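(* Let $(\mathcal C,\circ,I,\bullet,J)$ be a duoidal category with a reversion, and let $(H,m_H,u_H,\Delta_H,\varepsilon_H)$ be a bimonoid in it together with a morphism $\Sigma_H:H\to H^{-}$ in $\mathcal C$. In each statement below, an equality involving $P,X,Q$ without further specification is meant for all objects $X$ of $\mathcal C$ and: for $\varkappa$, all right $H$-modules $P$ in $(\mathcal C,\circ,I)$ and all left $H$-comodules $Q$ in $(\mathcal C,\bullet,J)$; for $\varsigma$, all right $H$-comodules $P$ in $(\mathcal C,\bullet,J)$ and all left $H$-modules $Q$ in $(\mathcal C,\circ,I)$. Then: 1) $\overline{\varkappa}^H_{P,X,Q}\varkappa^H_{P,X,Q}=\mathrm{Id}$ if and only if $\overline{\varkappa}^H_{H,I,H}\varkappa^H_{H,I,H}=\mathrm{Id}$ if and only if $\mathrm{Id}_H\star\Sigma_H=1^l_{H,H}$; 2) $\varkappa^H_{P,X,Q}\overline{\varkappa}^H_{P,X,Q}=\mathrm{Id}$ if $\Sigma_H\star\mathrm{Id}_H=1^r_{H,H}$; 3) $\overline{\varsigma}^H_{P,X,Q}\varsigma^H_{P,X,Q}=\mathrm{Id}$ if and only if $\overline{\varsigma}^H_{H,I,H}\varsigma^H_{H,I,H}=\mathrm{Id}$ if and only if $\Sigma_H\star\mathrm{Id}_H=1^r_{H,H}$; 4) $\varsigma^H_{P,X,Q}\overline{\varsigma}^H_{P,X,Q}=\mathrm{Id}$ if $\mathrm{Id}_H\star\Sigma_H=1^l_{H,H}$. As a consequence, both the Galois maps $\varkappa^H$ and the co-Galois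 maps $\varsigma^H$ are invertible with $\overline{\varkappa}^H_{P,X,Q}=(\varkappa^H_{P,X,Q})^{-1}$ and $\overline{\varsigma}^H_{P,X,Q}=(\varsigma^H_{P,X,Q})^{-1}$ if and only if $\Sigma_H$ is an antipode.
   Context: Conventions: composition is juxtaposition (right to left), an object also denotes its identity morphism, associativity constraints are suppressed. Duoidal category $(\mathcal C,\circ,I,\bullet,J)$: a category with monoidal structures $(\mathcal C,\circ,I)$, $(\mathcal C,\bullet,J)$ (left/right unit constraints $l^\circ,r^\circ$, resp. $l^\bullet,r^\bullet$), a natural transformation $\zeta_{A,B,C,D}:(A\bullet B)\circ(C\bullet D)\to(A\circ C)\bullet(B\circ D)$ and morphisms $\Delta_I:I\to I\bullet I$, $m_J:J\circ J\to J$, $\varepsilon_I=u_J:I\to J$ such that $(J,m_J,u_J)$ is a monoid in $(\mathcal C,\circ,I)$, $(I,\Delta_I,\varepsilon_I)$ is a comonoid in $(\mathcal C,\bullet,J)$, and $\zeta_{A,B,C\circ E,D\circ F}((A\bullet B)\circ\zeta_{C,D,E,F})=\zeta_{A\circ C,B\circ D,E,F}(\zeta_{A,B,C,D}\circ(E\bullet F))$, $((A\circ D)\bullet\zeta_{B,C,E,F})\zeta_{A,B\bullet C,D,E\bullet F}=(\zeta_{A,B,D,E}\bullet(C\circ F))\zeta_{A\bullet B,C,D\bullet E,F}$, $(l^\circ_A\bullet l^\circ_B)\zeta_{I,I,A,B}(\Delta_I\circ(A\bullet B))=l^\circ_{A\bullet B}$, $(r^\circ_A\bullet r^\circ_B)\zeta_{A,B,I,I}((A\bullet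 B)\circ\Delta_I)=r^\circ_{A\bullet B}$, $l^\bullet_{A\circ B}(m_J\bullet(A\circ B))\zeta_{J,A,J,B}=l^\bullet_A\circ l^\bullet_B$, $r^\bullet_{A\circ B}((A\circ B)\bullet m_J)\zeta_{A,J,B,J}=r^\bullet_A\circ r^\bullet_B$. Bimonoid: $(H,m_H,u_H,\Delta_H,\varepsilon_H)$ with $(H,m_H,u_H)$ a monoid in $(\mathcal C,\circ,I)$, $(H,\Delta_H,\varepsilon_H)$ a comonoid in $(\mathcal C,\bullet,J)$ and $\Delta_Hm_H=(m_H\bullet m_H)\zeta_{H,H,H,H}(\Delta_H\circ\Delta_H)$, $\varepsilon_Hm_H=m_J(\varepsilon_H\circ\varepsilon_H)$, $\Delta_Hu_H=(u_H\bullet u_H)\Delta_I$, $\varepsilon_Hu_H=\varepsilon_I$. Reversion: a functor $(-)^-:\mathcal C\to\mathcal C$ with lax monoidal structures $(\phi^\circ_{X,Y}:X^-\circ Y^-\to(Y\circ X)^-,\ \phi^\circ_0:I\to I^-)$ from $(\mathcal C,\circ^{\mathrm{rev}})$ to $(\mathcal C,\circ)$ and $(\phi^\bullet_{X,Y}:X^-\bullet Y^-\to(Y\bullet X)^-,\ \phi^\bullet_0:J\to J^-)$ from $(\mathcal C,\bullet^{\mathrm{rev}})$ to $(\mathcal C,\bullet)$ ($\mathrm{rev}$ = reversed tensor product), forming a double lax monoidal functor $(\mathcal C,\circ^{\mathrm{rev}},\bullet^{\mathrm{rev}})\to(\mathcal C,\circ,\bullet)$, i.e. $\phi^\bullet_{C\circ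 A,D\circ B}(\phi^\circ_{A,C}\bullet\phi^\circ_{B,D})\zeta_{A^-,B^-,C^-,D^-}=(\zeta_{D,C,B,A})^-\phi^\circ_{B\bullet A,D\bullet C}(\phi^\bullet_{A,B}\circ\phi^\bullet_{C,D})$, $\phi^\bullet_{I,I}(\phi^\circ_0\bullet\phi^\circ_0)\Delta_I=(\Delta_I)^-\phi^\circ_0$, $(m_J)^-\phi^\circ_{J,J}(\phi^\bullet_0\circ\phi^\bullet_0)=\phi^\bullet_0m_J$, $\phi^\bullet_0\varepsilon_I=(\varepsilon_I)^-\phi^\circ_0$; together with natural transformations $\gamma_{X,Y,Z,T}:((X\bullet Y^-)\circ Z)\bullet T\to X\circ(Z\bullet(Y\circ T))$, $\delta_{X,Y,Z,T}:X\bullet(Y\circ(Z^-\bullet T))\to((X\circ Z)\bullet Y)\circ T$, $\widetilde\gamma_{X,Y,Z,T}:X^-\bullet((Y\bullet Z)\circ T)\to Z\circ((X\circ Y)^-\bullet T)$, $\widetilde\delta_{X,Y,Z,T}:(X\circ(Y\bullet Z))\bullet T^-\to(X\bullet(Z\circ T)^-)\circ Y$. Put $\psi_{X,Y}=\gamma_{J,X,I,Y}(((l^\bullet_{X^-})^{-1}\circ I)\bullet Y)((r^\circ_{X^-})^{-1}\bullet Y):X^-\bullet Y\to J\circ(I\bullet(X\circ Y))$, $\varphi_{X,Y}=\delta_{X,I,Y,J}(X\bullet(I\circ(r^\bullet_{Y^-})^{-1}))(X\bullet(l^\circ_{Y^-})^{-1}):X\bullet Y^-\to((X\circ Y)\bullet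 I)\circ J$, $\widetilde\psi_{X,Y}=l^\circ_{(X\circ Y)^-}(I\circ r^\bullet_{(X\circ Y)^-})\widetilde\gamma_{X,Y,I,J}:X^-\bullet((Y\bullet I)\circ J)\to(X\circ Y)^-$, $\widetilde\varphi_{X,Y}=r^\circ_{(X\circ Y)^-}(l^\bullet_{(X\circ Y)^-}\circ I)\widetilde\delta_{J,I,X,Y}:(J\circ(I\bullet X))\bullet Y^-\to(X\circ Y)^-$. Axioms, for all objects ($\Delta_J:J\to J\bullet J$ is the inverse unit constraint): (R1) $\gamma_{X,Y,Z\circ U,T\circ V}\zeta_{(X\bullet Y^-)\circ Z,T,U,V}=(X\circ\zeta_{Z,Y\circ T,U,V})(\gamma_{X,Y,Z,T}\circ(U\bullet V))$. (R2) $((X\circ T)\bullet\gamma_{Y,Z,U,V})(\zeta_{X,Y\bullet Z^-,T,U}\bullet V)=\zeta_{X,Y,T,U\bullet(Z\circ V)}\gamma_{X\bullet Y,Z,T\bullet U,V}$. (R3) $\delta_{X\circ Z,Y\circ T,U,V}\zeta_{X,Y,Z,T\circ(U^-\bullet V)}=(\zeta_{X,Y,Z\circ U,T}\circ V)((X\bullet Y)\circ\delta_{Z,T,U,V})$. (R4) $(\delta_{X,Y,T,U}\bullet(Z\circ V))(X\bullet\zeta_{Y,Z,T^-\bullet U,V})=\zeta_{(X\circ T)\bullet Y,Z,U,V}\delta_{X,Y\bullet Z,T,U\bullet V}$. (R5) $\delta_{X,Y,T,U\bullet(Z\circ V)}(X\bullet\gamma_{Y,Z,T^-\bullet U,V})=\gamma_{(X\circ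 T)\bullet Y,Z,U,V}(\delta_{X,Y\bullet Z^-,T,U}\bullet V)$. (R6) $l^\circ_{I\bullet I}(I\circ(I\bullet l^\circ_I))\gamma_{I,I,I,I}(((I\bullet\phi^\circ_0)\Delta_I\circ I)\bullet I)=l^\circ_I\bullet I$. (R7) $r^\circ_{I\bullet I}((r^\circ_I\bullet I)\circ I)\delta_{I,I,I,I}(I\bullet(I\circ(\phi^\circ_0\bullet I)\Delta_I))=I\bullet r^\circ_I$. (R8) $\gamma_{X\circ Z,Y,J\circ J,U}((\delta_{X,Y^-,Z,J}\circ J)\bullet U)(((X\bullet(Y^-\circ(r^\bullet_{Z^-})^{-1}))\circ J)\bullet U)=(X\circ Z\circ\zeta_{J,Y,J,U})(X\circ Z\circ(l^\bullet_Y)^{-1}\circ(l^\bullet_U)^{-1})(X\circ l^\bullet_{Z\circ Y\circ U})\gamma_{X,Z\circ Y,J,U}(((X\bullet\phi^\circ_{Y,Z})\circ J)\bullet U)$. (R9) $\delta_{X,J\circ J,Z,Y\circ U}(X\bullet(J\circ\gamma_{J,Y,Z^-,U}))(X\bullet(J\circ(((l^\bullet_{Y^-})^{-1}\circ Z^-)\bullet U)))=(\zeta_{X,J,Z,J}\circ Y\circ U)((r^\bullet_X)^{-1}\circ(r^\bullet_Z)^{-1}\circ Y\circ U)(r^\bullet_{X\circ Z\circ Y}\circ U)\delta_{X,J,Z\circ Y,U}(X\bullet(J\circ(\phi^\circ_{Y,Z}\bullet U)))$. (R10) $\widetilde\varphi_{X\circ Y,Z}(\psi_{X,Y}\bullet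 Z^-)=\widetilde\psi_{X,Y\circ Z}(X^-\bullet\varphi_{Y,Z})$. (R11) $(r^\circ_X)^-l^\circ_{(X\circ I)^-}(I\circ r^\bullet_{(X\circ I)^-})\widetilde\gamma_{X,I,I,J}(X^-\bullet(\Delta_I\circ J))=r^\bullet_{X^-}(X^-\bullet l^\circ_J)$. (R12) $(l^\circ_X)^-r^\circ_{(I\circ X)^-}(l^\bullet_{(I\circ X)^-}\circ I)\widetilde\delta_{J,I,I,X}((J\circ\Delta_I)\bullet X^-)=l^\bullet_{X^-}(r^\circ_J\bullet X^-)$. (R13) $\gamma_{X,Y,T\bullet(Z\circ U),V}(\gamma_{X\bullet Y^-,Z,T,U}\bullet V)=(X\circ(T\bullet\zeta_{Z,Y,U,V}))\gamma_{X,Z\bullet Y,T,U\bullet V}(((X\bullet\phi^\bullet_{Y,Z})\circ T)\bullet U\bullet V)$. (R14) $\delta_{X,(Y\circ T)\bullet Z,U,V}(X\bullet\delta_{Y,Z,T,U^-\bullet V})=((\zeta_{X,Y,U,T}\bullet Z)\circ V)\delta_{X\bullet Y,Z,U\bullet T,V}(X\bullet Y\bullet(Z\circ(\phi^\bullet_{T,U}\bullet V)))$. (R15) $(X\circ\gamma_{Z,T,U,Y\circ V})\gamma_{X,Y,(Z\bullet T^-)\circ U,V}=\gamma_{X\circ Z,T\circ Y,U,V}((((X\circ Z)\bullet\phi^\circ_{Y,T})\circ U)\bullet V)((\zeta_{X,Y^-,Z,T^-}\circ U)\bullet V)$. (R16) $(\delta_{X\circ U,Y,Z,T}\circ V)\delta_{X,Y\circ(Z^-\bullet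 T),U,V}=\delta_{X,Y,U\circ Z,T\circ V}(X\bullet(Y\circ(\phi^\circ_{Z,U}\bullet(T\circ V))))(X\bullet(Y\circ\zeta_{Z^-,T,U^-,V}))$. (R17) $r^\circ_J(J\circ r^\bullet_I)(J\circ(I\bullet m_J))\gamma_{J,J,I,J}(((J\bullet\phi^\bullet_0)\Delta_J\circ I)\bullet J)=r^\bullet_J(r^\circ_J\bullet J)$. (R18) $l^\circ_J(l^\bullet_I\circ J)((m_J\bullet I)\circ J)\delta_{J,I,J,J}(J\bullet(I\circ(\phi^\bullet_0\bullet J)\Delta_J))=l^\bullet_J(J\bullet l^\circ_J)$. Convolution: $\mathrm{Id}_H\star\Sigma_H=((m_H\bullet I)\circ J)\varphi_{H,H}(H\bullet\Sigma_H)\Delta_H$; $\Sigma_H\star\mathrm{Id}_H=(J\circ(I\bullet m_H))\psi_{H,H}(\Sigma_H\bullet H)\Delta_H$; $1^l_{H,H}=((u_H\bullet I)\circ J)(\Delta_I\circ J)(l^\circ_J)^{-1}\varepsilon_H$; $1^r_{H,H}=(J\circ(I\bullet u_H))(J\circ\Delta_I)(r^\circ_J)^{-1}\varepsilon_H$. $\Sigma_H$ is an antipode if $\mathrm{Id}_H\star\Sigma_H=1^l_{H,H}$ and $\Sigma_H\star\mathrm{Id}_H=1^r_{H,H}$. Galois maps: for a right $H$-module $(P,\mu_P)$ in $(\mathcal C,\circ)$, an object $X$ and a left $H$-comodule $(Q,\rho_Q)$ in $(\mathcal C,\bullet)$: $\varkappa^H_{P,X,Q}=(\mu_P\bullet(X\circ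 Q))\zeta_{P,X,H,Q}((P\bullet X)\circ\rho_Q):(P\bullet X)\circ Q\to P\bullet(X\circ Q)$, $\overline\varkappa^H_{P,X,Q}=((\mu_P\bullet X)\circ Q)\delta_{P,X,H,Q}(P\bullet(X\circ(\Sigma_H\bullet Q)\rho_Q)):P\bullet(X\circ Q)\to(P\bullet X)\circ Q$. Co-Galois maps: for a right $H$-comodule $(P,\rho_P)$ in $(\mathcal C,\bullet)$, an object $X$ and a left $H$-module $(Q,\mu_Q)$ in $(\mathcal C,\circ)$: $\varsigma^H_{P,X,Q}=((P\circ X)\bullet\mu_Q)\zeta_{P,H,X,Q}(\rho_P\circ(X\bullet Q)):P\circ(X\bullet Q)\to(P\circ X)\bullet Q$, $\overline\varsigma^H_{P,X,Q}=(P\circ(X\bullet\mu_Q))\gamma_{P,H,X,Q}(((P\bullet\Sigma_H)\rho_P\circ X)\bullet Q):(P\circ X)\bullet Q\to P\circ(X\bullet Q)$. $H$ is a (co)module over itself via $m_H$ and $\Delta_H$. *)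

theory Defs
  imports Main
begin

text \<open>
  Categories are given by a type of objects and a type of arrows.  Composition is a total
  function on arrows, but only its values on composable pairs are constrained.
\<close>

record ('o, 'm) cat =
  src :: "'m \<Rightarrow> 'o" ("src\<index>")
  tgt :: "'m \<Rightarrow> 'o" ("tgt\<index>")
  ident :: "'o \<Rightarrow> 'm" ("\<langle>_\<rangle>\<index>")
  comp :: "'m \<Rightarrow> 'm \<Rightarrow> 'm" (infixl "\<cdot>\<index>" 60)

definition hom :: "('o, 'm, 'x) cat_scheme \<Rightarrow> 'o \<Rightarrow> 'o \<Rightarrow> 'm set" (infix "\<rightarrow>\<index>" 55)
  where "A \<rightarrow>\<^bsub>C\<^esub> B = {f. src\<^bsub>C\<^esub> f = A \<and> tgt\<^bsub>C\<^esub> f = B}"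

definition inverse_of :: "('o, 'm, 'x) cat_scheme \<Rightarrow> 'm \<Rightarrow> 'm \<Rightarrow> bool"
  where "inverse_of C f g \<longleftrightarrow>
    g \<in> tgt\<^bsub>C\<^esub> f \<rightarrow>\<^bsub>C\<^esub> src\<^bsub>C\<^esub> f \<and>
    g \<cdot>\<^bsub>C\<^esub> f = \<langle>src\<^bsub>C\<^esub> f\<rangle>\<^bsub>C\<^esub> \<and> f \<cdot>\<^bsub>C\<^esub> g = \<langle>tgt\<^bsub>C\<^esub> f\<rangle>\<^bsub>C\<^esub>"

definition is_iso :: "('o, 'm, 'x) cat_scheme \<Rightarrow> 'm \<Rightarrow> bool"
  where "is_iso C f \<longleftrightarrow> (\<exists>g. inverse_of C f g)"

definition inv_arr :: "('o, 'm, 'x) cat_scheme \<Rightarrow> 'm \<Rightarrow> 'm" ("_\<inverse>\<index>" [1000] 999)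
  where "f\<inverse>\<^bsub>C\<^esub> = (THE g. inverse_of C f g)"

locale category =
  fixes C :: "('o, 'm, 'x) cat_scheme" (structure)
  assumes ident_hom: "\<langle>A\<rangle> \<in> A \<rightarrow> A"
    and comp_hom: "\<lbrakk>f \<in> A \<rightarrow> B; g \<in> B \<rightarrow> D\<rbrakk> \<Longrightarrow> g \<cdot> f \<in> A \<rightarrow> D"
    and comp_ident_left: "f \<in> A \<rightarrow> B \<Longrightarrow> \<langle>B\<rangle> \<cdot> f = f"
    and comp_ident_right: "f \<in> A \<rightarrow> B \<Longrightarrow> f \<cdot> \<langle>A\<rangle> = f"
    and comp_assoc:
      "\<lbrakk>f \<in> A \<rightarrow> B; g \<in> B \<rightarrow> D; h \<in> D \<rightarrow> E\<rbrakk> \<Longrightarrow> (h \<cdot> g) \<cdot> f = h \<cdot> (g \<cdot> f)"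


section \<open>Monoidal structures\<close>

record ('o, 'm) tensor =
  tens_ob :: "'o \<Rightarrow> 'o \<Rightarrow> 'o" (infixl "\<otimes>\<index>" 70)
  tens_arr :: "'m \<Rightarrow> 'm \<Rightarrow> 'm" (infixl "\<otimes>\<^sub>a\<index>" 70)
  tens_unit :: 'o ("\<one>\<index>")
  tens_assoc :: "'o \<Rightarrow> 'o \<Rightarrow> 'o \<Rightarrow> 'm" ("\<alpha>\<index>")
  tens_left :: "'o \<Rightarrow> 'm" ("\<l>\<index>")
  tens_right :: "'o \<Rightarrow> 'm" ("\<r>\<index>")

locale monoidal_category = category C
  for C :: "('o, 'm, 'x) cat_scheme" (structure) +
  fixes T :: "('o, 'm) tensor"
  assumes tens_hom:
      "\<lbrakk>f \<in> A \<rightarrow> A'; g \<in> B \<rightarrow> B'\<rbrakk> \<Longrightarrow> f \<otimes>\<^sub>a\<^bsub>T\<^esub> g \<in> A \<otimes>\<^bsub>T\<^esub> B \<rightarrow> A' \<otimes>\<^bsub>T\<^esub> B'"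
    and tens_ident: "\<langle>A\<rangle> \<otimes>\<^sub>a\<^bsub>T\<^esub> \<langle>B\<rangle> = \<langle>A \<otimes>\<^bsub>T\<^esub> B\<rangle>"
    and tens_comp:
      "\<lbrakk>f \<in> A \<rightarrow> A'; f' \<in> A' \<rightarrow> A''; g \<in> B \<rightarrow> B'; g' \<in> B' \<rightarrow> B''\<rbrakk> \<Longrightarrow>
        (f' \<cdot> f) \<otimes>\<^sub>a\<^bsub>T\<^esub> (g' \<cdot> g) = (f' \<otimes>\<^sub>a\<^bsub>T\<^esub> g') \<cdot> (f \<otimes>\<^sub>a\<^bsub>T\<^esub> g)"
    and assoc_hom:
      "\<alpha>\<^bsub>T\<^esub> A B D \<in> (A \<otimes>\<^bsub>T\<^esub> B) \<otimes>\<^bsub>T\<^esub> D \<rightarrow> A \<otimes>\<^bsub>T\<^esub> (B \<otimes>\<^bsub>T\<^esub> D)"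
    and assoc_iso: "is_iso C (\<alpha>\<^bsub>T\<^esub> A B D)"
    and assoc_nat:
      "\<lbrakk>f \<in> A \<rightarrow> A'; g \<in> B \<rightarrow> B'; h \<in> D \<rightarrow> D'\<rbrakk> \<Longrightarrow>
        \<alpha>\<^bsub>T\<^esub> A' B' D' \<cdot> ((f \<otimes>\<^sub>a\<^bsub>T\<^esub> g) \<otimes>\<^sub>a\<^bsub>T\<^esub> h) = (f \<otimes>\<^sub>a\<^bsub>T\<^esub> (g \<otimes>\<^sub>a\<^bsub>T\<^esub> h)) \<cdot> \<alpha>\<^bsub>T\<^esub> A B D"
    and left_hom: "\<l>\<^bsub>T\<^esub> A \<in> \<one>\<^bsub>T\<^esub> \<otimes>\<^bsub>T\<^esub> A \<rightarrow> A"
    and left_iso: "is_iso C (\<l>\<^bsub>T\<^esub> A)"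
    and left_nat: "f \<in> A \<rightarrow> A' \<Longrightarrow> \<l>\<^bsub>T\<^esub> A' \<cdot> (\<langle>\<one>\<^bsub>T\<^esub>\<rangle> \<otimes>\<^sub>a\<^bsub>T\<^esub> f) = f \<cdot> \<l>\<^bsub>T\<^esub> A"
    and right_hom: "\<r>\<^bsub>T\<^esub> A \<in> A \<otimes>\<^bsub>T\<^esub> \<one>\<^bsub>T\<^esub> \<rightarrow> A"
    and right_iso: "is_iso C (\<r>\<^bsub>T\<^esub> A)"
    and right_nat: "f \<in> A \<rightarrow> A' \<Longrightarrow> \<r>\<^bsub>T\<^esub> A' \<cdot> (f \<otimes>\<^sub>a\<^bsub>T\<^esub> \<langle>\<one>\<^bsub>T\<^esub>\<rangle>) = f \<cdot> \<r>\<^bsub>T\<^esub> A"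
    and pentagon:
      "(\<langle>A\<rangle> \<otimes>\<^sub>a\<^bsub>T\<^esub> \<alpha>\<^bsub>T\<^esub> B D E) \<cdot> \<alpha>\<^bsub>T\<^esub> A (B \<otimes>\<^bsub>T\<^esub> D) E \<cdot> (\<alpha>\<^bsub>T\<^esub> A B D \<otimes>\<^sub>a\<^bsub>T\<^esub> \<langle>E\<rangle>) =
        \<alpha>\<^bsub>T\<^esub> A B (D \<otimes>\<^bsub>T\<^esub> E) \<cdot> \<alpha>\<^bsub>T\<^esub> (A \<otimes>\<^bsub>T\<^esub> B) D E"
    and triangle:
      "(\<langle>A\<rangle> \<otimes>\<^sub>a\<^bsub>T\<^esub> \<l>\<^bsub>T\<^esub> B) \<cdot> \<alpha>\<^bsub>T\<^esub> A \<one>\<^bsub>T\<^esub> B = \<r>\<^bsub>T\<^esub> A \<otimes>\<^sub>a\<^bsub>T\<^esub> \<langle>B\<rangle>"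

text \<open>The reversed tensor product \<open>A \<otimes>\<^sup>r\<^sup>e\<^sup>v B = B \<otimes> A\<close>.\<close>

definition rev_tensor ::
    "('o, 'm, 'x) cat_scheme \<Rightarrow> ('o, 'm) tensor \<Rightarrow> ('o, 'm) tensor"
  where "rev_tensor C T =
    \<lparr>tens_ob = (\<lambda>A B. B \<otimes>\<^bsub>T\<^esub> A),
     tens_arr = (\<lambda>f g. g \<otimes>\<^sub>a\<^bsub>T\<^esub> f),
     tens_unit = \<one>\<^bsub>T\<^esub>,
     tens_assoc = (\<lambda>A B D. (\<alpha>\<^bsub>T\<^esub> D B A)\<inverse>\<^bsub>C\<^esub>),
     tens_left = \<r>\<^bsub>T\<^esub>,
     tens_right = \<l>\<^bsub>T\<^esub>\<rparr>"

locale endofunctor = category C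
  for C :: "('o, 'm, 'x) cat_scheme" (structure) +
  fixes F :: "'o \<Rightarrow> 'o" and F' :: "'m \<Rightarrow> 'm"
  assumes functor_hom: "f \<in> A \<rightarrow> B \<Longrightarrow> F' f \<in> F A \<rightarrow> F B"
    and functor_ident: "F' \<langle>A\<rangle> = \<langle>F A\<rangle>"
    and functor_comp: "\<lbrakk>f \<in> A \<rightarrow> B; g \<in> B \<rightarrow> D\<rbrakk> \<Longrightarrow> F' (g \<cdot> f) = F' g \<cdot> F' f"

text \<open>
  A lax monoidal functor \<open>(\<C>, S) \<rightarrow> (\<C>, T)\<close> with object part \<open>F\<close> and arrow part \<open>F'\<close>.
\<close>

locale lax_monoidal_endofunctor = endofunctor C F F'
  for C :: "('o, 'm, 'x) cat_scheme" (structure)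
    and S :: "('o, 'm) tensor" and T :: "('o, 'm) tensor"
    and F :: "'o \<Rightarrow> 'o" and F' :: "'m \<Rightarrow> 'm" +
  fixes \<Phi> :: "'o \<Rightarrow> 'o \<Rightarrow> 'm" and \<Phi>\<^sub>0 :: 'm
  assumes lax_hom: "\<Phi> X Y \<in> F X \<otimes>\<^bsub>T\<^esub> F Y \<rightarrow> F (X \<otimes>\<^bsub>S\<^esub> Y)"
    and lax_nat:
      "\<lbrakk>f \<in> X \<rightarrow> X'; g \<in> Y \<rightarrow> Y'\<rbrakk> \<Longrightarrow>
        \<Phi> X' Y' \<cdot> (F' f \<otimes>\<^sub>a\<^bsub>T\<^esub> F' g) = F' (f \<otimes>\<^sub>a\<^bsub>S\<^esub> g) \<cdot> \<Phi> X Y"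
    and lax_unit_hom: "\<Phi>\<^sub>0 \<in> \<one>\<^bsub>T\<^esub> \<rightarrow> F \<one>\<^bsub>S\<^esub>"
    and lax_assoc:
      "F' (\<alpha>\<^bsub>S\<^esub> X Y Z) \<cdot> \<Phi> (X \<otimes>\<^bsub>S\<^esub> Y) Z \<cdot> (\<Phi> X Y \<otimes>\<^sub>a\<^bsub>T\<^esub> \<langle>F Z\<rangle>) =
        \<Phi> X (Y \<otimes>\<^bsub>S\<^esub> Z) \<cdot> (\<langle>F X\<rangle> \<otimes>\<^sub>a\<^bsub>T\<^esub> \<Phi> Y Z) \<cdot> \<alpha>\<^bsub>T\<^esub> (F X) (F Y) (F Z)"
    and lax_left:
      "F' (\<l>\<^bsub>S\<^esub> X) \<cdot> \<Phi> \<one>\<^bsub>S\<^esub> X \<cdot> (\<Phi>\<^sub>0 \<otimes>\<^sub>a\<^bsub>T\<^esub> \<langle>F X\<rangle>) = \<l>\<^bsub>T\<^esub> (F X)"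
    and lax_right:
      "F' (\<r>\<^bsub>S\<^esub> X) \<cdot> \<Phi> X \<one>\<^bsub>S\<^esub> \<cdot> (\<langle>F X\<rangle> \<otimes>\<^sub>a\<^bsub>T\<^esub> \<Phi>\<^sub>0) = \<r>\<^bsub>T\<^esub> (F X)"


section \<open>Monoids, comonoids, modules and comodules\<close>

locale monoid_in =
  fixes C :: "('o, 'm, 'x) cat_scheme" (structure) and T :: "('o, 'm) tensor"
    and M :: 'o and m :: 'm and u :: 'm
  assumes mult_hom: "m \<in> M \<otimes>\<^bsub>T\<^esub> M \<rightarrow> M"
    and unit_hom: "u \<in> \<one>\<^bsub>T\<^esub> \<rightarrow> M"
    and mult_assoc: "m \<cdot> (m \<otimes>\<^sub>a\<^bsub>T\<^esub> \<langle>M\<rangle>) = m \<cdot> (\<langle>M\<rangle> \<otimes>\<^sub>a\<^bsub>T\<^esub> m) \<cdot> \<alpha>\<^bsub>T\<^esub> M M M"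
    and mult_unit_left: "m \<cdot> (u \<otimes>\<^sub>a\<^bsub>T\<^esub> \<langle>M\<rangle>) = \<l>\<^bsub>T\<^esub> M"
    and mult_unit_right: "m \<cdot> (\<langle>M\<rangle> \<otimes>\<^sub>a\<^bsub>T\<^esub> u) = \<r>\<^bsub>T\<^esub> M"

locale comonoid_in =
  fixes C :: "('o, 'm, 'x) cat_scheme" (structure) and T :: "('o, 'm) tensor"
    and M :: 'o and d :: 'm and e :: 'm
  assumes comult_hom: "d \<in> M \<rightarrow> M \<otimes>\<^bsub>T\<^esub> M"
    and counit_hom: "e \<in> M \<rightarrow> \<one>\<^bsub>T\<^esub>"
    and comult_coassoc: "\<alpha>\<^bsub>T\<^esub> M M M \<cdot> (d \<otimes>\<^sub>a\<^bsub>T\<^esub> \<langle>M\<rangle>) \<cdot> d = (\<langle>M\<rangle> \<otimes>\<^sub>a\<^bsub>T\<^esub> d) \<cdot> d"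
    and comult_counit_left: "\<l>\<^bsub>T\<^esub> M \<cdot> (e \<otimes>\<^sub>a\<^bsub>T\<^esub> \<langle>M\<rangle>) \<cdot> d = \<langle>M\<rangle>"
    and comult_counit_right: "\<r>\<^bsub>T\<^esub> M \<cdot> (\<langle>M\<rangle> \<otimes>\<^sub>a\<^bsub>T\<^esub> e) \<cdot> d = \<langle>M\<rangle>"

locale right_module_in = monoid_in C T M m u
  for C :: "('o, 'm, 'x) cat_scheme" (structure) and T :: "('o, 'm) tensor"
    and M :: 'o and m :: 'm and u :: 'm +
  fixes P :: 'o and \<mu> :: 'm
  assumes right_act_hom: "\<mu> \<in> P \<otimes>\<^bsub>T\<^esub> M \<rightarrow> P"
    and right_act_mult: "\<mu> \<cdot> (\<mu> \<otimes>\<^sub>a\<^bsub>T\<^esub> \<langle>M\<rangle>) = \<mu> \<cdot> (\<langle>P\<rangle> \<otimes>\<^sub>a\<^bsub>T\<^esub> m) \<cdot> \<alpha>\<^bsub>T\<^esub> P M M"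
    and right_act_unit: "\<mu> \<cdot> (\<langle>P\<rangle> \<otimes>\<^sub>a\<^bsub>T\<^esub> u) = \<r>\<^bsub>T\<^esub> P"

locale left_module_in = monoid_in C T M m u
  for C :: "('o, 'm, 'x) cat_scheme" (structure) and T :: "('o, 'm) tensor"
    and M :: 'o and m :: 'm and u :: 'm +
  fixes Q :: 'o and \<mu> :: 'm
  assumes left_act_hom: "\<mu> \<in> M \<otimes>\<^bsub>T\<^esub> Q \<rightarrow> Q"
    and left_act_mult: "\<mu> \<cdot> (m \<otimes>\<^sub>a\<^bsub>T\<^esub> \<langle>Q\<rangle>) = \<mu> \<cdot> (\<langle>M\<rangle> \<otimes>\<^sub>a\<^bsub>T\<^esub> \<mu>) \<cdot> \<alpha>\<^bsub>T\<^esub> M M Q"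
    and left_act_unit: "\<mu> \<cdot> (u \<otimes>\<^sub>a\<^bsub>T\<^esub> \<langle>Q\<rangle>) = \<l>\<^bsub>T\<^esub> Q"

locale right_comodule_in = comonoid_in C T M d e
  for C :: "('o, 'm, 'x) cat_scheme" (structure) and T :: "('o, 'm) tensor"
    and M :: 'o and d :: 'm and e :: 'm +
  fixes P :: 'o and \<rho> :: 'm
  assumes right_coact_hom: "\<rho> \<in> P \<rightarrow> P \<otimes>\<^bsub>T\<^esub> M"
    and right_coact_comult:
      "\<alpha>\<^bsub>T\<^esub> P M M \<cdot> (\<rho> \<otimes>\<^sub>a\<^bsub>T\<^esub> \<langle>M\<rangle>) \<cdot> \<rho> = (\<langle>P\<rangle> \<otimes>\<^sub>a\<^bsub>T\<^esub> d) \<cdot> \<rho>"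
    and right_coact_counit: "\<r>\<^bsub>T\<^esub> P \<cdot> (\<langle>P\<rangle> \<otimes>\<^sub>a\<^bsub>T\<^esub> e) \<cdot> \<rho> = \<langle>P\<rangle>"

locale left_comodule_in = comonoid_in C T M d e
  for C :: "('o, 'm, 'x) cat_scheme" (structure) and T :: "('o, 'm) tensor"
    and M :: 'o and d :: 'm and e :: 'm +
  fixes Q :: 'o and \<rho> :: 'm
  assumes left_coact_hom: "\<rho> \<in> Q \<rightarrow> M \<otimes>\<^bsub>T\<^esub> Q"
    and left_coact_comult:
      "\<alpha>\<^bsub>T\<^esub> M M Q \<cdot> (d \<otimes>\<^sub>a\<^bsub>T\<^esub> \<langle>Q\<rangle>) \<cdot> \<rho> = (\<langle>M\<rangle> \<otimes>\<^sub>a\<^bsub>T\<^esub> \<rho>) \<cdot> \<rho>"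
    and left_coact_counit: "\<l>\<^bsub>T\<^esub> Q \<cdot> (e \<otimes>\<^sub>a\<^bsub>T\<^esub> \<langle>Q\<rangle>) \<cdot> \<rho> = \<langle>Q\<rangle>"


section \<open>Duoidal categories\<close>

record ('o, 'm) duoidal = "('o, 'm) cat" +
  circ :: "('o, 'm) tensor"
  bull :: "('o, 'm) tensor"
  interchange :: "'o \<Rightarrow> 'o \<Rightarrow> 'o \<Rightarrow> 'o \<Rightarrow> 'm" ("\<zeta>\<index>")
  comult_I :: 'm ("\<Delta>\<^sub>I\<index>")
  mult_J :: 'm ("m\<^sub>J\<index>")
  counit_I :: 'm ("\<epsilon>\<^sub>I\<index>")

text \<open>
  The tensor product written with a white circle in the literature is \<open>\<odot>\<close> here; the
  subscript \<open>a\<close> marks the tensor product of arrows.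
\<close>

abbreviation circ_ob (infixl "\<odot>\<index>" 70) where "A \<odot>\<^bsub>C\<^esub> B \<equiv> A \<otimes>\<^bsub>circ C\<^esub> B"
abbreviation circ_arr (infixl "\<odot>\<^sub>a\<index>" 70) where "f \<odot>\<^sub>a\<^bsub>C\<^esub> g \<equiv> f \<otimes>\<^sub>a\<^bsub>circ C\<^esub> g"
abbreviation circ_unit ("\<I>\<index>") where "\<I>\<^bsub>C\<^esub> \<equiv> \<one>\<^bsub>circ C\<^esub>"
abbreviation circ_assoc ("\<alpha>\<^sup>\<odot>\<index>") where "\<alpha>\<^sup>\<odot>\<^bsub>C\<^esub> \<equiv> \<alpha>\<^bsub>circ C\<^esub>"
abbreviation circ_left ("\<l>\<^sup>\<odot>\<index>") where "\<l>\<^sup>\<odot>\<^bsub>C\<^esub> \<equiv> \<l>\<^bsub>circ C\<^esub>"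
abbreviation circ_right ("\<r>\<^sup>\<odot>\<index>") where "\<r>\<^sup>\<odot>\<^bsub>C\<^esub> \<equiv> \<r>\<^bsub>circ C\<^esub>"

abbreviation bull_ob (infixl "\<bullet>\<index>" 70) where "A \<bullet>\<^bsub>C\<^esub> B \<equiv> A \<otimes>\<^bsub>bull C\<^esub> B"
abbreviation bull_arr (infixl "\<bullet>\<^sub>a\<index>" 70) where "f \<bullet>\<^sub>a\<^bsub>C\<^esub> g \<equiv> f \<otimes>\<^sub>a\<^bsub>bull C\<^esub> g"
abbreviation bull_unit ("\<J>\<index>") where "\<J>\<^bsub>C\<^esub> \<equiv> \<one>\<^bsub>bull C\<^esub>"
abbreviation bull_assoc ("\<alpha>\<^sup>\<bullet>\<index>") where "\<alpha>\<^sup>\<bullet>\<^bsub>C\<^esub> \<equiv> \<alpha>\<^bsub>bull C\<^esub>"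
abbreviation bull_left ("\<l>\<^sup>\<bullet>\<index>") where "\<l>\<^sup>\<bullet>\<^bsub>C\<^esub> \<equiv> \<l>\<^bsub>bull C\<^esub>"
abbreviation bull_right ("\<r>\<^sup>\<bullet>\<index>") where "\<r>\<^sup>\<bullet>\<^bsub>C\<^esub> \<equiv> \<r>\<^bsub>bull C\<^esub>"

definition comult_J :: "('o, 'm, 'x) duoidal_scheme \<Rightarrow> 'm" ("\<Delta>\<^sub>J\<index>")
  where "\<Delta>\<^sub>J\<^bsub>C\<^esub> = (\<l>\<^sup>\<bullet>\<^bsub>C\<^esub> \<J>\<^bsub>C\<^esub>)\<inverse>\<^bsub>C\<^esub>"

text \<open>
  The associativity constraints, usually suppressed, are inserted explicitly here and in the
  axioms of a reversion.
\<close>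

locale duoidal_category =
  circ: monoidal_category C "circ C" + bull: monoidal_category C "bull C"
  for C :: "('o, 'm, 'x) duoidal_scheme" (structure) +
  assumes zeta_hom: "\<zeta> A B D E \<in> (A \<bullet> B) \<odot> (D \<bullet> E) \<rightarrow> (A \<odot> D) \<bullet> (B \<odot> E)"
    and zeta_nat:
      "\<lbrakk>f \<in> A \<rightarrow> A'; g \<in> B \<rightarrow> B'; h \<in> D \<rightarrow> D'; k \<in> E \<rightarrow> E'\<rbrakk> \<Longrightarrow>
        \<zeta> A' B' D' E' \<cdot> ((f \<bullet>\<^sub>a g) \<odot>\<^sub>a (h \<bullet>\<^sub>a k)) =
        ((f \<odot>\<^sub>a h) \<bullet>\<^sub>a (g \<odot>\<^sub>a k)) \<cdot> \<zeta> A B D E"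
    and J_monoid: "monoid_in C (circ C) \<J> m\<^sub>J \<epsilon>\<^sub>I"
    and I_comonoid: "comonoid_in C (bull C) \<I> \<Delta>\<^sub>I \<epsilon>\<^sub>I"
    and zeta_circ_assoc:
      "\<zeta> A B (D \<odot> F) (E \<odot> G) \<cdot> (\<langle>A \<bullet> B\<rangle> \<odot>\<^sub>a \<zeta> D E F G) \<cdot> \<alpha>\<^sup>\<odot> (A \<bullet> B) (D \<bullet> E) (F \<bullet> G) =
        (\<alpha>\<^sup>\<odot> A D F \<bullet>\<^sub>a \<alpha>\<^sup>\<odot> B E G) \<cdot> \<zeta> (A \<odot> D) (B \<odot> E) F G \<cdot> (\<zeta> A B D E \<odot>\<^sub>a \<langle>F \<bullet> G\<rangle>)"
    and zeta_bull_assoc: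
      "(\<langle>A \<odot> E\<rangle> \<bullet>\<^sub>a \<zeta> B D F G) \<cdot> \<zeta> A (B \<bullet> D) E (F \<bullet> G) \<cdot> (\<alpha>\<^sup>\<bullet> A B D \<odot>\<^sub>a \<alpha>\<^sup>\<bullet> E F G) =
        \<alpha>\<^sup>\<bullet> (A \<odot> E) (B \<odot> F) (D \<odot> G) \<cdot> (\<zeta> A B E F \<bullet>\<^sub>a \<langle>D \<odot> G\<rangle>) \<cdot> \<zeta> (A \<bullet> B) D (E \<bullet> F) G"
    and zeta_circ_left:
      "(\<l>\<^sup>\<odot> A \<bullet>\<^sub>a \<l>\<^sup>\<odot> B) \<cdot> \<zeta> \<I> \<I> A B \<cdot> (\<Delta>\<^sub>I \<odot>\<^sub>a \<langle>A \<bullet> B\<rangle>) = \<l>\<^sup>\<odot> (A \<bullet> B)"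
    and zeta_circ_right:
      "(\<r>\<^sup>\<odot> A \<bullet>\<^sub>a \<r>\<^sup>\<odot> B) \<cdot> \<zeta> A B \<I> \<I> \<cdot> (\<langle>A \<bullet> B\<rangle> \<odot>\<^sub>a \<Delta>\<^sub>I) = \<r>\<^sup>\<odot> (A \<bullet> B)"
    and zeta_bull_left:
      "\<l>\<^sup>\<bullet> (A \<odot> B) \<cdot> (m\<^sub>J \<bullet>\<^sub>a \<langle>A \<odot> B\<rangle>) \<cdot> \<zeta> \<J> A \<J> B = \<l>\<^sup>\<bullet> A \<odot>\<^sub>a \<l>\<^sup>\<bullet> B"
    and zeta_bull_right:
      "\<r>\<^sup>\<bullet> (A \<odot> B) \<cdot> (\<langle>A \<odot> B\<rangle> \<bullet>\<^sub>a m\<^sub>J) \<cdot> \<zeta> A \<J> B \<J> = \<r>\<^sup>\<bullet> A \<odot>\<^sub>a \<r>\<^sup>\<bullet> B"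

locale bimonoid_in =
  monoid_in C "circ C" H m u + comonoid_in C "bull C" H d e
  for C :: "('o, 'm, 'x) duoidal_scheme" (structure)
    and H :: 'o and m :: 'm and u :: 'm and d :: 'm and e :: 'm +
  assumes comult_mult: "d \<cdot> m = (m \<bullet>\<^sub>a m) \<cdot> \<zeta> H H H H \<cdot> (d \<odot>\<^sub>a d)"
    and counit_mult: "e \<cdot> m = m\<^sub>J \<cdot> (e \<odot>\<^sub>a e)"
    and comult_unit: "d \<cdot> u = (u \<bullet>\<^sub>a u) \<cdot> \<Delta>\<^sub>I"
    and counit_unit: "e \<cdot> u = \<epsilon>\<^sub>I"


section \<open>Reversions\<close>

record ('o, 'm) reversion = "('o, 'm) duoidal" +
  rev_ob :: "'o \<Rightarrow> 'o" ("_\<^sup>-\<index>" [1000] 999)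
  rev_arr :: "'m \<Rightarrow> 'm" ("_\<^sup>-\<^sub>a\<index>" [1000] 999)
  phi_circ :: "'o \<Rightarrow> 'o \<Rightarrow> 'm" ("\<phi>\<^sup>\<odot>\<index>")
  phi_circ_0 :: 'm ("\<phi>\<^sup>\<odot>\<^sub>0\<index>")
  phi_bull :: "'o \<Rightarrow> 'o \<Rightarrow> 'm" ("\<phi>\<^sup>\<bullet>\<index>")
  phi_bull_0 :: 'm ("\<phi>\<^sup>\<bullet>\<^sub>0\<index>")
  gamma :: "'o \<Rightarrow> 'o \<Rightarrow> 'o \<Rightarrow> 'o \<Rightarrow> 'm" ("\<gamma>\<index>")
  delta :: "'o \<Rightarrow> 'o \<Rightarrow> 'o \<Rightarrow> 'o \<Rightarrow> 'm" ("\<delta>\<index>")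
  gamma_tilde :: "'o \<Rightarrow> 'o \<Rightarrow> 'o \<Rightarrow> 'o \<Rightarrow> 'm" ("\<gamma>\<^sup>\<sim>\<index>")
  delta_tilde :: "'o \<Rightarrow> 'o \<Rightarrow> 'o \<Rightarrow> 'o \<Rightarrow> 'm" ("\<delta>\<^sup>\<sim>\<index>")

context
  fixes C :: "('o, 'm, 'x) reversion_scheme" (structure)
begin

definition psi :: "'o \<Rightarrow> 'o \<Rightarrow> 'm"
  where "psi X Y =
    \<gamma> \<J> X \<I> Y \<cdot> (((\<l>\<^sup>\<bullet> (X\<^sup>-))\<inverse> \<odot>\<^sub>a \<langle>\<I>\<rangle>) \<bullet>\<^sub>a \<langle>Y\<rangle>) \<cdot> ((\<r>\<^sup>\<odot> (X\<^sup>-))\<inverse> \<bullet>\<^sub>a \<langle>Y\<rangle>)"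

definition varphi :: "'o \<Rightarrow> 'o \<Rightarrow> 'm"
  where "varphi X Y =
    \<delta> X \<I> Y \<J> \<cdot> (\<langle>X\<rangle> \<bullet>\<^sub>a (\<langle>\<I>\<rangle> \<odot>\<^sub>a (\<r>\<^sup>\<bullet> (Y\<^sup>-))\<inverse>)) \<cdot> (\<langle>X\<rangle> \<bullet>\<^sub>a (\<l>\<^sup>\<odot> (Y\<^sup>-))\<inverse>)"

definition psi_tilde :: "'o \<Rightarrow> 'o \<Rightarrow> 'm"
  where "psi_tilde X Y =
    \<l>\<^sup>\<odot> ((X \<odot> Y)\<^sup>-) \<cdot> (\<langle>\<I>\<rangle> \<odot>\<^sub>a \<r>\<^sup>\<bullet> ((X \<odot> Y)\<^sup>-)) \<cdot> \<gamma>\<^sup>\<sim> X Y \<I> \<J>"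

definition varphi_tilde :: "'o \<Rightarrow> 'o \<Rightarrow> 'm"
  where "varphi_tilde X Y =
    \<r>\<^sup>\<odot> ((X \<odot> Y)\<^sup>-) \<cdot> (\<l>\<^sup>\<bullet> ((X \<odot> Y)\<^sup>-) \<odot>\<^sub>a \<langle>\<I>\<rangle>) \<cdot> \<delta>\<^sup>\<sim> \<J> \<I> X Y"

end

notation psi ("\<psi>\<index>")
notation varphi ("\<phi>\<index>")
notation psi_tilde ("\<psi>\<^sup>\<sim>\<index>")
notation varphi_tilde ("\<phi>\<^sup>\<sim>\<index>")

locale duoidal_reversion = duoidal_category C
  for C :: "('o, 'm, 'x) reversion_scheme" (structure) +
  assumes phi_circ_lax:
      "lax_monoidal_endofunctor C (rev_tensor C (circ C)) (circ C)
        (rev_ob C) (rev_arr C) \<phi>\<^sup>\<odot> \<phi>\<^sup>\<odot>\<^sub>0"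
    and phi_bull_lax:
      "lax_monoidal_endofunctor C (rev_tensor C (bull C)) (bull C)
        (rev_ob C) (rev_arr C) \<phi>\<^sup>\<bullet> \<phi>\<^sup>\<bullet>\<^sub>0"
    and phi_zeta:
      "\<phi>\<^sup>\<bullet> (D \<odot> A) (E \<odot> B) \<cdot> (\<phi>\<^sup>\<odot> A D \<bullet>\<^sub>a \<phi>\<^sup>\<odot> B E) \<cdot> \<zeta> (A\<^sup>-) (B\<^sup>-) (D\<^sup>-) (E\<^sup>-) =
        (\<zeta> E D B A)\<^sup>-\<^sub>a \<cdot> \<phi>\<^sup>\<odot> (B \<bullet> A) (E \<bullet> D) \<cdot> (\<phi>\<^sup>\<bullet> A B \<odot>\<^sub>a \<phi>\<^sup>\<bullet> D E)"
    and phi_comult: "\<phi>\<^sup>\<bullet> \<I> \<I> \<cdot> (\<phi>\<^sup>\<odot>\<^sub>0 \<bullet>\<^sub>a \<phi>\<^sup>\<odot>\<^sub>0) \<cdot> \<Delta>\<^sub>I = \<Delta>\<^sub>I\<^sup>-\<^sub>a \<cdot> \<phi>\<^sup>\<odot>\<^sub>0"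
    and phi_mult: "m\<^sub>J\<^sup>-\<^sub>a \<cdot> \<phi>\<^sup>\<odot> \<J> \<J> \<cdot> (\<phi>\<^sup>\<bullet>\<^sub>0 \<odot>\<^sub>a \<phi>\<^sup>\<bullet>\<^sub>0) = \<phi>\<^sup>\<bullet>\<^sub>0 \<cdot> m\<^sub>J"
    and phi_counit: "\<phi>\<^sup>\<bullet>\<^sub>0 \<cdot> \<epsilon>\<^sub>I = \<epsilon>\<^sub>I\<^sup>-\<^sub>a \<cdot> \<phi>\<^sup>\<odot>\<^sub>0"
    and gamma_hom: "\<gamma> X Y Z T \<in> ((X \<bullet> Y\<^sup>-) \<odot> Z) \<bullet> T \<rightarrow> X \<odot> (Z \<bullet> (Y \<odot> T))"
    and gamma_nat:
      "\<lbrakk>f \<in> X \<rightarrow> X'; g \<in> Y \<rightarrow> Y'; h \<in> Z \<rightarrow> Z'; k \<in> T \<rightarrow> T'\<rbrakk> \<Longrightarrow>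
        \<gamma> X' Y' Z' T' \<cdot> (((f \<bullet>\<^sub>a g\<^sup>-\<^sub>a) \<odot>\<^sub>a h) \<bullet>\<^sub>a k) = (f \<odot>\<^sub>a (h \<bullet>\<^sub>a (g \<odot>\<^sub>a k))) \<cdot> \<gamma> X Y Z T"
    and delta_hom: "\<delta> X Y Z T \<in> X \<bullet> (Y \<odot> (Z\<^sup>- \<bullet> T)) \<rightarrow> ((X \<odot> Z) \<bullet> Y) \<odot> T"
    and delta_nat:
      "\<lbrakk>f \<in> X \<rightarrow> X'; g \<in> Y \<rightarrow> Y'; h \<in> Z \<rightarrow> Z'; k \<in> T \<rightarrow> T'\<rbrakk> \<Longrightarrow>
        \<delta> X' Y' Z' T' \<cdot> (f \<bullet>\<^sub>a (g \<odot>\<^sub>a (h\<^sup>-\<^sub>a \<bullet>\<^sub>a k))) = (((f \<odot>\<^sub>a h) \<bullet>\<^sub>a g) \<odot>\<^sub>a k) \<cdot> \<delta> X Y Z T"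
    and gamma_tilde_hom: "\<gamma>\<^sup>\<sim> X Y Z T \<in> X\<^sup>- \<bullet> ((Y \<bullet> Z) \<odot> T) \<rightarrow> Z \<odot> ((X \<odot> Y)\<^sup>- \<bullet> T)"
    and gamma_tilde_nat:
      "\<lbrakk>f \<in> X \<rightarrow> X'; g \<in> Y \<rightarrow> Y'; h \<in> Z \<rightarrow> Z'; k \<in> T \<rightarrow> T'\<rbrakk> \<Longrightarrow>
        \<gamma>\<^sup>\<sim> X' Y' Z' T' \<cdot> (f\<^sup>-\<^sub>a \<bullet>\<^sub>a ((g \<bullet>\<^sub>a h) \<odot>\<^sub>a k)) =
        (h \<odot>\<^sub>a ((f \<odot>\<^sub>a g)\<^sup>-\<^sub>a \<bullet>\<^sub>a k)) \<cdot> \<gamma>\<^sup>\<sim> X Y Z T"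
    and delta_tilde_hom: "\<delta>\<^sup>\<sim> X Y Z T \<in> (X \<odot> (Y \<bullet> Z)) \<bullet> T\<^sup>- \<rightarrow> (X \<bullet> (Z \<odot> T)\<^sup>-) \<odot> Y"
    and delta_tilde_nat:
      "\<lbrakk>f \<in> X \<rightarrow> X'; g \<in> Y \<rightarrow> Y'; h \<in> Z \<rightarrow> Z'; k \<in> T \<rightarrow> T'\<rbrakk> \<Longrightarrow>
        \<delta>\<^sup>\<sim> X' Y' Z' T' \<cdot> ((f \<odot>\<^sub>a (g \<bullet>\<^sub>a h)) \<bullet>\<^sub>a k\<^sup>-\<^sub>a) =
        ((f \<bullet>\<^sub>a (h \<odot>\<^sub>a k)\<^sup>-\<^sub>a) \<odot>\<^sub>a g) \<cdot> \<delta>\<^sup>\<sim> X Y Z T"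
    and R1:
      "\<gamma> X Y (Z \<odot> U) (T \<odot> V) \<cdot> (\<alpha>\<^sup>\<odot> (X \<bullet> Y\<^sup>-) Z U \<bullet>\<^sub>a \<langle>T \<odot> V\<rangle>) \<cdot> \<zeta> ((X \<bullet> Y\<^sup>-) \<odot> Z) T U V =
        (\<langle>X\<rangle> \<odot>\<^sub>a (\<langle>Z \<odot> U\<rangle> \<bullet>\<^sub>a \<alpha>\<^sup>\<odot> Y T V)) \<cdot> (\<langle>X\<rangle> \<odot>\<^sub>a \<zeta> Z (Y \<odot> T) U V) \<cdot>
        \<alpha>\<^sup>\<odot> X (Z \<bullet> (Y \<odot> T)) (U \<bullet> V) \<cdot> (\<gamma> X Y Z T \<odot>\<^sub>a \<langle>U \<bullet> V\<rangle>)"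
    and R2:
      "(\<langle>X \<odot> T\<rangle> \<bullet>\<^sub>a \<gamma> Y Z U V) \<cdot> \<alpha>\<^sup>\<bullet> (X \<odot> T) ((Y \<bullet> Z\<^sup>-) \<odot> U) V \<cdot>
        (\<zeta> X (Y \<bullet> Z\<^sup>-) T U \<bullet>\<^sub>a \<langle>V\<rangle>) \<cdot> ((\<alpha>\<^sup>\<bullet> X Y (Z\<^sup>-) \<odot>\<^sub>a \<langle>T \<bullet> U\<rangle>) \<bullet>\<^sub>a \<langle>V\<rangle>) =
        \<zeta> X Y T (U \<bullet> (Z \<odot> V)) \<cdot> (\<langle>X \<bullet> Y\<rangle> \<odot>\<^sub>a \<alpha>\<^sup>\<bullet> T U (Z \<odot> V)) \<cdot> \<gamma> (X \<bullet> Y) Z (T \<bullet> U) V"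
    and R3:
      "((\<alpha>\<^sup>\<odot> X Z U \<bullet>\<^sub>a \<langle>Y \<odot> T\<rangle>) \<odot>\<^sub>a \<langle>V\<rangle>) \<cdot> \<delta> (X \<odot> Z) (Y \<odot> T) U V \<cdot>
        (\<langle>X \<odot> Z\<rangle> \<bullet>\<^sub>a (\<alpha>\<^sup>\<odot> Y T (U\<^sup>- \<bullet> V))\<inverse>) \<cdot> \<zeta> X Y Z (T \<odot> (U\<^sup>- \<bullet> V)) =
        (\<zeta> X Y (Z \<odot> U) T \<odot>\<^sub>a \<langle>V\<rangle>) \<cdot> (\<alpha>\<^sup>\<odot> (X \<bullet> Y) ((Z \<odot> U) \<bullet> T) V)\<inverse> \<cdot>
        (\<langle>X \<bullet> Y\<rangle> \<odot>\<^sub>a \<delta> Z T U V)"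
    and R4:
      "(\<delta> X Y T U \<bullet>\<^sub>a \<langle>Z \<odot> V\<rangle>) \<cdot> (\<alpha>\<^sup>\<bullet> X (Y \<odot> (T\<^sup>- \<bullet> U)) (Z \<odot> V))\<inverse> \<cdot>
        (\<langle>X\<rangle> \<bullet>\<^sub>a \<zeta> Y Z (T\<^sup>- \<bullet> U) V) =
        \<zeta> ((X \<odot> T) \<bullet> Y) Z U V \<cdot> ((\<alpha>\<^sup>\<bullet> (X \<odot> T) Y Z)\<inverse> \<odot>\<^sub>a \<langle>U \<bullet> V\<rangle>) \<cdot>
        \<delta> X (Y \<bullet> Z) T (U \<bullet> V) \<cdot> (\<langle>X\<rangle> \<bullet>\<^sub>a (\<langle>Y \<bullet> Z\<rangle> \<odot>\<^sub>a \<alpha>\<^sup>\<bullet> (T\<^sup>-) U V))"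
    and R5:
      "\<delta> X Y T (U \<bullet> (Z \<odot> V)) \<cdot> (\<langle>X\<rangle> \<bullet>\<^sub>a (\<langle>Y\<rangle> \<odot>\<^sub>a \<alpha>\<^sup>\<bullet> (T\<^sup>-) U (Z \<odot> V))) \<cdot>
        (\<langle>X\<rangle> \<bullet>\<^sub>a \<gamma> Y Z (T\<^sup>- \<bullet> U) V) \<cdot> \<alpha>\<^sup>\<bullet> X ((Y \<bullet> Z\<^sup>-) \<odot> (T\<^sup>- \<bullet> U)) V =
        \<gamma> ((X \<odot> T) \<bullet> Y) Z U V \<cdot> (((\<alpha>\<^sup>\<bullet> (X \<odot> T) Y (Z\<^sup>-))\<inverse> \<odot>\<^sub>a \<langle>U\<rangle>) \<bullet>\<^sub>a \<langle>V\<rangle>) \<cdot>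
        (\<delta> X (Y \<bullet> Z\<^sup>-) T U \<bullet>\<^sub>a \<langle>V\<rangle>)"
    and R6:
      "\<l>\<^sup>\<odot> (\<I> \<bullet> \<I>) \<cdot> (\<langle>\<I>\<rangle> \<odot>\<^sub>a (\<langle>\<I>\<rangle> \<bullet>\<^sub>a \<l>\<^sup>\<odot> \<I>)) \<cdot> \<gamma> \<I> \<I> \<I> \<I> \<cdot>
        ((((\<langle>\<I>\<rangle> \<bullet>\<^sub>a \<phi>\<^sup>\<odot>\<^sub>0) \<cdot> \<Delta>\<^sub>I) \<odot>\<^sub>a \<langle>\<I>\<rangle>) \<bullet>\<^sub>a \<langle>\<I>\<rangle>) = \<l>\<^sup>\<odot> \<I> \<bullet>\<^sub>a \<langle>\<I>\<rangle>"
    and R7: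
      "\<r>\<^sup>\<odot> (\<I> \<bullet> \<I>) \<cdot> ((\<r>\<^sup>\<odot> \<I> \<bullet>\<^sub>a \<langle>\<I>\<rangle>) \<odot>\<^sub>a \<langle>\<I>\<rangle>) \<cdot> \<delta> \<I> \<I> \<I> \<I> \<cdot>
        (\<langle>\<I>\<rangle> \<bullet>\<^sub>a (\<langle>\<I>\<rangle> \<odot>\<^sub>a ((\<phi>\<^sup>\<odot>\<^sub>0 \<bullet>\<^sub>a \<langle>\<I>\<rangle>) \<cdot> \<Delta>\<^sub>I))) = \<langle>\<I>\<rangle> \<bullet>\<^sub>a \<r>\<^sup>\<odot> \<I>"
    and R8:
      "\<gamma> (X \<odot> Z) Y (\<J> \<odot> \<J>) U \<cdot> (\<alpha>\<^sup>\<odot> ((X \<odot> Z) \<bullet> Y\<^sup>-) \<J> \<J> \<bullet>\<^sub>a \<langle>U\<rangle>) \<cdot>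
        ((\<delta> X (Y\<^sup>-) Z \<J> \<odot>\<^sub>a \<langle>\<J>\<rangle>) \<bullet>\<^sub>a \<langle>U\<rangle>) \<cdot>
        (((\<langle>X\<rangle> \<bullet>\<^sub>a (\<langle>Y\<^sup>-\<rangle> \<odot>\<^sub>a (\<r>\<^sup>\<bullet> (Z\<^sup>-))\<inverse>)) \<odot>\<^sub>a \<langle>\<J>\<rangle>) \<bullet>\<^sub>a \<langle>U\<rangle>) =
        (\<langle>X \<odot> Z\<rangle> \<odot>\<^sub>a \<zeta> \<J> Y \<J> U) \<cdot> (\<langle>X \<odot> Z\<rangle> \<odot>\<^sub>a ((\<l>\<^sup>\<bullet> Y)\<inverse> \<odot>\<^sub>a (\<l>\<^sup>\<bullet> U)\<inverse>)) \<cdot>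
        (\<alpha>\<^sup>\<odot> X Z (Y \<odot> U))\<inverse> \<cdot> (\<langle>X\<rangle> \<odot>\<^sub>a \<alpha>\<^sup>\<odot> Z Y U) \<cdot> (\<langle>X\<rangle> \<odot>\<^sub>a \<l>\<^sup>\<bullet> ((Z \<odot> Y) \<odot> U)) \<cdot>
        \<gamma> X (Z \<odot> Y) \<J> U \<cdot> (((\<langle>X\<rangle> \<bullet>\<^sub>a \<phi>\<^sup>\<odot> Y Z) \<odot>\<^sub>a \<langle>\<J>\<rangle>) \<bullet>\<^sub>a \<langle>U\<rangle>)"
    and R9:
      "\<delta> X (\<J> \<odot> \<J>) Z (Y \<odot> U) \<cdot> (\<langle>X\<rangle> \<bullet>\<^sub>a (\<alpha>\<^sup>\<odot> \<J> \<J> (Z\<^sup>- \<bullet> (Y \<odot> U)))\<inverse>) \<cdot>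
        (\<langle>X\<rangle> \<bullet>\<^sub>a (\<langle>\<J>\<rangle> \<odot>\<^sub>a \<gamma> \<J> Y (Z\<^sup>-) U)) \<cdot>
        (\<langle>X\<rangle> \<bullet>\<^sub>a (\<langle>\<J>\<rangle> \<odot>\<^sub>a (((\<l>\<^sup>\<bullet> (Y\<^sup>-))\<inverse> \<odot>\<^sub>a \<langle>Z\<^sup>-\<rangle>) \<bullet>\<^sub>a \<langle>U\<rangle>))) =
        (\<zeta> X \<J> Z \<J> \<odot>\<^sub>a \<langle>Y \<odot> U\<rangle>) \<cdot> (((\<r>\<^sup>\<bullet> X)\<inverse> \<odot>\<^sub>a (\<r>\<^sup>\<bullet> Z)\<inverse>) \<odot>\<^sub>a \<langle>Y \<odot> U\<rangle>) \<cdot>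
        \<alpha>\<^sup>\<odot> (X \<odot> Z) Y U \<cdot> ((\<alpha>\<^sup>\<odot> X Z Y)\<inverse> \<odot>\<^sub>a \<langle>U\<rangle>) \<cdot> (\<r>\<^sup>\<bullet> (X \<odot> (Z \<odot> Y)) \<odot>\<^sub>a \<langle>U\<rangle>) \<cdot>
        \<delta> X \<J> (Z \<odot> Y) U \<cdot> (\<langle>X\<rangle> \<bullet>\<^sub>a (\<langle>\<J>\<rangle> \<odot>\<^sub>a (\<phi>\<^sup>\<odot> Y Z \<bullet>\<^sub>a \<langle>U\<rangle>)))"
    and R10:
      "(\<alpha>\<^sup>\<odot> X Y Z)\<^sup>-\<^sub>a \<cdot> \<phi>\<^sup>\<sim> (X \<odot> Y) Z \<cdot> (\<psi> X Y \<bullet>\<^sub>a \<langle>Z\<^sup>-\<rangle>) =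
        \<psi>\<^sup>\<sim> X (Y \<odot> Z) \<cdot> (\<langle>X\<^sup>-\<rangle> \<bullet>\<^sub>a \<phi> Y Z) \<cdot> \<alpha>\<^sup>\<bullet> (X\<^sup>-) Y (Z\<^sup>-)"
    and R11:
      "(\<r>\<^sup>\<odot> X)\<^sup>-\<^sub>a \<cdot> \<l>\<^sup>\<odot> ((X \<odot> \<I>)\<^sup>-) \<cdot> (\<langle>\<I>\<rangle> \<odot>\<^sub>a \<r>\<^sup>\<bullet> ((X \<odot> \<I>)\<^sup>-)) \<cdot> \<gamma>\<^sup>\<sim> X \<I> \<I> \<J> \<cdot>
        (\<langle>X\<^sup>-\<rangle> \<bullet>\<^sub>a (\<Delta>\<^sub>I \<odot>\<^sub>a \<langle>\<J>\<rangle>)) = \<r>\<^sup>\<bullet> (X\<^sup>-) \<cdot> (\<langle>X\<^sup>-\<rangle> \<bullet>\<^sub>a \<l>\<^sup>\<odot> \<J>)"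
    and R12:
      "(\<l>\<^sup>\<odot> X)\<^sup>-\<^sub>a \<cdot> \<r>\<^sup>\<odot> ((\<I> \<odot> X)\<^sup>-) \<cdot> (\<l>\<^sup>\<bullet> ((\<I> \<odot> X)\<^sup>-) \<odot>\<^sub>a \<langle>\<I>\<rangle>) \<cdot> \<delta>\<^sup>\<sim> \<J> \<I> \<I> X \<cdot>
        ((\<langle>\<J>\<rangle> \<odot>\<^sub>a \<Delta>\<^sub>I) \<bullet>\<^sub>a \<langle>X\<^sup>-\<rangle>) = \<l>\<^sup>\<bullet> (X\<^sup>-) \<cdot> (\<r>\<^sup>\<odot> \<J> \<bullet>\<^sub>a \<langle>X\<^sup>-\<rangle>)"
    and R13:
      "(\<langle>X\<rangle> \<odot>\<^sub>a \<alpha>\<^sup>\<bullet> T (Z \<odot> U) (Y \<odot> V)) \<cdot> \<gamma> X Y (T \<bullet> (Z \<odot> U)) V \<cdot>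
        (\<gamma> (X \<bullet> Y\<^sup>-) Z T U \<bullet>\<^sub>a \<langle>V\<rangle>) =
        (\<langle>X\<rangle> \<odot>\<^sub>a (\<langle>T\<rangle> \<bullet>\<^sub>a \<zeta> Z Y U V)) \<cdot> \<gamma> X (Z \<bullet> Y) T (U \<bullet> V) \<cdot>
        (((\<langle>X\<rangle> \<bullet>\<^sub>a \<phi>\<^sup>\<bullet> Y Z) \<odot>\<^sub>a \<langle>T\<rangle>) \<bullet>\<^sub>a \<langle>U \<bullet> V\<rangle>) \<cdot>
        ((\<alpha>\<^sup>\<bullet> X (Y\<^sup>-) (Z\<^sup>-) \<odot>\<^sub>a \<langle>T\<rangle>) \<bullet>\<^sub>a \<langle>U \<bullet> V\<rangle>) \<cdot>
        \<alpha>\<^sup>\<bullet> (((X \<bullet> Y\<^sup>-) \<bullet> Z\<^sup>-) \<odot> T) U V"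
    and R14:
      "\<delta> X ((Y \<odot> T) \<bullet> Z) U V \<cdot> (\<langle>X\<rangle> \<bullet>\<^sub>a \<delta> Y Z T (U\<^sup>- \<bullet> V)) \<cdot>
        \<alpha>\<^sup>\<bullet> X Y (Z \<odot> (T\<^sup>- \<bullet> (U\<^sup>- \<bullet> V))) \<cdot> (\<langle>X \<bullet> Y\<rangle> \<bullet>\<^sub>a (\<langle>Z\<rangle> \<odot>\<^sub>a \<alpha>\<^sup>\<bullet> (T\<^sup>-) (U\<^sup>-) V)) =
        (\<alpha>\<^sup>\<bullet> (X \<odot> U) (Y \<odot> T) Z \<odot>\<^sub>a \<langle>V\<rangle>) \<cdot> ((\<zeta> X Y U T \<bullet>\<^sub>a \<langle>Z\<rangle>) \<odot>\<^sub>a \<langle>V\<rangle>) \<cdot>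
        \<delta> (X \<bullet> Y) Z (U \<bullet> T) V \<cdot> (\<langle>X \<bullet> Y\<rangle> \<bullet>\<^sub>a (\<langle>Z\<rangle> \<odot>\<^sub>a (\<phi>\<^sup>\<bullet> T U \<bullet>\<^sub>a \<langle>V\<rangle>)))"
    and R15:
      "(\<langle>X\<rangle> \<odot>\<^sub>a \<gamma> Z T U (Y \<odot> V)) \<cdot> \<gamma> X Y ((Z \<bullet> T\<^sup>-) \<odot> U) V \<cdot>
        (\<alpha>\<^sup>\<odot> (X \<bullet> Y\<^sup>-) (Z \<bullet> T\<^sup>-) U \<bullet>\<^sub>a \<langle>V\<rangle>) =
        \<alpha>\<^sup>\<odot> X Z (U \<bullet> (T \<odot> (Y \<odot> V))) \<cdot> (\<langle>X \<odot> Z\<rangle> \<odot>\<^sub>a (\<langle>U\<rangle> \<bullet>\<^sub>a \<alpha>\<^sup>\<odot> T Y V)) \<cdot>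
        \<gamma> (X \<odot> Z) (T \<odot> Y) U V \<cdot> (((\<langle>X \<odot> Z\<rangle> \<bullet>\<^sub>a \<phi>\<^sup>\<odot> Y T) \<odot>\<^sub>a \<langle>U\<rangle>) \<bullet>\<^sub>a \<langle>V\<rangle>) \<cdot>
        ((\<zeta> X (Y\<^sup>-) Z (T\<^sup>-) \<odot>\<^sub>a \<langle>U\<rangle>) \<bullet>\<^sub>a \<langle>V\<rangle>)"
    and R16:
      "((\<alpha>\<^sup>\<odot> X U Z \<bullet>\<^sub>a \<langle>Y\<rangle>) \<odot>\<^sub>a \<langle>T \<odot> V\<rangle>) \<cdot> \<alpha>\<^sup>\<odot> (((X \<odot> U) \<odot> Z) \<bullet> Y) T V \<cdot>
        (\<delta> (X \<odot> U) Y Z T \<odot>\<^sub>a \<langle>V\<rangle>) \<cdot> \<delta> X (Y \<odot> (Z\<^sup>- \<bullet> T)) U V =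
        \<delta> X Y (U \<odot> Z) (T \<odot> V) \<cdot> (\<langle>X\<rangle> \<bullet>\<^sub>a (\<langle>Y\<rangle> \<odot>\<^sub>a (\<phi>\<^sup>\<odot> Z U \<bullet>\<^sub>a \<langle>T \<odot> V\<rangle>))) \<cdot>
        (\<langle>X\<rangle> \<bullet>\<^sub>a (\<langle>Y\<rangle> \<odot>\<^sub>a \<zeta> (Z\<^sup>-) T (U\<^sup>-) V)) \<cdot> (\<langle>X\<rangle> \<bullet>\<^sub>a \<alpha>\<^sup>\<odot> Y (Z\<^sup>- \<bullet> T) (U\<^sup>- \<bullet> V))"
    and R17:
      "\<r>\<^sup>\<odot> \<J> \<cdot> (\<langle>\<J>\<rangle> \<odot>\<^sub>a \<r>\<^sup>\<bullet> \<I>) \<cdot> (\<langle>\<J>\<rangle> \<odot>\<^sub>a (\<langle>\<I>\<rangle> \<bullet>\<^sub>a m\<^sub>J)) \<cdot> \<gamma> \<J> \<J> \<I> \<J> \<cdot>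
        ((((\<langle>\<J>\<rangle> \<bullet>\<^sub>a \<phi>\<^sup>\<bullet>\<^sub>0) \<cdot> \<Delta>\<^sub>J) \<odot>\<^sub>a \<langle>\<I>\<rangle>) \<bullet>\<^sub>a \<langle>\<J>\<rangle>) = \<r>\<^sup>\<bullet> \<J> \<cdot> (\<r>\<^sup>\<odot> \<J> \<bullet>\<^sub>a \<langle>\<J>\<rangle>)"
    and R18:
      "\<l>\<^sup>\<odot> \<J> \<cdot> (\<l>\<^sup>\<bullet> \<I> \<odot>\<^sub>a \<langle>\<J>\<rangle>) \<cdot> ((m\<^sub>J \<bullet>\<^sub>a \<langle>\<I>\<rangle>) \<odot>\<^sub>a \<langle>\<J>\<rangle>) \<cdot> \<delta> \<J> \<I> \<J> \<J> \<cdot>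
        (\<langle>\<J>\<rangle> \<bullet>\<^sub>a (\<langle>\<I>\<rangle> \<odot>\<^sub>a ((\<phi>\<^sup>\<bullet>\<^sub>0 \<bullet>\<^sub>a \<langle>\<J>\<rangle>) \<cdot> \<Delta>\<^sub>J))) = \<l>\<^sup>\<bullet> \<J> \<cdot> (\<langle>\<J>\<rangle> \<bullet>\<^sub>a \<l>\<^sup>\<odot> \<J>)"


section \<open>Antipodes, Galois maps and co-Galois maps\<close>

text \<open>
  In the sequel \<open>m\<close>, \<open>u\<close>, \<open>d\<close>, \<open>e\<close> are the multiplication, unit, comultiplication and counit
  of \<open>H\<close>, and \<open>S : H \<rightarrow> H\<^sup>-\<close> is the candidate for an antipode.
\<close>

context
  fixes C :: "('o, 'm, 'x) reversion_scheme" (structure)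
begin

definition conv_id_left :: "'o \<Rightarrow> 'm \<Rightarrow> 'm \<Rightarrow> 'm \<Rightarrow> 'm"
  \<comment> \<open>\<open>Id \<star> S\<close>\<close>
  where "conv_id_left H m d S =
    ((m \<bullet>\<^sub>a \<langle>\<I>\<rangle>) \<odot>\<^sub>a \<langle>\<J>\<rangle>) \<cdot> \<phi> H H \<cdot> (\<langle>H\<rangle> \<bullet>\<^sub>a S) \<cdot> d"

definition conv_id_right :: "'o \<Rightarrow> 'm \<Rightarrow> 'm \<Rightarrow> 'm \<Rightarrow> 'm"
  \<comment> \<open>\<open>S \<star> Id\<close>\<close>
  where "conv_id_right H m d S =
    (\<langle>\<J>\<rangle> \<odot>\<^sub>a (\<langle>\<I>\<rangle> \<bullet>\<^sub>a m)) \<cdot> \<psi> H H \<cdot> (S \<bullet>\<^sub>a \<langle>H\<rangle>) \<cdot> d"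

definition conv_unit_left :: "'m \<Rightarrow> 'm \<Rightarrow> 'm"
  \<comment> \<open>\<open>1\<^sup>l\<close>\<close>
  where "conv_unit_left u e =
    ((u \<bullet>\<^sub>a \<langle>\<I>\<rangle>) \<odot>\<^sub>a \<langle>\<J>\<rangle>) \<cdot> (\<Delta>\<^sub>I \<odot>\<^sub>a \<langle>\<J>\<rangle>) \<cdot> (\<l>\<^sup>\<odot> \<J>)\<inverse> \<cdot> e"

definition conv_unit_right :: "'m \<Rightarrow> 'm \<Rightarrow> 'm"
  \<comment> \<open>\<open>1\<^sup>r\<close>\<close>
  where "conv_unit_right u e =
    (\<langle>\<J>\<rangle> \<odot>\<^sub>a (\<langle>\<I>\<rangle> \<bullet>\<^sub>a u)) \<cdot> (\<langle>\<J>\<rangle> \<odot>\<^sub>a \<Delta>\<^sub>I) \<cdot> (\<r>\<^sup>\<odot> \<J>)\<inverse> \<cdot> e"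

definition antipode :: "'o \<Rightarrow> 'm \<Rightarrow> 'm \<Rightarrow> 'm \<Rightarrow> 'm \<Rightarrow> 'm \<Rightarrow> bool"
  where "antipode H m u d e S \<longleftrightarrow>
    S \<in> H \<rightarrow> H\<^sup>- \<and>
    conv_id_left H m d S = conv_unit_left u e \<and>
    conv_id_right H m d S = conv_unit_right u e"

text \<open>
  Below, \<open>\<mu>\<close> is the action on \<open>P\<close> and \<open>\<rho>\<close> the coaction on \<open>Q\<close> for the Galois maps, while for
  the co-Galois maps \<open>\<rho>\<close> is the coaction on \<open>P\<close> and \<open>\<mu>\<close> the action on \<open>Q\<close>.
\<close>

definition galois :: "'o \<Rightarrow> 'o \<Rightarrow> 'm \<Rightarrow> 'o \<Rightarrow> 'o \<Rightarrow> 'm \<Rightarrow> 'm"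
  where "galois H P \<mu> X Q \<rho> =
    (\<mu> \<bullet>\<^sub>a \<langle>X \<odot> Q\<rangle>) \<cdot> \<zeta> P X H Q \<cdot> (\<langle>P \<bullet> X\<rangle> \<odot>\<^sub>a \<rho>)"

definition galois_bar :: "'o \<Rightarrow> 'm \<Rightarrow> 'o \<Rightarrow> 'm \<Rightarrow> 'o \<Rightarrow> 'o \<Rightarrow> 'm \<Rightarrow> 'm"
  where "galois_bar H S P \<mu> X Q \<rho> =
    ((\<mu> \<bullet>\<^sub>a \<langle>X\<rangle>) \<odot>\<^sub>a \<langle>Q\<rangle>) \<cdot> \<delta> P X H Q \<cdot> (\<langle>P\<rangle> \<bullet>\<^sub>a (\<langle>X\<rangle> \<odot>\<^sub>a ((S \<bullet>\<^sub>a \<langle>Q\<rangle>) \<cdot> \<rho>)))"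

definition cogalois :: "'o \<Rightarrow> 'o \<Rightarrow> 'm \<Rightarrow> 'o \<Rightarrow> 'o \<Rightarrow> 'm \<Rightarrow> 'm"
  where "cogalois H P \<rho> X Q \<mu> =
    (\<langle>P \<odot> X\<rangle> \<bullet>\<^sub>a \<mu>) \<cdot> \<zeta> P H X Q \<cdot> (\<rho> \<odot>\<^sub>a \<langle>X \<bullet> Q\<rangle>)"

definition cogalois_bar :: "'o \<Rightarrow> 'm \<Rightarrow> 'o \<Rightarrow> 'm \<Rightarrow> 'o \<Rightarrow> 'o \<Rightarrow> 'm \<Rightarrow> 'm"
  where "cogalois_bar H S P \<rho> X Q \<mu> =
    (\<langle>P\<rangle> \<odot>\<^sub>a (\<langle>X\<rangle> \<bullet>\<^sub>a \<mu>)) \<cdot> \<gamma> P H X Q \<cdot> ((((\<langle>P\<rangle> \<bullet>\<^sub>a S) \<cdot> \<rho>) \<odot>\<^sub>a \<langle>X\<rangle>) \<bullet>\<^sub>a \<langle>Q\<rangle>)"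

end

end

theory Submission
  imports Defs
begin

text \<open>
  The composite \<open>\<kappa>\<^bsub>bar\<^esub> \<kappa>\<close> factors through a single arrow \<open>w : Q \<rightarrow> (H \<bullet> \<I>) \<odot> Q\<close>:
  naturality and (R3) with \<open>T = \<I>\<close> pull the action of \<open>P\<close> and the object \<open>X\<close> out of \<open>\<delta>\<close>, and
  coassociativity together with (R5) and (R6) shows that \<open>w\<close> is obtained from \<open>Id \<star> S\<close> by
  attaching \<open>Q\<close>.  Hence \<open>Id \<star> S = 1\<^sup>l\<close> makes \<open>w\<close> the unit and \<open>\<kappa>\<^bsub>bar\<^esub> \<kappa>\<close> the identity; conversely, for
  \<open>P = Q = H\<close> and \<open>X = \<I>\<close> one recovers \<open>w\<close> by inserting the unit of \<open>H\<close>, and then \<open>Id \<star> S\<close> by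
  applying the counit.

  For \<open>\<kappa> \<kappa>\<^bsub>bar\<^esub>\<close>, (R4) with \<open>Y = \<J>\<close> confines all action on \<open>P\<close> to an arrow \<open>P \<bullet> (\<J> \<odot> H) \<rightarrow> P\<close>
  containing \<open>\<delta>\<^bsub>P,\<J>,H,H\<^esub>\<close>.  By (R9) with \<open>Z = \<I>\<close> that instance of \<open>\<delta>\<close> is a function of \<open>\<psi>\<^bsub>H,H\<^esub>\<close>, so the
  arrow depends on \<open>S\<close> only through \<open>S \<star> Id\<close>, and for \<open>S \<star> Id = 1\<^sup>r\<close> it collapses by (R7).

  The statements on co-Galois maps are the same statements in the category with both tensor
  products reversed, where \<open>\<gamma>\<close> and \<open>\<delta>\<close> exchange their roles.
\<close>

section \<open>Categories and monoidal categories\<close>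

text \<open>The obstacle is that \<zeta>, \<gamma> and \<delta> are not assumed invertible, so an
  equation that holds after composing with one of them cannot simply be cancelled. Every passage to
  or from a unit object therefore uses \<open>\<Delta>\<^sub>I\<close> or \<open>m\<^sub>J\<close>,
  which combine with \<zeta> to give invertible unit constraints.

  The second difficulty is one of arguments. Convolution products live where \<delta> and \<gamma>
  have units in two places: \<open>varphi\<close> is \<delta> with \<I> in the second and \<J> in
  the fourth, \<open>psi\<close> is \<gamma> with \<J> in the first and \<I> in the third. Galois
  maps have arbitrary objects there. Two auxiliary arrows cross this gap, one for each order of
  composition: \<open>cap\<close> brings back the comodule Q, \<open>theta\<close> the module P.
  Each is natural and is evaluated explicitly on \<open>\<Delta>\<^sub>I\<close>, which is how the
  units of convolution enter.

  For the final equivalence each family supplies one equation of an antipode: \<kappa> yields Id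
  \<star> S, and its mirror image, the co-Galois map, yields S \<star> Id.\<close>

unbundle no converse_syntax

context category
begin

text \<open>Turns typing into two equations between objects. Sources and targets of all structural
  arrows become simp rules, so side conditions on composability are settled by rewriting.\<close>

lemma hom_iff: "f \<in> A \<rightarrow> B \<longleftrightarrow> src f = A \<and> tgt f = B"
  by (simp add: hom_def)

lemma src_ident [simp]: "src \<langle>A\<rangle> = A" and tgt_ident [simp]: "tgt \<langle>A\<rangle> = A"
  using ident_hom by (simp_all add: hom_iff)

lemma src_comp [simp]: "tgt f = src g \<Longrightarrow> src (g \<cdot> f) = src f"
  and tgt_comp [simp]: "tgt f = src g \<Longrightarrow> tgt (g \<cdot> f) = tgt g"
  using comp_hom by (simp_all add: hom_iff)

lemma ident_comp [simp]: "tgt f = B \<Longrightarrow> \<langle>B\<rangle> \<cdot> f = f"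
  and comp_ident [simp]: "src f = A \<Longrightarrow> f \<cdot> \<langle>A\<rangle> = f"
  using comp_ident_left comp_ident_right by (auto simp add: hom_iff)

lemma assoc [simp]: "\<lbrakk>tgt f = src g; tgt g = src h\<rbrakk> \<Longrightarrow> (h \<cdot> g) \<cdot> f = h \<cdot> (g \<cdot> f)"
  using comp_assoc by (simp add: hom_iff)

lemma inv_unique: "\<lbrakk>inverse_of C f g; inverse_of C f h\<rbrakk> \<Longrightarrow> g = h"
  unfolding inverse_of_def hom_iff by (metis assoc ident_comp comp_ident)

lemma inv_eqI: "inverse_of C f g \<Longrightarrow> f\<inverse> = g"
  unfolding inv_arr_def using inv_unique by (blast intro: the_equality)

lemma inverse_of_inv: "is_iso C f \<Longrightarrow> inverse_of C f (f\<inverse>)"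
  using inv_eqI unfolding is_iso_def by metis

lemma is_iso_inv [simp]: "is_iso C f \<Longrightarrow> is_iso C (f\<inverse>)"
  using inverse_of_inv unfolding is_iso_def inverse_of_def hom_iff by metis

lemma src_inv [simp]: "is_iso C f \<Longrightarrow> src (f\<inverse>) = tgt f"
  and tgt_inv [simp]: "is_iso C f \<Longrightarrow> tgt (f\<inverse>) = src f"
  and inv_comp [simp]: "is_iso C f \<Longrightarrow> f\<inverse> \<cdot> f = \<langle>src f\<rangle>"
  and comp_inv [simp]: "is_iso C f \<Longrightarrow> f \<cdot> f\<inverse> = \<langle>tgt f\<rangle>"
  using inverse_of_inv unfolding inverse_of_def hom_iff by metis+

lemma inv_inv [simp]: "is_iso C f \<Longrightarrow> (f\<inverse>)\<inverse> = f"
  by (rule inv_eqI) (simp add: inverse_of_def hom_iff)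

lemma inv_comp_cancel [simp]: "\<lbrakk>is_iso C f; tgt x = src f\<rbrakk> \<Longrightarrow> f\<inverse> \<cdot> (f \<cdot> x) = x"
  by (subst assoc [symmetric]) simp_all

lemma comp_inv_cancel [simp]: "\<lbrakk>is_iso C f; tgt x = tgt f\<rbrakk> \<Longrightarrow> f \<cdot> (f\<inverse> \<cdot> x) = x"
  by (subst assoc [symmetric]) simp_all

lemma is_iso_ident [simp]: "is_iso C \<langle>A\<rangle>"
  unfolding is_iso_def inverse_of_def hom_iff by (metis src_ident tgt_ident ident_comp)

lemma inv_ident [simp]: "\<langle>A\<rangle>\<inverse> = \<langle>A\<rangle>"
  by (rule inv_eqI) (simp add: inverse_of_def hom_iff)

lemma is_iso_comp [simp]:
  assumes "is_iso C f" "is_iso C g" "tgt f = src g"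
  shows "is_iso C (g \<cdot> f)"
proof -
  have "inverse_of C (g \<cdot> f) (f\<inverse> \<cdot> g\<inverse>)"
    using assms by (simp add: inverse_of_def hom_iff)
  then show ?thesis by (auto simp: is_iso_def)
qed

lemma inv_of_comp:
  "\<lbrakk>is_iso C f; is_iso C g; tgt f = src g\<rbrakk> \<Longrightarrow> (g \<cdot> f)\<inverse> = f\<inverse> \<cdot> g\<inverse>"
  by (rule inv_eqI) (simp add: inverse_of_def hom_iff)

lemma iso_left_cancel:
  "\<lbrakk>is_iso C f; tgt x = src f; tgt y = src f; f \<cdot> x = f \<cdot> y\<rbrakk> \<Longrightarrow> x = y"
  by (metis inv_comp_cancel)

lemma iso_right_cancel:
  assumes "is_iso C f" "src x = tgt f" "src y = tgt f" "x \<cdot> f = y \<cdot> f"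
  shows "x = y"
proof -
  have "x = (x \<cdot> f) \<cdot> f\<inverse>" "y = (y \<cdot> f) \<cdot> f\<inverse>"
    using assms(1-3) by simp_all
  with assms(4) show ?thesis by simp
qed

lemma eq_inv_comp: "\<lbrakk>i \<cdot> x = y; is_iso C i; tgt x = src i\<rbrakk> \<Longrightarrow> x = i\<inverse> \<cdot> y"
  by auto

lemma eq_comp_inv: "\<lbrakk>x \<cdot> i = y; is_iso C i; src x = tgt i\<rbrakk> \<Longrightarrow> x = y \<cdot> i\<inverse>"
  by auto

text \<open>Translates the closing claim on inverses into two equations between composites, the form
  in which the four numbered parts deliver them.\<close>

lemma iso_inv_eq_iff:
  assumes "f \<in> A \<rightarrow> B" "g \<in> B \<rightarrow> A"
  shows "is_iso C f \<and> g = f\<inverse> \<longleftrightarrow> g \<cdot> f = \<langle>A\<rangle> \<and> f \<cdot> g = \<langle>B\<rangle>"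
proof
  assume "g \<cdot> f = \<langle>A\<rangle> \<and> f \<cdot> g = \<langle>B\<rangle>"
  with assms have "inverse_of C f g" by (simp add: inverse_of_def hom_iff)
  then show "is_iso C f \<and> g = f\<inverse>" using inv_eqI by (auto simp: is_iso_def)
qed (use assms in \<open>auto simp: hom_iff\<close>)

text \<open>Since \<open>assoc\<close> brackets composites to the right, the left-hand side g
  \<cdot> f of an equation is no longer a subterm once a further arrow x precedes it. This form
  matches there.\<close>

lemma comp_extend:
  "\<lbrakk>g \<cdot> f = h; tgt f = src g; tgt x = src f\<rbrakk> \<Longrightarrow> g \<cdot> (f \<cdot> x) = h \<cdot> x"
  using assoc by metis

text \<open>A commuting square with two opposite sides invertible can be read in the other
  direction. It serves for naturality of inverse constraints and for coherence axioms with inverted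
  associators.\<close>

lemma inverse_of_nat:
  assumes "is_iso C i" "is_iso C j" "tgt f = src j" "src f = src i" "src g = tgt i" "tgt g = tgt j"
    and "j \<cdot> f = g \<cdot> i"
  shows "j\<inverse> \<cdot> g = f \<cdot> i\<inverse>"
proof -
  have "j\<inverse> \<cdot> g = j\<inverse> \<cdot> ((g \<cdot> i) \<cdot> i\<inverse>)"
    using assms(1-6) by simp
  also have "\<dots> = f \<cdot> i\<inverse>"
    using assms(1-6) by (simp flip: assms(7))
  finally show ?thesis .
qed

end

section \<open>Functoriality of tensor products and coherence of unit constraints\<close>

context monoidal_category
begin

lemma src_tens [simp]: "src (f \<otimes>\<^sub>a\<^bsub>T\<^esub> g) = src f \<otimes>\<^bsub>T\<^esub> src g"
  and tgt_tens [simp]: "tgt (f \<otimes>\<^sub>a\<^bsub>T\<^esub> g) = tgt f \<otimes>\<^bsub>T\<^esub> tgt g"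
  using tens_hom by (simp_all add: hom_iff)

lemmas tens_ident [simp]

text \<open>Kept out of the simp set: calculations alternate between merging tensors into one and
  splitting them so that a naturality square becomes visible.\<close>

lemma merge:
  "\<lbrakk>tgt f = src f'; tgt g = src g'\<rbrakk> \<Longrightarrow>
    (f' \<otimes>\<^sub>a\<^bsub>T\<^esub> g') \<cdot> (f \<otimes>\<^sub>a\<^bsub>T\<^esub> g) = (f' \<cdot> f) \<otimes>\<^sub>a\<^bsub>T\<^esub> (g' \<cdot> g)"
  using tens_comp by (simp add: hom_iff)

lemma merge_ext:
  "\<lbrakk>tgt f = src f'; tgt g = src g'; tgt x = src f \<otimes>\<^bsub>T\<^esub> src g\<rbrakk> \<Longrightarrow>
    (f' \<otimes>\<^sub>a\<^bsub>T\<^esub> g') \<cdot> ((f \<otimes>\<^sub>a\<^bsub>T\<^esub> g) \<cdot> x) = ((f' \<cdot> f) \<otimes>\<^sub>a\<^bsub>T\<^esub> (g' \<cdot> g)) \<cdot> x"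
  by (subst comp_extend [OF merge]) simp_all

lemma inverse_of_tens:
  "\<lbrakk>is_iso C f; is_iso C g\<rbrakk> \<Longrightarrow> inverse_of C (f \<otimes>\<^sub>a\<^bsub>T\<^esub> g) (f\<inverse> \<otimes>\<^sub>a\<^bsub>T\<^esub> g\<inverse>)"
  by (simp add: inverse_of_def hom_iff merge)

lemma is_iso_tens [simp]: "\<lbrakk>is_iso C f; is_iso C g\<rbrakk> \<Longrightarrow> is_iso C (f \<otimes>\<^sub>a\<^bsub>T\<^esub> g)"
  using inverse_of_tens by (auto simp: is_iso_def)

lemma inv_tens: "\<lbrakk>is_iso C f; is_iso C g\<rbrakk> \<Longrightarrow> (f \<otimes>\<^sub>a\<^bsub>T\<^esub> g)\<inverse> = f\<inverse> \<otimes>\<^sub>a\<^bsub>T\<^esub> g\<inverse>"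
  by (rule inv_eqI [OF inverse_of_tens])

lemmas isos [simp] = assoc_iso left_iso right_iso

lemma src_assoc [simp]: "src (\<alpha>\<^bsub>T\<^esub> A B D) = (A \<otimes>\<^bsub>T\<^esub> B) \<otimes>\<^bsub>T\<^esub> D"
  and tgt_assoc [simp]: "tgt (\<alpha>\<^bsub>T\<^esub> A B D) = A \<otimes>\<^bsub>T\<^esub> (B \<otimes>\<^bsub>T\<^esub> D)"
  and src_left [simp]: "src (\<l>\<^bsub>T\<^esub> A) = \<one>\<^bsub>T\<^esub> \<otimes>\<^bsub>T\<^esub> A"
  and tgt_left [simp]: "tgt (\<l>\<^bsub>T\<^esub> A) = A"
  and src_right [simp]: "src (\<r>\<^bsub>T\<^esub> A) = A \<otimes>\<^bsub>T\<^esub> \<one>\<^bsub>T\<^esub>"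
  and tgt_right [simp]: "tgt (\<r>\<^bsub>T\<^esub> A) = A"
  using assoc_hom left_hom right_hom by (simp_all add: hom_iff)

text \<open>Naming the objects as sources and targets of the arrows removes all typing premises, so
  giving the arrows fixes the whole instance. The later naturality lemmas have the same
  format.\<close>

lemma assoc_natural:
  "\<alpha>\<^bsub>T\<^esub> (tgt f) (tgt g) (tgt h) \<cdot> ((f \<otimes>\<^sub>a\<^bsub>T\<^esub> g) \<otimes>\<^sub>a\<^bsub>T\<^esub> h) =
    (f \<otimes>\<^sub>a\<^bsub>T\<^esub> (g \<otimes>\<^sub>a\<^bsub>T\<^esub> h)) \<cdot> \<alpha>\<^bsub>T\<^esub> (src f) (src g) (src h)"
  by (rule assoc_nat) (simp_all add: hom_iff)

lemma left_natural: "\<l>\<^bsub>T\<^esub> (tgt f) \<cdot> (\<langle>\<one>\<^bsub>T\<^esub>\<rangle> \<otimes>\<^sub>a\<^bsub>T\<^esub> f) = f \<cdot> \<l>\<^bsub>T\<^esub> (src f)"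
  and right_natural: "\<r>\<^bsub>T\<^esub> (tgt f) \<cdot> (f \<otimes>\<^sub>a\<^bsub>T\<^esub> \<langle>\<one>\<^bsub>T\<^esub>\<rangle>) = f \<cdot> \<r>\<^bsub>T\<^esub> (src f)"
  using left_nat right_nat by (simp_all add: hom_iff)

lemma assoc_inv_natural:
  "(\<alpha>\<^bsub>T\<^esub> (tgt f) (tgt g) (tgt h))\<inverse> \<cdot> (f \<otimes>\<^sub>a\<^bsub>T\<^esub> (g \<otimes>\<^sub>a\<^bsub>T\<^esub> h)) =
    ((f \<otimes>\<^sub>a\<^bsub>T\<^esub> g) \<otimes>\<^sub>a\<^bsub>T\<^esub> h) \<cdot> (\<alpha>\<^bsub>T\<^esub> (src f) (src g) (src h))\<inverse>"
  by (rule inverse_of_nat) (simp_all add: assoc_natural)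

lemma left_inv_natural: "(\<l>\<^bsub>T\<^esub> (tgt f))\<inverse> \<cdot> f = (\<langle>\<one>\<^bsub>T\<^esub>\<rangle> \<otimes>\<^sub>a\<^bsub>T\<^esub> f) \<cdot> (\<l>\<^bsub>T\<^esub> (src f))\<inverse>"
  and right_inv_natural: "(\<r>\<^bsub>T\<^esub> (tgt f))\<inverse> \<cdot> f = (f \<otimes>\<^sub>a\<^bsub>T\<^esub> \<langle>\<one>\<^bsub>T\<^esub>\<rangle>) \<cdot> (\<r>\<^bsub>T\<^esub> (src f))\<inverse>"
  by (rule inverse_of_nat; simp add: left_natural right_natural)+

lemma triangle_inv:
  "(\<r>\<^bsub>T\<^esub> A \<otimes>\<^sub>a\<^bsub>T\<^esub> \<langle>B\<rangle>) \<cdot> (\<alpha>\<^bsub>T\<^esub> A \<one>\<^bsub>T\<^esub> B)\<inverse> = \<langle>A\<rangle> \<otimes>\<^sub>a\<^bsub>T\<^esub> \<l>\<^bsub>T\<^esub> B"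
  by (simp flip: triangle)

lemma triangle_inv':
  "(\<alpha>\<^bsub>T\<^esub> A \<one>\<^bsub>T\<^esub> B)\<inverse> \<cdot> (\<langle>A\<rangle> \<otimes>\<^sub>a\<^bsub>T\<^esub> (\<l>\<^bsub>T\<^esub> B)\<inverse>) = (\<r>\<^bsub>T\<^esub> A)\<inverse> \<otimes>\<^sub>a\<^bsub>T\<^esub> \<langle>B\<rangle>"
  by (rule iso_left_cancel [of "\<r>\<^bsub>T\<^esub> A \<otimes>\<^sub>a\<^bsub>T\<^esub> \<langle>B\<rangle>"])
    (simp_all add: merge comp_extend [OF triangle_inv])

text \<open>Tensoring with the unit is naturally isomorphic to the identity functor, hence
  faithful.\<close>

lemma tens_unit_left_cancel:
  assumes "src f = src g" "tgt f = tgt g" "\<langle>\<one>\<^bsub>T\<^esub>\<rangle> \<otimes>\<^sub>a\<^bsub>T\<^esub> f = \<langle>\<one>\<^bsub>T\<^esub>\<rangle> \<otimes>\<^sub>a\<^bsub>T\<^esub> g"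
  shows "f = g"
  using left_natural [of f] left_natural [of g] assms
  by (metis iso_right_cancel left_iso tgt_left)

lemma tens_unit_right_cancel:
  assumes "src f = src g" "tgt f = tgt g" "f \<otimes>\<^sub>a\<^bsub>T\<^esub> \<langle>\<one>\<^bsub>T\<^esub>\<rangle> = g \<otimes>\<^sub>a\<^bsub>T\<^esub> \<langle>\<one>\<^bsub>T\<^esub>\<rangle>"
  shows "f = g"
  using right_natural [of f] right_natural [of g] assms
  by (metis iso_right_cancel right_iso tgt_right)

text \<open>Kelly's consequence of pentagon and triangle. Both sides are tensored with the unit,
  which is faithful, and compared after \<open>?i\<close>, two invertible legs of the
  pentagon.\<close>

lemma left_tens: "\<l>\<^bsub>T\<^esub> (A \<otimes>\<^bsub>T\<^esub> B) \<cdot> \<alpha>\<^bsub>T\<^esub> \<one>\<^bsub>T\<^esub> A B = \<l>\<^bsub>T\<^esub> A \<otimes>\<^sub>a\<^bsub>T\<^esub> \<langle>B\<rangle>"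
proof (rule tens_unit_left_cancel)
  let ?u = "\<one>\<^bsub>T\<^esub>"
  let ?i = "\<alpha>\<^bsub>T\<^esub> ?u (?u \<otimes>\<^bsub>T\<^esub> A) B \<cdot> (\<alpha>\<^bsub>T\<^esub> ?u ?u A \<otimes>\<^sub>a\<^bsub>T\<^esub> \<langle>B\<rangle>)"
  have "(\<langle>?u\<rangle> \<otimes>\<^sub>a\<^bsub>T\<^esub> (\<l>\<^bsub>T\<^esub> (A \<otimes>\<^bsub>T\<^esub> B) \<cdot> \<alpha>\<^bsub>T\<^esub> ?u A B)) \<cdot> ?i =
      (\<langle>?u\<rangle> \<otimes>\<^sub>a\<^bsub>T\<^esub> \<l>\<^bsub>T\<^esub> (A \<otimes>\<^bsub>T\<^esub> B)) \<cdot> ((\<langle>?u\<rangle> \<otimes>\<^sub>a\<^bsub>T\<^esub> \<alpha>\<^bsub>T\<^esub> ?u A B) \<cdot> ?i)"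
    by (simp add: merge_ext)
  also have "\<dots> = (\<langle>?u\<rangle> \<otimes>\<^sub>a\<^bsub>T\<^esub> \<l>\<^bsub>T\<^esub> (A \<otimes>\<^bsub>T\<^esub> B)) \<cdot> \<alpha>\<^bsub>T\<^esub> ?u ?u (A \<otimes>\<^bsub>T\<^esub> B) \<cdot> \<alpha>\<^bsub>T\<^esub> (?u \<otimes>\<^bsub>T\<^esub> ?u) A B"
    using pentagon [of ?u ?u A B] by simp
  also have "\<dots> = (\<r>\<^bsub>T\<^esub> ?u \<otimes>\<^sub>a\<^bsub>T\<^esub> \<langle>A \<otimes>\<^bsub>T\<^esub> B\<rangle>) \<cdot> \<alpha>\<^bsub>T\<^esub> (?u \<otimes>\<^bsub>T\<^esub> ?u) A B"
    by (simp add: triangle)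
  also have "\<dots> = \<alpha>\<^bsub>T\<^esub> ?u A B \<cdot> ((\<r>\<^bsub>T\<^esub> ?u \<otimes>\<^sub>a\<^bsub>T\<^esub> \<langle>A\<rangle>) \<otimes>\<^sub>a\<^bsub>T\<^esub> \<langle>B\<rangle>)"
    using assoc_natural [of "\<r>\<^bsub>T\<^esub> ?u" "\<langle>A\<rangle>" "\<langle>B\<rangle>"] by simp
  also have "\<dots> = \<alpha>\<^bsub>T\<^esub> ?u A B \<cdot> ((\<langle>?u\<rangle> \<otimes>\<^sub>a\<^bsub>T\<^esub> \<l>\<^bsub>T\<^esub> A) \<otimes>\<^sub>a\<^bsub>T\<^esub> \<langle>B\<rangle>) \<cdot> (\<alpha>\<^bsub>T\<^esub> ?u ?u A \<otimes>\<^sub>a\<^bsub>T\<^esub> \<langle>B\<rangle>)"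
    by (simp add: merge flip: triangle)
  also have "\<dots> = (\<langle>?u\<rangle> \<otimes>\<^sub>a\<^bsub>T\<^esub> (\<l>\<^bsub>T\<^esub> A \<otimes>\<^sub>a\<^bsub>T\<^esub> \<langle>B\<rangle>)) \<cdot> ?i"
    using assoc_natural [of "\<langle>?u\<rangle>" "\<l>\<^bsub>T\<^esub> A" "\<langle>B\<rangle>"] by simp
  finally show "\<langle>?u\<rangle> \<otimes>\<^sub>a\<^bsub>T\<^esub> (\<l>\<^bsub>T\<^esub> (A \<otimes>\<^bsub>T\<^esub> B) \<cdot> \<alpha>\<^bsub>T\<^esub> ?u A B) = \<langle>?u\<rangle> \<otimes>\<^sub>a\<^bsub>T\<^esub> (\<l>\<^bsub>T\<^esub> A \<otimes>\<^sub>a\<^bsub>T\<^esub> \<langle>B\<rangle>)"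
    by (rule iso_right_cancel [rotated -1]) simp_all
qed simp_all

text \<open>Naturality of the left constraint at itself shows that its value at the tensor square of
  the unit is the unit tensored with the constraint. \<open>left_tens\<close> and the triangle then
  agree up to the two arrows to be compared.\<close>

lemma left_unit_eq_right_unit: "\<l>\<^bsub>T\<^esub> \<one>\<^bsub>T\<^esub> = \<r>\<^bsub>T\<^esub> \<one>\<^bsub>T\<^esub>"
proof (rule tens_unit_right_cancel)
  let ?u = "\<one>\<^bsub>T\<^esub>"
  have "\<l>\<^bsub>T\<^esub> ?u \<cdot> \<l>\<^bsub>T\<^esub> (?u \<otimes>\<^bsub>T\<^esub> ?u) = \<l>\<^bsub>T\<^esub> ?u \<cdot> (\<langle>?u\<rangle> \<otimes>\<^sub>a\<^bsub>T\<^esub> \<l>\<^bsub>T\<^esub> ?u)"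
    using left_natural [of "\<l>\<^bsub>T\<^esub> ?u"] by simp
  then have "\<l>\<^bsub>T\<^esub> (?u \<otimes>\<^bsub>T\<^esub> ?u) = \<langle>?u\<rangle> \<otimes>\<^sub>a\<^bsub>T\<^esub> \<l>\<^bsub>T\<^esub> ?u"
    by (rule iso_left_cancel [rotated -1]) simp_all
  then show "\<l>\<^bsub>T\<^esub> ?u \<otimes>\<^sub>a\<^bsub>T\<^esub> \<langle>?u\<rangle> = \<r>\<^bsub>T\<^esub> ?u \<otimes>\<^sub>a\<^bsub>T\<^esub> \<langle>?u\<rangle>"
    using left_tens [of ?u ?u] triangle [of ?u ?u] by simp
qed simp_all

end

lemma rev_tensor_simps [simp]:
  "tens_ob (rev_tensor C T) A B = tens_ob T B A"
  "tens_arr (rev_tensor C T) f g = tens_arr T g f"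
  "tens_unit (rev_tensor C T) = tens_unit T"
  "tens_assoc (rev_tensor C T) A B D = inv_arr C (tens_assoc T D B A)"
  "tens_left (rev_tensor C T) = tens_right T"
  "tens_right (rev_tensor C T) = tens_left T"
  by (simp_all add: rev_tensor_def)

lemma (in monoidal_category) monoidal_rev: "monoidal_category C (rev_tensor C T)"
proof (unfold_locales, goal_cases)
  \<comment> \<open>The pentagon: reversed associators are inverses, so it arises from the pentagon
    of \<open>T\<close> at the objects in reverse order by inverting both sides.\<close>
  case (13 A B D E)
  show ?case
    using arg_cong [OF pentagon [of E D B A], of "inv_arr C"]
    by (simp add: inv_of_comp inv_tens)
qed (simp_all add: hom_iff merge left_natural right_natural assoc_inv_natural triangle_inv' triangle_inv)

lemma (in monoidal_category) right_tens:
  "\<r>\<^bsub>T\<^esub> (A \<otimes>\<^bsub>T\<^esub> B) \<cdot> (\<alpha>\<^bsub>T\<^esub> A B \<one>\<^bsub>T\<^esub>)\<inverse> = \<langle>A\<rangle> \<otimes>\<^sub>a\<^bsub>T\<^esub> \<r>\<^bsub>T\<^esub> B"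
  using monoidal_category.left_tens [OF monoidal_rev, of B A] by simp

lemma (in monoidal_category) right_tens_inv:
  "(\<alpha>\<^bsub>T\<^esub> A B \<one>\<^bsub>T\<^esub>)\<inverse> \<cdot> (\<langle>A\<rangle> \<otimes>\<^sub>a\<^bsub>T\<^esub> (\<r>\<^bsub>T\<^esub> B)\<inverse>) = (\<r>\<^bsub>T\<^esub> (A \<otimes>\<^bsub>T\<^esub> B))\<inverse>"
  by (rule iso_left_cancel [of "\<r>\<^bsub>T\<^esub> (A \<otimes>\<^bsub>T\<^esub> B)"])
    (simp_all add: comp_extend [OF right_tens] merge)

context duoidal_category
begin

lemma src_zeta [simp]: "src (\<zeta> A B D E) = (A \<bullet> B) \<odot> (D \<bullet> E)"
  and tgt_zeta [simp]: "tgt (\<zeta> A B D E) = (A \<odot> D) \<bullet> (B \<odot> E)"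
  using zeta_hom by (simp_all add: circ.hom_iff)

lemma src_comult_I [simp]: "src \<Delta>\<^sub>I = \<I>" and tgt_comult_I [simp]: "tgt \<Delta>\<^sub>I = \<I> \<bullet> \<I>"
  and src_counit_I [simp]: "src \<epsilon>\<^sub>I = \<I>" and tgt_counit_I [simp]: "tgt \<epsilon>\<^sub>I = \<J>"
  using I_comonoid by (simp_all add: comonoid_in_def circ.hom_iff)

lemma src_mult_J [simp]: "src m\<^sub>J = \<J> \<odot> \<J>" and tgt_mult_J [simp]: "tgt m\<^sub>J = \<J>"
  using J_monoid by (simp_all add: monoid_in_def circ.hom_iff)

lemma zeta_natural:
  "\<zeta> (tgt f) (tgt g) (tgt h) (tgt k) \<cdot> ((f \<bullet>\<^sub>a g) \<odot>\<^sub>a (h \<bullet>\<^sub>a k)) =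
    ((f \<odot>\<^sub>a h) \<bullet>\<^sub>a (g \<odot>\<^sub>a k)) \<cdot> \<zeta> (src f) (src g) (src h) (src k)"
  by (rule zeta_nat) (simp_all add: circ.hom_iff)

end

section \<open>Reversions\<close>

text \<open>
  Only these axioms of a reversion matter for Galois maps.  Reversal of both tensor products
  exchanges (R1) with (R3), (R2) with (R4), (R6) with (R7) and (R8) with (R9), and fixes (R5).
\<close>

locale galois_reversion = duoidal_category C
  for C :: "('o, 'm, 'x) reversion_scheme" (structure) +
  assumes rev_functor: "endofunctor C (rev_ob C) (rev_arr C)"
    and phi_circ_hom: "\<phi>\<^sup>\<odot> X Y \<in> X\<^sup>- \<odot> Y\<^sup>- \<rightarrow> (Y \<odot> X)\<^sup>-"
    and phi_circ_0_hom: "\<phi>\<^sup>\<odot>\<^sub>0 \<in> \<I> \<rightarrow> \<I>\<^sup>-"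
    and phi_circ_left: "(\<r>\<^sup>\<odot> X)\<^sup>-\<^sub>a \<cdot> \<phi>\<^sup>\<odot> \<I> X \<cdot> (\<phi>\<^sup>\<odot>\<^sub>0 \<odot>\<^sub>a \<langle>X\<^sup>-\<rangle>) = \<l>\<^sup>\<odot> (X\<^sup>-)"
    and phi_circ_right: "(\<l>\<^sup>\<odot> X)\<^sup>-\<^sub>a \<cdot> \<phi>\<^sup>\<odot> X \<I> \<cdot> (\<langle>X\<^sup>-\<rangle> \<odot>\<^sub>a \<phi>\<^sup>\<odot>\<^sub>0) = \<r>\<^sup>\<odot> (X\<^sup>-)"
    and gamma_hom: "\<gamma> X Y Z T \<in> ((X \<bullet> Y\<^sup>-) \<odot> Z) \<bullet> T \<rightarrow> X \<odot> (Z \<bullet> (Y \<odot> T))"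
    and gamma_nat:
      "\<lbrakk>f \<in> X \<rightarrow> X'; g \<in> Y \<rightarrow> Y'; h \<in> Z \<rightarrow> Z'; k \<in> T \<rightarrow> T'\<rbrakk> \<Longrightarrow>
        \<gamma> X' Y' Z' T' \<cdot> (((f \<bullet>\<^sub>a g\<^sup>-\<^sub>a) \<odot>\<^sub>a h) \<bullet>\<^sub>a k) = (f \<odot>\<^sub>a (h \<bullet>\<^sub>a (g \<odot>\<^sub>a k))) \<cdot> \<gamma> X Y Z T"
    and delta_hom: "\<delta> X Y Z T \<in> X \<bullet> (Y \<odot> (Z\<^sup>- \<bullet> T)) \<rightarrow> ((X \<odot> Z) \<bullet> Y) \<odot> T"
    and delta_nat:
      "\<lbrakk>f \<in> X \<rightarrow> X'; g \<in> Y \<rightarrow> Y'; h \<in> Z \<rightarrow> Z'; k \<in> T \<rightarrow> T'\<rbrakk> \<Longrightarrow>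
        \<delta> X' Y' Z' T' \<cdot> (f \<bullet>\<^sub>a (g \<odot>\<^sub>a (h\<^sup>-\<^sub>a \<bullet>\<^sub>a k))) = (((f \<odot>\<^sub>a h) \<bullet>\<^sub>a g) \<odot>\<^sub>a k) \<cdot> \<delta> X Y Z T"
    and R1:
      "\<gamma> X Y (Z \<odot> U) (T \<odot> V) \<cdot> (\<alpha>\<^sup>\<odot> (X \<bullet> Y\<^sup>-) Z U \<bullet>\<^sub>a \<langle>T \<odot> V\<rangle>) \<cdot> \<zeta> ((X \<bullet> Y\<^sup>-) \<odot> Z) T U V =
        (\<langle>X\<rangle> \<odot>\<^sub>a (\<langle>Z \<odot> U\<rangle> \<bullet>\<^sub>a \<alpha>\<^sup>\<odot> Y T V)) \<cdot> (\<langle>X\<rangle> \<odot>\<^sub>a \<zeta> Z (Y \<odot> T) U V) \<cdot>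
        \<alpha>\<^sup>\<odot> X (Z \<bullet> (Y \<odot> T)) (U \<bullet> V) \<cdot> (\<gamma> X Y Z T \<odot>\<^sub>a \<langle>U \<bullet> V\<rangle>)"
    and R2:
      "(\<langle>X \<odot> T\<rangle> \<bullet>\<^sub>a \<gamma> Y Z U V) \<cdot> \<alpha>\<^sup>\<bullet> (X \<odot> T) ((Y \<bullet> Z\<^sup>-) \<odot> U) V \<cdot>
        (\<zeta> X (Y \<bullet> Z\<^sup>-) T U \<bullet>\<^sub>a \<langle>V\<rangle>) \<cdot> ((\<alpha>\<^sup>\<bullet> X Y (Z\<^sup>-) \<odot>\<^sub>a \<langle>T \<bullet> U\<rangle>) \<bullet>\<^sub>a \<langle>V\<rangle>) =
        \<zeta> X Y T (U \<bullet> (Z \<odot> V)) \<cdot> (\<langle>X \<bullet> Y\<rangle> \<odot>\<^sub>a \<alpha>\<^sup>\<bullet> T U (Z \<odot> V)) \<cdot> \<gamma> (X \<bullet> Y) Z (T \<bullet> U) V"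
    and R3:
      "((\<alpha>\<^sup>\<odot> X Z U \<bullet>\<^sub>a \<langle>Y \<odot> T\<rangle>) \<odot>\<^sub>a \<langle>V\<rangle>) \<cdot> \<delta> (X \<odot> Z) (Y \<odot> T) U V \<cdot>
        (\<langle>X \<odot> Z\<rangle> \<bullet>\<^sub>a (\<alpha>\<^sup>\<odot> Y T (U\<^sup>- \<bullet> V))\<inverse>) \<cdot> \<zeta> X Y Z (T \<odot> (U\<^sup>- \<bullet> V)) =
        (\<zeta> X Y (Z \<odot> U) T \<odot>\<^sub>a \<langle>V\<rangle>) \<cdot> (\<alpha>\<^sup>\<odot> (X \<bullet> Y) ((Z \<odot> U) \<bullet> T) V)\<inverse> \<cdot>
        (\<langle>X \<bullet> Y\<rangle> \<odot>\<^sub>a \<delta> Z T U V)"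
    and R4:
      "(\<delta> X Y T U \<bullet>\<^sub>a \<langle>Z \<odot> V\<rangle>) \<cdot> (\<alpha>\<^sup>\<bullet> X (Y \<odot> (T\<^sup>- \<bullet> U)) (Z \<odot> V))\<inverse> \<cdot>
        (\<langle>X\<rangle> \<bullet>\<^sub>a \<zeta> Y Z (T\<^sup>- \<bullet> U) V) =
        \<zeta> ((X \<odot> T) \<bullet> Y) Z U V \<cdot> ((\<alpha>\<^sup>\<bullet> (X \<odot> T) Y Z)\<inverse> \<odot>\<^sub>a \<langle>U \<bullet> V\<rangle>) \<cdot>
        \<delta> X (Y \<bullet> Z) T (U \<bullet> V) \<cdot> (\<langle>X\<rangle> \<bullet>\<^sub>a (\<langle>Y \<bullet> Z\<rangle> \<odot>\<^sub>a \<alpha>\<^sup>\<bullet> (T\<^sup>-) U V))"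
    and R5:
      "\<delta> X Y T (U \<bullet> (Z \<odot> V)) \<cdot> (\<langle>X\<rangle> \<bullet>\<^sub>a (\<langle>Y\<rangle> \<odot>\<^sub>a \<alpha>\<^sup>\<bullet> (T\<^sup>-) U (Z \<odot> V))) \<cdot>
        (\<langle>X\<rangle> \<bullet>\<^sub>a \<gamma> Y Z (T\<^sup>- \<bullet> U) V) \<cdot> \<alpha>\<^sup>\<bullet> X ((Y \<bullet> Z\<^sup>-) \<odot> (T\<^sup>- \<bullet> U)) V =
        \<gamma> ((X \<odot> T) \<bullet> Y) Z U V \<cdot> (((\<alpha>\<^sup>\<bullet> (X \<odot> T) Y (Z\<^sup>-))\<inverse> \<odot>\<^sub>a \<langle>U\<rangle>) \<bullet>\<^sub>a \<langle>V\<rangle>) \<cdot>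
        (\<delta> X (Y \<bullet> Z\<^sup>-) T U \<bullet>\<^sub>a \<langle>V\<rangle>)"
    and R6:
      "\<l>\<^sup>\<odot> (\<I> \<bullet> \<I>) \<cdot> (\<langle>\<I>\<rangle> \<odot>\<^sub>a (\<langle>\<I>\<rangle> \<bullet>\<^sub>a \<l>\<^sup>\<odot> \<I>)) \<cdot> \<gamma> \<I> \<I> \<I> \<I> \<cdot>
        ((((\<langle>\<I>\<rangle> \<bullet>\<^sub>a \<phi>\<^sup>\<odot>\<^sub>0) \<cdot> \<Delta>\<^sub>I) \<odot>\<^sub>a \<langle>\<I>\<rangle>) \<bullet>\<^sub>a \<langle>\<I>\<rangle>) = \<l>\<^sup>\<odot> \<I> \<bullet>\<^sub>a \<langle>\<I>\<rangle>"
    and R7: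
      "\<r>\<^sup>\<odot> (\<I> \<bullet> \<I>) \<cdot> ((\<r>\<^sup>\<odot> \<I> \<bullet>\<^sub>a \<langle>\<I>\<rangle>) \<odot>\<^sub>a \<langle>\<I>\<rangle>) \<cdot> \<delta> \<I> \<I> \<I> \<I> \<cdot>
        (\<langle>\<I>\<rangle> \<bullet>\<^sub>a (\<langle>\<I>\<rangle> \<odot>\<^sub>a ((\<phi>\<^sup>\<odot>\<^sub>0 \<bullet>\<^sub>a \<langle>\<I>\<rangle>) \<cdot> \<Delta>\<^sub>I))) = \<langle>\<I>\<rangle> \<bullet>\<^sub>a \<r>\<^sup>\<odot> \<I>"
    and R8:
      "\<gamma> (X \<odot> Z) Y (\<J> \<odot> \<J>) U \<cdot> (\<alpha>\<^sup>\<odot> ((X \<odot> Z) \<bullet> Y\<^sup>-) \<J> \<J> \<bullet>\<^sub>a \<langle>U\<rangle>) \<cdot>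
        ((\<delta> X (Y\<^sup>-) Z \<J> \<odot>\<^sub>a \<langle>\<J>\<rangle>) \<bullet>\<^sub>a \<langle>U\<rangle>) \<cdot>
        (((\<langle>X\<rangle> \<bullet>\<^sub>a (\<langle>Y\<^sup>-\<rangle> \<odot>\<^sub>a (\<r>\<^sup>\<bullet> (Z\<^sup>-))\<inverse>)) \<odot>\<^sub>a \<langle>\<J>\<rangle>) \<bullet>\<^sub>a \<langle>U\<rangle>) =
        (\<langle>X \<odot> Z\<rangle> \<odot>\<^sub>a \<zeta> \<J> Y \<J> U) \<cdot> (\<langle>X \<odot> Z\<rangle> \<odot>\<^sub>a ((\<l>\<^sup>\<bullet> Y)\<inverse> \<odot>\<^sub>a (\<l>\<^sup>\<bullet> U)\<inverse>)) \<cdot>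
        (\<alpha>\<^sup>\<odot> X Z (Y \<odot> U))\<inverse> \<cdot> (\<langle>X\<rangle> \<odot>\<^sub>a \<alpha>\<^sup>\<odot> Z Y U) \<cdot> (\<langle>X\<rangle> \<odot>\<^sub>a \<l>\<^sup>\<bullet> ((Z \<odot> Y) \<odot> U)) \<cdot>
        \<gamma> X (Z \<odot> Y) \<J> U \<cdot> (((\<langle>X\<rangle> \<bullet>\<^sub>a \<phi>\<^sup>\<odot> Y Z) \<odot>\<^sub>a \<langle>\<J>\<rangle>) \<bullet>\<^sub>a \<langle>U\<rangle>)"
    and R9:
      "\<delta> X (\<J> \<odot> \<J>) Z (Y \<odot> U) \<cdot> (\<langle>X\<rangle> \<bullet>\<^sub>a (\<alpha>\<^sup>\<odot> \<J> \<J> (Z\<^sup>- \<bullet> (Y \<odot> U)))\<inverse>) \<cdot>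
        (\<langle>X\<rangle> \<bullet>\<^sub>a (\<langle>\<J>\<rangle> \<odot>\<^sub>a \<gamma> \<J> Y (Z\<^sup>-) U)) \<cdot>
        (\<langle>X\<rangle> \<bullet>\<^sub>a (\<langle>\<J>\<rangle> \<odot>\<^sub>a (((\<l>\<^sup>\<bullet> (Y\<^sup>-))\<inverse> \<odot>\<^sub>a \<langle>Z\<^sup>-\<rangle>) \<bullet>\<^sub>a \<langle>U\<rangle>))) =
        (\<zeta> X \<J> Z \<J> \<odot>\<^sub>a \<langle>Y \<odot> U\<rangle>) \<cdot> (((\<r>\<^sup>\<bullet> X)\<inverse> \<odot>\<^sub>a (\<r>\<^sup>\<bullet> Z)\<inverse>) \<odot>\<^sub>a \<langle>Y \<odot> U\<rangle>) \<cdot>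
        \<alpha>\<^sup>\<odot> (X \<odot> Z) Y U \<cdot> ((\<alpha>\<^sup>\<odot> X Z Y)\<inverse> \<odot>\<^sub>a \<langle>U\<rangle>) \<cdot> (\<r>\<^sup>\<bullet> (X \<odot> (Z \<odot> Y)) \<odot>\<^sub>a \<langle>U\<rangle>) \<cdot>
        \<delta> X \<J> (Z \<odot> Y) U \<cdot> (\<langle>X\<rangle> \<bullet>\<^sub>a (\<langle>\<J>\<rangle> \<odot>\<^sub>a (\<phi>\<^sup>\<odot> Y Z \<bullet>\<^sub>a \<langle>U\<rangle>)))"
begin

lemma src_rev_arr [simp]: "src (f\<^sup>-\<^sub>a) = (src f)\<^sup>-" and tgt_rev_arr [simp]: "tgt (f\<^sup>-\<^sub>a) = (tgt f)\<^sup>-"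
  and rev_ident [simp]: "\<langle>A\<rangle>\<^sup>-\<^sub>a = \<langle>A\<^sup>-\<rangle>"
  and rev_comp: "tgt f = src g \<Longrightarrow> (g \<cdot> f)\<^sup>-\<^sub>a = g\<^sup>-\<^sub>a \<cdot> f\<^sup>-\<^sub>a"
  using endofunctor.functor_hom [OF rev_functor] endofunctor.functor_ident [OF rev_functor]
    endofunctor.functor_comp [OF rev_functor]
  by (simp_all add: circ.hom_iff)

lemma src_phi_circ [simp]: "src (\<phi>\<^sup>\<odot> X Y) = X\<^sup>- \<odot> Y\<^sup>-"
  and tgt_phi_circ [simp]: "tgt (\<phi>\<^sup>\<odot> X Y) = (Y \<odot> X)\<^sup>-"
  and src_phi_circ_0 [simp]: "src \<phi>\<^sup>\<odot>\<^sub>0 = \<I>" and tgt_phi_circ_0 [simp]: "tgt \<phi>\<^sup>\<odot>\<^sub>0 = \<I>\<^sup>-"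
  and src_gamma [simp]: "src (\<gamma> X Y Z T) = ((X \<bullet> Y\<^sup>-) \<odot> Z) \<bullet> T"
  and tgt_gamma [simp]: "tgt (\<gamma> X Y Z T) = X \<odot> (Z \<bullet> (Y \<odot> T))"
  and src_delta [simp]: "src (\<delta> X Y Z T) = X \<bullet> (Y \<odot> (Z\<^sup>- \<bullet> T))"
  and tgt_delta [simp]: "tgt (\<delta> X Y Z T) = ((X \<odot> Z) \<bullet> Y) \<odot> T"
  using phi_circ_hom phi_circ_0_hom gamma_hom delta_hom by (simp_all add: circ.hom_iff)

lemma gamma_natural:
  "\<gamma> (tgt f) (tgt g) (tgt h) (tgt k) \<cdot> (((f \<bullet>\<^sub>a g\<^sup>-\<^sub>a) \<odot>\<^sub>a h) \<bullet>\<^sub>a k) =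
    (f \<odot>\<^sub>a (h \<bullet>\<^sub>a (g \<odot>\<^sub>a k))) \<cdot> \<gamma> (src f) (src g) (src h) (src k)"
  by (rule gamma_nat) (simp_all add: circ.hom_iff)

lemma delta_natural:
  "\<delta> (tgt f) (tgt g) (tgt h) (tgt k) \<cdot> (f \<bullet>\<^sub>a (g \<odot>\<^sub>a (h\<^sup>-\<^sub>a \<bullet>\<^sub>a k))) =
    (((f \<odot>\<^sub>a h) \<bullet>\<^sub>a g) \<odot>\<^sub>a k) \<cdot> \<delta> (src f) (src g) (src h) (src k)"
  by (rule delta_nat) (simp_all add: circ.hom_iff)

text \<open>Coevaluations of the unit object: \<open>\<Delta>\<^sub>I\<close> doubles \<I>, and
  \<open>\<phi>\<^sup>\<odot>\<^sub>0\<close> replaces one copy by its reverse. (R6) contains the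
  first, (R7) the second, and reversal exchanges them.\<close>

abbreviation coev_right ("\<^bold>j") where "\<^bold>j \<equiv> (\<langle>\<I>\<rangle> \<bullet>\<^sub>a \<phi>\<^sup>\<odot>\<^sub>0) \<cdot> \<Delta>\<^sub>I"
abbreviation coev_left ("\<^bold>k") where "\<^bold>k \<equiv> (\<phi>\<^sup>\<odot>\<^sub>0 \<bullet>\<^sub>a \<langle>\<I>\<rangle>) \<cdot> \<Delta>\<^sub>I"

text \<open>(R6) is the case \<open>U = V = \<I>\<close>; the general case follows from it by (R1).\<close>

lemma gamma_unit:
  "\<l>\<^sup>\<odot> (U \<bullet> V) \<cdot> (\<langle>\<I>\<rangle> \<odot>\<^sub>a (\<langle>U\<rangle> \<bullet>\<^sub>a \<l>\<^sup>\<odot> V)) \<cdot> \<gamma> \<I> \<I> U V \<cdot> ((\<^bold>j \<odot>\<^sub>a \<langle>U\<rangle>) \<bullet>\<^sub>a \<langle>V\<rangle>) =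
    \<l>\<^sup>\<odot> U \<bullet>\<^sub>a \<langle>V\<rangle>" (is "?G = _")
proof -
  let ?p = "\<l>\<^sup>\<odot> (U \<bullet> V) \<cdot> (\<langle>\<I>\<rangle> \<odot>\<^sub>a (\<l>\<^sup>\<odot> U \<bullet>\<^sub>a (\<l>\<^sup>\<odot> V \<cdot> (\<langle>\<I>\<rangle> \<odot>\<^sub>a \<l>\<^sup>\<odot> V))))"
  let ?q = "((\<^bold>j \<odot>\<^sub>a \<langle>\<I>\<rangle>) \<bullet>\<^sub>a \<langle>\<I>\<rangle>) \<odot>\<^sub>a \<langle>U \<bullet> V\<rangle>"
  let ?z = "\<zeta> \<I> \<I> U V" and ?i = "(\<l>\<^sup>\<odot> \<I> \<bullet>\<^sub>a \<langle>\<I>\<rangle>) \<odot>\<^sub>a \<langle>U \<bullet> V\<rangle>"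
  \<comment> \<open>(R1) controls \<gamma> only after \<zeta>, and (R6) ends in a left unit
    constraint. Composing the claim with both makes these axioms applicable; the two extra arrows
    are removed at the end.\<close>
  have "?G \<cdot> (\<langle>\<I> \<odot> U\<rangle> \<bullet>\<^sub>a \<l>\<^sup>\<odot> V) \<cdot> ?z \<cdot> ?i =
      ?G \<cdot> ((\<l>\<^sup>\<odot> \<I> \<odot>\<^sub>a \<langle>U\<rangle>) \<bullet>\<^sub>a \<l>\<^sup>\<odot> V) \<cdot> \<zeta> (\<I> \<odot> \<I>) \<I> U V"
    using zeta_natural [of "\<l>\<^sup>\<odot> \<I>" "\<langle>\<I>\<rangle>" "\<langle>U\<rangle>" "\<langle>V\<rangle>"] by (simp add: bull.merge_ext)
  also have "\<dots> = \<l>\<^sup>\<odot> (U \<bullet> V) \<cdot> (\<langle>\<I>\<rangle> \<odot>\<^sub>a (\<langle>U\<rangle> \<bullet>\<^sub>a \<l>\<^sup>\<odot> V)) \<cdot>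
      (\<gamma> \<I> \<I> U V \<cdot> ((\<langle>\<I> \<bullet> \<I>\<^sup>-\<rangle> \<odot>\<^sub>a \<l>\<^sup>\<odot> U) \<bullet>\<^sub>a \<l>\<^sup>\<odot> V)) \<cdot> (((\<^bold>j \<odot>\<^sub>a \<langle>\<I> \<odot> U\<rangle>) \<cdot> \<alpha>\<^sup>\<odot> \<I> \<I> U) \<bullet>\<^sub>a \<langle>\<I> \<odot> V\<rangle>) \<cdot> \<zeta> (\<I> \<odot> \<I>) \<I> U V"
    by (simp add: bull.merge_ext circ.merge circ.merge_ext circ.left_unit_eq_right_unit flip: circ.triangle)
  also have "\<dots> = \<l>\<^sup>\<odot> (U \<bullet> V) \<cdot> (\<langle>\<I>\<rangle> \<odot>\<^sub>a (\<langle>U\<rangle> \<bullet>\<^sub>a \<l>\<^sup>\<odot> V)) \<cdot>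
      ((\<langle>\<I>\<rangle> \<odot>\<^sub>a (\<l>\<^sup>\<odot> U \<bullet>\<^sub>a (\<langle>\<I>\<rangle> \<odot>\<^sub>a \<l>\<^sup>\<odot> V))) \<cdot> \<gamma> \<I> \<I> (\<I> \<odot> U) (\<I> \<odot> V)) \<cdot>
      ((\<alpha>\<^sup>\<odot> (\<I> \<bullet> \<I>\<^sup>-) \<I> U \<cdot> ((\<^bold>j \<odot>\<^sub>a \<langle>\<I>\<rangle>) \<odot>\<^sub>a \<langle>U\<rangle>)) \<bullet>\<^sub>a \<langle>\<I> \<odot> V\<rangle>) \<cdot> \<zeta> (\<I> \<odot> \<I>) \<I> U V"
    using gamma_natural [of "\<langle>\<I>\<rangle>" "\<langle>\<I>\<rangle>" "\<l>\<^sup>\<odot> U" "\<l>\<^sup>\<odot> V"] circ.assoc_natural [of "\<^bold>j" "\<langle>\<I>\<rangle>" "\<langle>U\<rangle>"] by simp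
  also have "\<dots> = ?p \<cdot> \<gamma> \<I> \<I> (\<I> \<odot> U) (\<I> \<odot> V) \<cdot> (\<alpha>\<^sup>\<odot> (\<I> \<bullet> \<I>\<^sup>-) \<I> U \<bullet>\<^sub>a \<langle>\<I> \<odot> V\<rangle>) \<cdot>
      ((((\<^bold>j \<odot>\<^sub>a \<langle>\<I>\<rangle>) \<odot>\<^sub>a \<langle>U\<rangle>) \<bullet>\<^sub>a \<langle>\<I> \<odot> V\<rangle>) \<cdot> \<zeta> (\<I> \<odot> \<I>) \<I> U V)"
    by (simp add: bull.merge bull.merge_ext circ.merge_ext)
  also have "\<dots> = ?p \<cdot> (\<gamma> \<I> \<I> (\<I> \<odot> U) (\<I> \<odot> V) \<cdot> (\<alpha>\<^sup>\<odot> (\<I> \<bullet> \<I>\<^sup>-) \<I> U \<bullet>\<^sub>a \<langle>\<I> \<odot> V\<rangle>) \<cdot>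
      \<zeta> ((\<I> \<bullet> \<I>\<^sup>-) \<odot> \<I>) \<I> U V) \<cdot> ?q"
    using zeta_natural [of "\<^bold>j \<odot>\<^sub>a \<langle>\<I>\<rangle>" "\<langle>\<I>\<rangle>" "\<langle>U\<rangle>" "\<langle>V\<rangle>"] by simp
  \<comment> \<open>(R1) with X = Y = Z = T = \<I> exchanges \<gamma> at \<I> \<odot> U and \<I>
    \<odot> V for \<gamma> with all arguments \<I>, the one that (R6) evaluates.\<close>
  also have "\<dots> = \<l>\<^sup>\<odot> (U \<bullet> V) \<cdot> (\<langle>\<I>\<rangle> \<odot>\<^sub>a ((\<l>\<^sup>\<odot> U \<bullet>\<^sub>a (\<l>\<^sup>\<odot> V \<cdot> (\<langle>\<I>\<rangle> \<odot>\<^sub>a \<l>\<^sup>\<odot> V) \<cdot> \<alpha>\<^sup>\<odot> \<I> \<I> V)) \<cdot> \<zeta> \<I> (\<I> \<odot> \<I>) U V)) \<cdot>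
      \<alpha>\<^sup>\<odot> \<I> (\<I> \<bullet> (\<I> \<odot> \<I>)) (U \<bullet> V) \<cdot> (\<gamma> \<I> \<I> \<I> \<I> \<odot>\<^sub>a \<langle>U \<bullet> V\<rangle>) \<cdot> ?q"
    by (subst R1) (simp add: bull.merge bull.merge_ext circ.merge_ext)
  also have "\<dots> = \<l>\<^sup>\<odot> (U \<bullet> V) \<cdot> (\<langle>\<I>\<rangle> \<odot>\<^sub>a ((\<l>\<^sup>\<odot> U \<bullet>\<^sub>a \<l>\<^sup>\<odot> V) \<cdot> ((\<langle>\<I> \<odot> U\<rangle> \<bullet>\<^sub>a (\<l>\<^sup>\<odot> \<I> \<odot>\<^sub>a \<langle>V\<rangle>)) \<cdot> \<zeta> \<I> (\<I> \<odot> \<I>) U V))) \<cdot>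
      \<alpha>\<^sup>\<odot> \<I> (\<I> \<bullet> (\<I> \<odot> \<I>)) (U \<bullet> V) \<cdot> (\<gamma> \<I> \<I> \<I> \<I> \<odot>\<^sub>a \<langle>U \<bullet> V\<rangle>) \<cdot> ?q"
    by (simp add: bull.merge_ext circ.triangle circ.left_unit_eq_right_unit)
  also have "\<dots> = (\<l>\<^sup>\<odot> (U \<bullet> V) \<cdot> (\<langle>\<I>\<rangle> \<odot>\<^sub>a ((\<l>\<^sup>\<odot> U \<bullet>\<^sub>a \<l>\<^sup>\<odot> V) \<cdot> ?z))) \<cdot>
      ((\<langle>\<I>\<rangle> \<odot>\<^sub>a ((\<langle>\<I>\<rangle> \<bullet>\<^sub>a \<l>\<^sup>\<odot> \<I>) \<odot>\<^sub>a \<langle>U \<bullet> V\<rangle>)) \<cdot>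
      \<alpha>\<^sup>\<odot> \<I> (\<I> \<bullet> (\<I> \<odot> \<I>)) (U \<bullet> V)) \<cdot> (\<gamma> \<I> \<I> \<I> \<I> \<odot>\<^sub>a \<langle>U \<bullet> V\<rangle>) \<cdot> ?q"
    using zeta_natural [of "\<langle>\<I>\<rangle>" "\<l>\<^sup>\<odot> \<I>" "\<langle>U\<rangle>" "\<langle>V\<rangle>"] by (simp add: circ.merge_ext)
  also have "\<dots> = ((\<l>\<^sup>\<odot> U \<bullet>\<^sub>a \<l>\<^sup>\<odot> V) \<cdot> ?z \<cdot> \<l>\<^sup>\<odot> ((\<I> \<bullet> \<I>) \<odot> (U \<bullet> V))) \<cdot>
      (\<alpha>\<^sup>\<odot> \<I> (\<I> \<bullet> \<I>) (U \<bullet> V) \<cdot> ((\<langle>\<I>\<rangle> \<odot>\<^sub>a (\<langle>\<I>\<rangle> \<bullet>\<^sub>a \<l>\<^sup>\<odot> \<I>)) \<odot>\<^sub>a \<langle>U \<bullet> V\<rangle>)) \<cdot> (\<gamma> \<I> \<I> \<I> \<I> \<odot>\<^sub>a \<langle>U \<bullet> V\<rangle>) \<cdot> ?q"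
    using circ.left_natural [of "(\<l>\<^sup>\<odot> U \<bullet>\<^sub>a \<l>\<^sup>\<odot> V) \<cdot> ?z"]
      circ.assoc_natural [of "\<langle>\<I>\<rangle>" "\<langle>\<I>\<rangle> \<bullet>\<^sub>a \<l>\<^sup>\<odot> \<I>" "\<langle>U \<bullet> V\<rangle>"] by simp
  also have "\<dots> = (\<l>\<^sup>\<odot> U \<bullet>\<^sub>a \<l>\<^sup>\<odot> V) \<cdot> ?z \<cdot> (\<l>\<^sup>\<odot> (\<I> \<bullet> \<I>) \<odot>\<^sub>a \<langle>U \<bullet> V\<rangle>) \<cdot>
      (((\<langle>\<I>\<rangle> \<odot>\<^sub>a (\<langle>\<I>\<rangle> \<bullet>\<^sub>a \<l>\<^sup>\<odot> \<I>)) \<odot>\<^sub>a \<langle>U \<bullet> V\<rangle>) \<cdot> (\<gamma> \<I> \<I> \<I> \<I> \<odot>\<^sub>a \<langle>U \<bullet> V\<rangle>) \<cdot> ?q)"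
    by (simp add: circ.comp_extend [OF circ.left_tens])
  also have "\<dots> = (\<l>\<^sup>\<odot> U \<bullet>\<^sub>a \<l>\<^sup>\<odot> V) \<cdot> ?z \<cdot> ?i"
    using R6 by (simp add: circ.merge)
  finally have eq: "(?G \<cdot> (\<langle>\<I> \<odot> U\<rangle> \<bullet>\<^sub>a \<l>\<^sup>\<odot> V) \<cdot> ?z) \<cdot> ?i = ((\<l>\<^sup>\<odot> U \<bullet>\<^sub>a \<l>\<^sup>\<odot> V) \<cdot> ?z) \<cdot> ?i" by simp
  have "?G \<cdot> (\<langle>\<I> \<odot> U\<rangle> \<bullet>\<^sub>a \<l>\<^sup>\<odot> V) \<cdot> ?z = (\<l>\<^sup>\<odot> U \<bullet>\<^sub>a \<l>\<^sup>\<odot> V) \<cdot> ?z"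
    by (rule circ.iso_right_cancel [OF _ _ _ eq]) simp_all
  \<comment> \<open>\<zeta> itself cannot be cancelled, but composed with
    \<open>\<Delta>\<^sub>I\<close> it is invertible by \<open>zeta_circ_left\<close>.\<close>
  then have "?G \<cdot> (\<langle>\<I> \<odot> U\<rangle> \<bullet>\<^sub>a \<l>\<^sup>\<odot> V) \<cdot> ?z \<cdot> (\<Delta>\<^sub>I \<odot>\<^sub>a \<langle>U \<bullet> V\<rangle>) =
      (\<l>\<^sup>\<odot> U \<bullet>\<^sub>a \<l>\<^sup>\<odot> V) \<cdot> ?z \<cdot> (\<Delta>\<^sub>I \<odot>\<^sub>a \<langle>U \<bullet> V\<rangle>)"
    by (simp flip: circ.assoc)
  moreover have "?z \<cdot> (\<Delta>\<^sub>I \<odot>\<^sub>a \<langle>U \<bullet> V\<rangle>) = ((\<l>\<^sup>\<odot> U)\<inverse> \<bullet>\<^sub>a (\<l>\<^sup>\<odot> V)\<inverse>) \<cdot> \<l>\<^sup>\<odot> (U \<bullet> V)"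
    by (simp add: bull.merge_ext flip: zeta_circ_left)
  ultimately have eq: "(?G \<cdot> ((\<l>\<^sup>\<odot> U)\<inverse> \<bullet>\<^sub>a \<langle>V\<rangle>)) \<cdot> \<l>\<^sup>\<odot> (U \<bullet> V) = \<l>\<^sup>\<odot> (U \<bullet> V)"
    by (simp add: bull.merge_ext)
  have "?G \<cdot> ((\<l>\<^sup>\<odot> U)\<inverse> \<bullet>\<^sub>a \<langle>V\<rangle>) = \<langle>U \<bullet> V\<rangle>"
    by (rule circ.iso_right_cancel [of "\<l>\<^sup>\<odot> (U \<bullet> V)"]) (use eq in simp_all)
  then have "(?G \<cdot> ((\<l>\<^sup>\<odot> U)\<inverse> \<bullet>\<^sub>a \<langle>V\<rangle>)) \<cdot> (\<l>\<^sup>\<odot> U \<bullet>\<^sub>a \<langle>V\<rangle>) = \<l>\<^sup>\<odot> U \<bullet>\<^sub>a \<langle>V\<rangle>"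
    by simp
  then show ?thesis by (simp add: bull.merge)
qed

text \<open>The instance of \<delta> from which w is built, with the unit in its source absorbed.
  For Q = \<J> it is \<open>varphi\<close> up to a unit constraint.\<close>

definition delta_I :: "'o \<Rightarrow> 'o \<Rightarrow> 'o \<Rightarrow> 'm"
  where "delta_I X T Q = \<delta> X \<I> T Q \<cdot> (\<langle>X\<rangle> \<bullet>\<^sub>a (\<l>\<^sup>\<odot> (T\<^sup>- \<bullet> Q))\<inverse>)"

lemma src_delta_I [simp]: "src (delta_I X T Q) = X \<bullet> (T\<^sup>- \<bullet> Q)"
  and tgt_delta_I [simp]: "tgt (delta_I X T Q) = ((X \<odot> T) \<bullet> \<I>) \<odot> Q"
  by (simp_all add: delta_I_def)

lemma delta_I_natural:
  "delta_I (tgt f) (tgt h) (tgt k) \<cdot> (f \<bullet>\<^sub>a (h\<^sup>-\<^sub>a \<bullet>\<^sub>a k)) =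
    (((f \<odot>\<^sub>a h) \<bullet>\<^sub>a \<langle>\<I>\<rangle>) \<odot>\<^sub>a k) \<cdot> delta_I (src f) (src h) (src k)"
proof -
  have "delta_I (tgt f) (tgt h) (tgt k) \<cdot> (f \<bullet>\<^sub>a (h\<^sup>-\<^sub>a \<bullet>\<^sub>a k)) =
      (\<delta> (tgt f) \<I> (tgt h) (tgt k) \<cdot> (f \<bullet>\<^sub>a (\<langle>\<I>\<rangle> \<odot>\<^sub>a (h\<^sup>-\<^sub>a \<bullet>\<^sub>a k)))) \<cdot>
        (\<langle>src f\<rangle> \<bullet>\<^sub>a (\<l>\<^sup>\<odot> ((src h)\<^sup>- \<bullet> (src k)))\<inverse>)"
    using circ.left_inv_natural [of "h\<^sup>-\<^sub>a \<bullet>\<^sub>a k"] by (simp add: delta_I_def bull.merge)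
  then show ?thesis
    using circ.comp_extend [OF delta_natural [of f "\<langle>\<I>\<rangle>" h k]]
    by (simp add: delta_I_def)
qed

lemma delta_I_bull_unit: "delta_I X Y \<J> \<cdot> (\<langle>X\<rangle> \<bullet>\<^sub>a (\<r>\<^sup>\<bullet> (Y\<^sup>-))\<inverse>) = \<phi> X Y"
  using circ.left_inv_natural [of "(\<r>\<^sup>\<bullet> (Y\<^sup>-))\<inverse>"]
  by (simp add: delta_I_def varphi_def bull.merge)

text \<open>Writing Y as Y \<odot> \<I> lets (R3) send only the factor \<I> into \<delta>, while Y
  stays with \<zeta>. The \<open>delta_I\<close> that results mentions neither X nor Y.\<close>

lemma delta_zeta:
  "((\<alpha>\<^sup>\<odot> X Z U \<bullet>\<^sub>a \<langle>Y\<rangle>) \<odot>\<^sub>a \<langle>V\<rangle>) \<cdot> \<delta> (X \<odot> Z) Y U V \<cdot> \<zeta> X Y Z (U\<^sup>- \<bullet> V) =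
    (((\<langle>X \<odot> (Z \<odot> U)\<rangle> \<bullet>\<^sub>a \<r>\<^sup>\<odot> Y) \<cdot> \<zeta> X Y (Z \<odot> U) \<I>) \<odot>\<^sub>a \<langle>V\<rangle>) \<cdot>
      (\<alpha>\<^sup>\<odot> (X \<bullet> Y) ((Z \<odot> U) \<bullet> \<I>) V)\<inverse> \<cdot> (\<langle>X \<bullet> Y\<rangle> \<odot>\<^sub>a delta_I Z U V)" (is "_ = ?rhs")
proof -
  let ?N = "U\<^sup>- \<bullet> V"
  let ?p = "(\<langle>X \<odot> (Z \<odot> U)\<rangle> \<bullet>\<^sub>a \<r>\<^sup>\<odot> Y) \<odot>\<^sub>a \<langle>V\<rangle>"
  let ?q = "\<langle>X \<bullet> Y\<rangle> \<odot>\<^sub>a (\<langle>Z\<rangle> \<bullet>\<^sub>a (\<l>\<^sup>\<odot> ?N)\<inverse>)"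
  have "?rhs = ?p \<cdot> ((\<zeta> X Y (Z \<odot> U) \<I> \<odot>\<^sub>a \<langle>V\<rangle>) \<cdot> (\<alpha>\<^sup>\<odot> (X \<bullet> Y) ((Z \<odot> U) \<bullet> \<I>) V)\<inverse> \<cdot>
        (\<langle>X \<bullet> Y\<rangle> \<odot>\<^sub>a \<delta> Z \<I> U V)) \<cdot> ?q"
    by (simp add: delta_I_def circ.merge_ext circ.merge)
  also have "\<dots> = ?p \<cdot> ((\<alpha>\<^sup>\<odot> X Z U \<bullet>\<^sub>a \<langle>Y \<odot> \<I>\<rangle>) \<odot>\<^sub>a \<langle>V\<rangle>) \<cdot> \<delta> (X \<odot> Z) (Y \<odot> \<I>) U V \<cdot>
        (\<langle>X \<odot> Z\<rangle> \<bullet>\<^sub>a (\<alpha>\<^sup>\<odot> Y \<I> ?N)\<inverse>) \<cdot> (\<zeta> X Y Z (\<I> \<odot> ?N) \<cdot> ?q)"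
    by (subst R3 [symmetric]) simp
  also have "\<dots> = ((\<alpha>\<^sup>\<odot> X Z U \<bullet>\<^sub>a \<langle>Y\<rangle>) \<odot>\<^sub>a \<langle>V\<rangle>) \<cdot>
        (((\<langle>(X \<odot> Z) \<odot> U\<rangle> \<bullet>\<^sub>a \<r>\<^sup>\<odot> Y) \<odot>\<^sub>a \<langle>V\<rangle>) \<cdot> \<delta> (X \<odot> Z) (Y \<odot> \<I>) U V) \<cdot>
        (\<langle>X \<odot> Z\<rangle> \<bullet>\<^sub>a (\<alpha>\<^sup>\<odot> Y \<I> ?N)\<inverse>) \<cdot> (\<langle>X \<odot> Z\<rangle> \<bullet>\<^sub>a (\<langle>Y\<rangle> \<odot>\<^sub>a (\<l>\<^sup>\<odot> ?N)\<inverse>)) \<cdot> \<zeta> X Y Z ?N"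
    using zeta_natural [of "\<langle>X\<rangle>" "\<langle>Y\<rangle>" "\<langle>Z\<rangle>" "(\<l>\<^sup>\<odot> ?N)\<inverse>"]
    by (simp add: circ.merge_ext bull.merge bull.merge_ext)
  also have "\<dots> = ((\<alpha>\<^sup>\<odot> X Z U \<bullet>\<^sub>a \<langle>Y\<rangle>) \<odot>\<^sub>a \<langle>V\<rangle>) \<cdot>
        (\<delta> (X \<odot> Z) Y U V \<cdot> (\<langle>X \<odot> Z\<rangle> \<bullet>\<^sub>a (\<r>\<^sup>\<odot> Y \<odot>\<^sub>a \<langle>?N\<rangle>))) \<cdot>
        (\<langle>X \<odot> Z\<rangle> \<bullet>\<^sub>a (\<alpha>\<^sup>\<odot> Y \<I> ?N)\<inverse>) \<cdot> (\<langle>X \<odot> Z\<rangle> \<bullet>\<^sub>a (\<langle>Y\<rangle> \<odot>\<^sub>a (\<l>\<^sup>\<odot> ?N)\<inverse>)) \<cdot> \<zeta> X Y Z ?N"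
    using delta_natural [of "\<langle>X \<odot> Z\<rangle>" "\<r>\<^sup>\<odot> Y" "\<langle>U\<rangle>" "\<langle>V\<rangle>"] by simp
  \<comment> \<open>The unit that (R3) inserted cancels: by the triangle the arrows between \<delta>
    and \<zeta> compose to the identity.\<close>
  also have "\<dots> = ((\<alpha>\<^sup>\<odot> X Z U \<bullet>\<^sub>a \<langle>Y\<rangle>) \<odot>\<^sub>a \<langle>V\<rangle>) \<cdot> \<delta> (X \<odot> Z) Y U V \<cdot> \<zeta> X Y Z ?N"
    by (simp add: bull.merge_ext circ.triangle_inv' circ.merge)
  finally show ?thesis by simp
qed

lemma src_varphi [simp]: "src (\<phi> X Y) = X \<bullet> Y\<^sup>-" and tgt_varphi [simp]: "tgt (\<phi> X Y) = ((X \<odot> Y) \<bullet> \<I>) \<odot> \<J>"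
  by (simp_all add: varphi_def)

lemma src_psi [simp]: "src (\<psi> X Y) = X\<^sup>- \<bullet> Y" and tgt_psi [simp]: "tgt (\<psi> X Y) = \<J> \<odot> (\<I> \<bullet> (X \<odot> Y))"
  by (simp_all add: psi_def)

text \<open>
  By (R5), \<open>cap\<close> rebuilds \<open>\<delta>\<close> with arbitrary last argument \<open>Q\<close> from \<open>\<phi>\<close>, where that argument is \<open>\<J>\<close>.
\<close>

definition cap :: "'o \<Rightarrow> 'o \<Rightarrow> 'm"
  where "cap A Q = (\<langle>A \<bullet> \<I>\<rangle> \<odot>\<^sub>a (\<l>\<^sup>\<bullet> Q \<cdot> (\<langle>\<J>\<rangle> \<bullet>\<^sub>a \<l>\<^sup>\<odot> Q))) \<cdot> \<gamma> (A \<bullet> \<I>) \<I> \<J> Q \<cdot>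
    ((((\<alpha>\<^sup>\<bullet> A \<I> (\<I>\<^sup>-))\<inverse> \<cdot> (\<langle>A\<rangle> \<bullet>\<^sub>a \<^bold>j)) \<odot>\<^sub>a \<langle>\<J>\<rangle>) \<bullet>\<^sub>a \<langle>Q\<rangle>)"

lemma src_cap [simp]: "src (cap A Q) = ((A \<bullet> \<I>) \<odot> \<J>) \<bullet> Q"
  and tgt_cap [simp]: "tgt (cap A Q) = (A \<bullet> \<I>) \<odot> Q"
  by (simp_all add: cap_def)

text \<open>A enters only through the first argument of \<gamma>, so arrows out of A slide through.
  Applied to m this assembles \<open>conv_id_left\<close>; applied to u it evaluates
  \<open>conv_unit_left\<close>.\<close>

lemma cap_natural:
  "cap (tgt f) Q \<cdot> (((f \<bullet>\<^sub>a \<langle>\<I>\<rangle>) \<odot>\<^sub>a \<langle>\<J>\<rangle>) \<bullet>\<^sub>a \<langle>Q\<rangle>) =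
    ((f \<bullet>\<^sub>a \<langle>\<I>\<rangle>) \<odot>\<^sub>a \<langle>Q\<rangle>) \<cdot> cap (src f) Q"
proof -
  let ?q = "\<l>\<^sup>\<bullet> Q \<cdot> (\<langle>\<J>\<rangle> \<bullet>\<^sub>a \<l>\<^sup>\<odot> Q)"
  have a: "(\<alpha>\<^sup>\<bullet> (tgt f) \<I> (\<I>\<^sup>-))\<inverse> \<cdot> (\<langle>tgt f\<rangle> \<bullet>\<^sub>a \<^bold>j) \<cdot> (f \<bullet>\<^sub>a \<langle>\<I>\<rangle>) =
      ((f \<bullet>\<^sub>a \<langle>\<I>\<rangle>) \<bullet>\<^sub>a \<langle>\<I>\<^sup>-\<rangle>) \<cdot> (\<alpha>\<^sup>\<bullet> (src f) \<I> (\<I>\<^sup>-))\<inverse> \<cdot> (\<langle>src f\<rangle> \<bullet>\<^sub>a \<^bold>j)"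
  proof -
    have "(\<langle>tgt f\<rangle> \<bullet>\<^sub>a \<^bold>j) \<cdot> (f \<bullet>\<^sub>a \<langle>\<I>\<rangle>) = (f \<bullet>\<^sub>a \<langle>\<I> \<bullet> \<I>\<^sup>-\<rangle>) \<cdot> (\<langle>src f\<rangle> \<bullet>\<^sub>a \<^bold>j)"
      by (simp add: bull.merge)
    then show ?thesis
      using circ.comp_extend [OF bull.assoc_inv_natural [of f "\<langle>\<I>\<rangle>" "\<langle>\<I>\<^sup>-\<rangle>"]] by simp
  qed
  have "cap (tgt f) Q \<cdot> (((f \<bullet>\<^sub>a \<langle>\<I>\<rangle>) \<odot>\<^sub>a \<langle>\<J>\<rangle>) \<bullet>\<^sub>a \<langle>Q\<rangle>) =
      (\<langle>tgt f \<bullet> \<I>\<rangle> \<odot>\<^sub>a ?q) \<cdot> \<gamma> (tgt f \<bullet> \<I>) \<I> \<J> Q \<cdot>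
      ((((\<alpha>\<^sup>\<bullet> (tgt f) \<I> (\<I>\<^sup>-))\<inverse> \<cdot> (\<langle>tgt f\<rangle> \<bullet>\<^sub>a \<^bold>j) \<cdot> (f \<bullet>\<^sub>a \<langle>\<I>\<rangle>)) \<odot>\<^sub>a \<langle>\<J>\<rangle>) \<bullet>\<^sub>a \<langle>Q\<rangle>)"
    by (simp add: cap_def bull.merge [of _ "_ \<odot>\<^sub>a _"] circ.merge)
  also have "\<dots> = (\<langle>tgt f \<bullet> \<I>\<rangle> \<odot>\<^sub>a ?q) \<cdot> (\<gamma> (tgt f \<bullet> \<I>) \<I> \<J> Q \<cdot>
      ((((f \<bullet>\<^sub>a \<langle>\<I>\<rangle>) \<bullet>\<^sub>a \<langle>\<I>\<^sup>-\<rangle>) \<odot>\<^sub>a \<langle>\<J>\<rangle>) \<bullet>\<^sub>a \<langle>Q\<rangle>)) \<cdot>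
      ((((\<alpha>\<^sup>\<bullet> (src f) \<I> (\<I>\<^sup>-))\<inverse> \<cdot> (\<langle>src f\<rangle> \<bullet>\<^sub>a \<^bold>j)) \<odot>\<^sub>a \<langle>\<J>\<rangle>) \<bullet>\<^sub>a \<langle>Q\<rangle>)"
    unfolding a by (simp add: bull.merge circ.merge)
  also have "\<dots> = ((f \<bullet>\<^sub>a \<langle>\<I>\<rangle>) \<odot>\<^sub>a \<langle>Q\<rangle>) \<cdot> cap (src f) Q"
    using gamma_natural [of "f \<bullet>\<^sub>a \<langle>\<I>\<rangle>" "\<langle>\<I>\<rangle>" "\<langle>\<J>\<rangle>" "\<langle>Q\<rangle>"]
    by (simp add: cap_def circ.merge_ext)
  finally show ?thesis .
qed

lemma I_coassoc: "(\<langle>\<I>\<rangle> \<bullet>\<^sub>a \<Delta>\<^sub>I) \<cdot> \<Delta>\<^sub>I = \<alpha>\<^sup>\<bullet> \<I> \<I> \<I> \<cdot> (\<Delta>\<^sub>I \<bullet>\<^sub>a \<langle>\<I>\<rangle>) \<cdot> \<Delta>\<^sub>I"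
  using I_comonoid by (simp add: comonoid_in_def)

text \<open>The computation behind the value of w when Id \<star> S is the convolution unit.
  Coassociativity moves \<open>\<Delta>\<^sub>I\<close> in front of the coevaluation, naturality
  carries it through \<gamma>, and \<open>gamma_unit\<close> at \<J> and Q does the rest.\<close>

lemma cap_comult: "cap \<I> Q \<cdot> ((\<Delta>\<^sub>I \<odot>\<^sub>a \<langle>\<J>\<rangle>) \<bullet>\<^sub>a \<langle>Q\<rangle>) = (\<Delta>\<^sub>I \<odot>\<^sub>a \<langle>Q\<rangle>) \<cdot> (\<l>\<^sup>\<odot> Q)\<inverse> \<cdot> \<l>\<^sup>\<bullet> Q \<cdot> (\<l>\<^sup>\<odot> \<J> \<bullet>\<^sub>a \<langle>Q\<rangle>)"
proof -
  let ?q = "\<l>\<^sup>\<bullet> Q \<cdot> (\<langle>\<J>\<rangle> \<bullet>\<^sub>a \<l>\<^sup>\<odot> Q)"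
  have j: "(\<alpha>\<^sup>\<bullet> \<I> \<I> (\<I>\<^sup>-))\<inverse> \<cdot> (\<langle>\<I>\<rangle> \<bullet>\<^sub>a \<^bold>j) \<cdot> \<Delta>\<^sub>I = (\<Delta>\<^sub>I \<bullet>\<^sub>a \<langle>\<I>\<^sup>-\<rangle>) \<cdot> \<^bold>j"
  proof -
    have "(\<alpha>\<^sup>\<bullet> \<I> \<I> (\<I>\<^sup>-))\<inverse> \<cdot> (\<langle>\<I>\<rangle> \<bullet>\<^sub>a \<^bold>j) \<cdot> \<Delta>\<^sub>I =
        ((\<alpha>\<^sup>\<bullet> \<I> \<I> (\<I>\<^sup>-))\<inverse> \<cdot> (\<langle>\<I>\<rangle> \<bullet>\<^sub>a (\<langle>\<I>\<rangle> \<bullet>\<^sub>a \<phi>\<^sup>\<odot>\<^sub>0))) \<cdot> ((\<langle>\<I>\<rangle> \<bullet>\<^sub>a \<Delta>\<^sub>I) \<cdot> \<Delta>\<^sub>I)"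
      by (simp add: bull.merge_ext)
    also have "\<dots> = (\<Delta>\<^sub>I \<bullet>\<^sub>a \<langle>\<I>\<^sup>-\<rangle>) \<cdot> \<^bold>j"
      unfolding I_coassoc using bull.assoc_inv_natural [of "\<langle>\<I>\<rangle>" "\<langle>\<I>\<rangle>" "\<phi>\<^sup>\<odot>\<^sub>0"]
      by (simp add: bull.merge_ext)
    finally show ?thesis .
  qed
  have "cap \<I> Q \<cdot> ((\<Delta>\<^sub>I \<odot>\<^sub>a \<langle>\<J>\<rangle>) \<bullet>\<^sub>a \<langle>Q\<rangle>) = (\<langle>\<I> \<bullet> \<I>\<rangle> \<odot>\<^sub>a ?q) \<cdot> \<gamma> (\<I> \<bullet> \<I>) \<I> \<J> Q \<cdot>
      ((((\<alpha>\<^sup>\<bullet> \<I> \<I> (\<I>\<^sup>-))\<inverse> \<cdot> (\<langle>\<I>\<rangle> \<bullet>\<^sub>a \<^bold>j) \<cdot> \<Delta>\<^sub>I) \<odot>\<^sub>a \<langle>\<J>\<rangle>) \<bullet>\<^sub>a \<langle>Q\<rangle>)"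
    by (simp add: cap_def bull.merge circ.merge)
  also have "\<dots> = (\<langle>\<I> \<bullet> \<I>\<rangle> \<odot>\<^sub>a ?q) \<cdot> (\<gamma> (\<I> \<bullet> \<I>) \<I> \<J> Q \<cdot>
      (((\<Delta>\<^sub>I \<bullet>\<^sub>a \<langle>\<I>\<^sup>-\<rangle>) \<odot>\<^sub>a \<langle>\<J>\<rangle>) \<bullet>\<^sub>a \<langle>Q\<rangle>)) \<cdot> ((\<^bold>j \<odot>\<^sub>a \<langle>\<J>\<rangle>) \<bullet>\<^sub>a \<langle>Q\<rangle>)"
    unfolding j by (simp add: bull.merge circ.merge)
  also have "\<dots> = (\<langle>\<I> \<bullet> \<I>\<rangle> \<odot>\<^sub>a ?q) \<cdot> ((\<Delta>\<^sub>I \<odot>\<^sub>a \<langle>\<J> \<bullet> (\<I> \<odot> Q)\<rangle>) \<cdot> \<gamma> \<I> \<I> \<J> Q) \<cdot>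
      ((\<^bold>j \<odot>\<^sub>a \<langle>\<J>\<rangle>) \<bullet>\<^sub>a \<langle>Q\<rangle>)"
    using gamma_natural [of "\<Delta>\<^sub>I" "\<langle>\<I>\<rangle>" "\<langle>\<J>\<rangle>" "\<langle>Q\<rangle>"] by simp
  also have "\<dots> = (\<Delta>\<^sub>I \<odot>\<^sub>a \<langle>Q\<rangle>) \<cdot> (\<langle>\<I>\<rangle> \<odot>\<^sub>a \<l>\<^sup>\<bullet> Q) \<cdot> ((\<langle>\<I>\<rangle> \<odot>\<^sub>a (\<langle>\<J>\<rangle> \<bullet>\<^sub>a \<l>\<^sup>\<odot> Q)) \<cdot> \<gamma> \<I> \<I> \<J> Q \<cdot>
      ((\<^bold>j \<odot>\<^sub>a \<langle>\<J>\<rangle>) \<bullet>\<^sub>a \<langle>Q\<rangle>))"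
    by (simp add: circ.merge_ext)
  also have "\<dots> = (\<Delta>\<^sub>I \<odot>\<^sub>a \<langle>Q\<rangle>) \<cdot> ((\<langle>\<I>\<rangle> \<odot>\<^sub>a \<l>\<^sup>\<bullet> Q) \<cdot> (\<l>\<^sup>\<odot> (\<J> \<bullet> Q))\<inverse>) \<cdot> (\<l>\<^sup>\<odot> \<J> \<bullet>\<^sub>a \<langle>Q\<rangle>)"
    by (simp flip: gamma_unit)
  also have "\<dots> = (\<Delta>\<^sub>I \<odot>\<^sub>a \<langle>Q\<rangle>) \<cdot> (\<l>\<^sup>\<odot> Q)\<inverse> \<cdot> \<l>\<^sup>\<bullet> Q \<cdot> (\<l>\<^sup>\<odot> \<J> \<bullet>\<^sub>a \<langle>Q\<rangle>)"
    using circ.comp_extend [OF circ.left_inv_natural [of "\<l>\<^sup>\<bullet> Q"]] by simp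
  finally show ?thesis .
qed

text \<open>(R5) with Y = Z = \<I>, U = \<J> and V = Q compares \<delta> with last argument \<J>
  followed by \<gamma>, which is \<open>varphi\<close> followed by \<open>cap\<close>, with \<delta>
  whose last argument contains Q. The \<gamma> on the other side of (R5) has \<I> in its first two
  places, hence reduces to a unit constraint by \<open>gamma_unit\<close>.\<close>

lemma delta_I_assoc: "delta_I X T Q \<cdot> \<alpha>\<^sup>\<bullet> X (T\<^sup>-) Q = cap (X \<odot> T) Q \<cdot> (\<phi> X T \<bullet>\<^sub>a \<langle>Q\<rangle>)"
proof -
  let ?M = "T\<^sup>- \<bullet> \<J>" and ?A = "X \<odot> T"
  let ?q = "\<l>\<^sup>\<bullet> Q \<cdot> (\<langle>\<J>\<rangle> \<bullet>\<^sub>a \<l>\<^sup>\<odot> Q)"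
  let ?t = "(\<langle>X\<rangle> \<bullet>\<^sub>a (\<^bold>j \<odot>\<^sub>a \<langle>?M\<rangle>)) \<bullet>\<^sub>a \<langle>Q\<rangle>"
  let ?s = "(\<langle>?A \<bullet> \<I>\<rangle> \<odot>\<^sub>a ?q)"
  have "cap ?A Q \<cdot> (\<delta> X \<I> T \<J> \<bullet>\<^sub>a \<langle>Q\<rangle>) = ?s \<cdot> \<gamma> (?A \<bullet> \<I>) \<I> \<J> Q \<cdot>
      (((\<alpha>\<^sup>\<bullet> ?A \<I> (\<I>\<^sup>-))\<inverse> \<odot>\<^sub>a \<langle>\<J>\<rangle>) \<bullet>\<^sub>a \<langle>Q\<rangle>) \<cdot> ((((\<langle>?A\<rangle> \<bullet>\<^sub>a \<^bold>j) \<odot>\<^sub>a \<langle>\<J>\<rangle>) \<cdot> \<delta> X \<I> T \<J>) \<bullet>\<^sub>a \<langle>Q\<rangle>)"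
    by (simp add: cap_def bull.merge bull.merge_ext circ.merge circ.merge_ext)
  also have "\<dots> = ?s \<cdot> \<gamma> (?A \<bullet> \<I>) \<I> \<J> Q \<cdot>
      (((\<alpha>\<^sup>\<bullet> ?A \<I> (\<I>\<^sup>-))\<inverse> \<odot>\<^sub>a \<langle>\<J>\<rangle>) \<bullet>\<^sub>a \<langle>Q\<rangle>) \<cdot>
      ((\<delta> X (\<I> \<bullet> \<I>\<^sup>-) T \<J> \<cdot> (\<langle>X\<rangle> \<bullet>\<^sub>a (\<^bold>j \<odot>\<^sub>a \<langle>?M\<rangle>))) \<bullet>\<^sub>a \<langle>Q\<rangle>)"
    using delta_natural [of "\<langle>X\<rangle>" "\<^bold>j" "\<langle>T\<rangle>" "\<langle>\<J>\<rangle>"] by simp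
  also have "\<dots> = ?s \<cdot> (\<gamma> (?A \<bullet> \<I>) \<I> \<J> Q \<cdot>
      (((\<alpha>\<^sup>\<bullet> ?A \<I> (\<I>\<^sup>-))\<inverse> \<odot>\<^sub>a \<langle>\<J>\<rangle>) \<bullet>\<^sub>a \<langle>Q\<rangle>) \<cdot> (\<delta> X (\<I> \<bullet> \<I>\<^sup>-) T \<J> \<bullet>\<^sub>a \<langle>Q\<rangle>)) \<cdot> ?t"
    by (simp add: bull.merge)
  also have "\<dots> = (?s \<cdot> \<delta> X \<I> T (\<J> \<bullet> (\<I> \<odot> Q))) \<cdot>
      (\<langle>X\<rangle> \<bullet>\<^sub>a (\<langle>\<I>\<rangle> \<odot>\<^sub>a \<alpha>\<^sup>\<bullet> (T\<^sup>-) \<J> (\<I> \<odot> Q))) \<cdot>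
      (\<langle>X\<rangle> \<bullet>\<^sub>a \<gamma> \<I> \<I> ?M Q) \<cdot> (\<alpha>\<^sup>\<bullet> X ((\<I> \<bullet> \<I>\<^sup>-) \<odot> ?M) Q \<cdot> ?t)"
    by (subst R5 [symmetric]) simp
  also have "\<dots> = (\<delta> X \<I> T Q \<cdot> (\<langle>X\<rangle> \<bullet>\<^sub>a (\<langle>\<I>\<rangle> \<odot>\<^sub>a (\<langle>T\<^sup>-\<rangle> \<bullet>\<^sub>a ?q)))) \<cdot>
      (\<langle>X\<rangle> \<bullet>\<^sub>a (\<langle>\<I>\<rangle> \<odot>\<^sub>a \<alpha>\<^sup>\<bullet> (T\<^sup>-) \<J> (\<I> \<odot> Q))) \<cdot>
      (\<langle>X\<rangle> \<bullet>\<^sub>a \<gamma> \<I> \<I> ?M Q) \<cdot> (\<langle>X\<rangle> \<bullet>\<^sub>a ((\<^bold>j \<odot>\<^sub>a \<langle>?M\<rangle>) \<bullet>\<^sub>a \<langle>Q\<rangle>)) \<cdot> \<alpha>\<^sup>\<bullet> X (\<I> \<odot> ?M) Q"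
    using delta_natural [of "\<langle>X\<rangle>" "\<langle>\<I>\<rangle>" "\<langle>T\<rangle>" ?q] bull.assoc_natural [of "\<langle>X\<rangle>" "\<^bold>j \<odot>\<^sub>a \<langle>?M\<rangle>" "\<langle>Q\<rangle>"]
    by simp
  also have "\<dots> = \<delta> X \<I> T Q \<cdot> (\<langle>X\<rangle> \<bullet>\<^sub>a ((\<langle>\<I>\<rangle> \<odot>\<^sub>a ((\<langle>T\<^sup>-\<rangle> \<bullet>\<^sub>a \<l>\<^sup>\<bullet> Q) \<cdot> (\<langle>T\<^sup>-\<rangle> \<bullet>\<^sub>a (\<langle>\<J>\<rangle> \<bullet>\<^sub>a \<l>\<^sup>\<odot> Q)) \<cdot>
      \<alpha>\<^sup>\<bullet> (T\<^sup>-) \<J> (\<I> \<odot> Q))) \<cdot>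
      \<gamma> \<I> \<I> ?M Q \<cdot> ((\<^bold>j \<odot>\<^sub>a \<langle>?M\<rangle>) \<bullet>\<^sub>a \<langle>Q\<rangle>))) \<cdot> \<alpha>\<^sup>\<bullet> X (\<I> \<odot> ?M) Q"
    by (simp add: bull.merge bull.merge_ext circ.merge circ.merge_ext)
  also have "(\<langle>T\<^sup>-\<rangle> \<bullet>\<^sub>a \<l>\<^sup>\<bullet> Q) \<cdot> (\<langle>T\<^sup>-\<rangle> \<bullet>\<^sub>a (\<langle>\<J>\<rangle> \<bullet>\<^sub>a \<l>\<^sup>\<odot> Q)) \<cdot> \<alpha>\<^sup>\<bullet> (T\<^sup>-) \<J> (\<I> \<odot> Q) =
      (\<r>\<^sup>\<bullet> (T\<^sup>-) \<bullet>\<^sub>a \<langle>Q\<rangle>) \<cdot> (\<langle>?M\<rangle> \<bullet>\<^sub>a \<l>\<^sup>\<odot> Q)"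
    using circ.comp_extend [OF bull.triangle [of "T\<^sup>-" Q]]
    by (simp flip: bull.assoc_natural [of "\<langle>T\<^sup>-\<rangle>" "\<langle>\<J>\<rangle>" "\<l>\<^sup>\<odot> Q", simplified])
  \<comment> \<open>Singles out the part that \<open>gamma_unit\<close> evaluates, with U =
    \<open>?M\<close> and V = Q.\<close>
  also have "(\<langle>\<I>\<rangle> \<odot>\<^sub>a ((\<r>\<^sup>\<bullet> (T\<^sup>-) \<bullet>\<^sub>a \<langle>Q\<rangle>) \<cdot> (\<langle>?M\<rangle> \<bullet>\<^sub>a \<l>\<^sup>\<odot> Q))) \<cdot>
      \<gamma> \<I> \<I> ?M Q \<cdot> ((\<^bold>j \<odot>\<^sub>a \<langle>?M\<rangle>) \<bullet>\<^sub>a \<langle>Q\<rangle>) =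
      (\<langle>\<I>\<rangle> \<odot>\<^sub>a (\<r>\<^sup>\<bullet> (T\<^sup>-) \<bullet>\<^sub>a \<langle>Q\<rangle>)) \<cdot> ((\<langle>\<I>\<rangle> \<odot>\<^sub>a (\<langle>?M\<rangle> \<bullet>\<^sub>a \<l>\<^sup>\<odot> Q)) \<cdot>
      \<gamma> \<I> \<I> ?M Q \<cdot> ((\<^bold>j \<odot>\<^sub>a \<langle>?M\<rangle>) \<bullet>\<^sub>a \<langle>Q\<rangle>))"
    by (simp add: circ.merge_ext)
  also have "\<dots> = ((\<langle>\<I>\<rangle> \<odot>\<^sub>a (\<r>\<^sup>\<bullet> (T\<^sup>-) \<bullet>\<^sub>a \<langle>Q\<rangle>)) \<cdot> (\<l>\<^sup>\<odot> (?M \<bullet> Q))\<inverse>) \<cdot> (\<l>\<^sup>\<odot> ?M \<bullet>\<^sub>a \<langle>Q\<rangle>)"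
    by (simp flip: gamma_unit)
  also have "\<dots> = (\<l>\<^sup>\<odot> (T\<^sup>- \<bullet> Q))\<inverse> \<cdot> ((\<r>\<^sup>\<bullet> (T\<^sup>-) \<cdot> \<l>\<^sup>\<odot> ?M) \<bullet>\<^sub>a \<langle>Q\<rangle>)"
  proof -
    have "(\<r>\<^sup>\<bullet> (T\<^sup>-) \<cdot> \<l>\<^sup>\<odot> ?M) \<bullet>\<^sub>a \<langle>Q\<rangle> = (\<r>\<^sup>\<bullet> (T\<^sup>-) \<bullet>\<^sub>a \<langle>Q\<rangle>) \<cdot> (\<l>\<^sup>\<odot> ?M \<bullet>\<^sub>a \<langle>Q\<rangle>)"
      by (simp add: bull.merge)
    then show ?thesis
      using circ.comp_extend [OF circ.left_inv_natural [of "\<r>\<^sup>\<bullet> (T\<^sup>-) \<bullet>\<^sub>a \<langle>Q\<rangle>"]] by simp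
  qed
  also have "\<delta> X \<I> T Q \<cdot> (\<langle>X\<rangle> \<bullet>\<^sub>a \<dots>) \<cdot> \<alpha>\<^sup>\<bullet> X (\<I> \<odot> ?M) Q =
      delta_I X T Q \<cdot> ((\<langle>X\<rangle> \<bullet>\<^sub>a ((\<r>\<^sup>\<bullet> (T\<^sup>-) \<cdot> \<l>\<^sup>\<odot> ?M) \<bullet>\<^sub>a \<langle>Q\<rangle>)) \<cdot> \<alpha>\<^sup>\<bullet> X (\<I> \<odot> ?M) Q)"
    by (simp add: delta_I_def bull.merge_ext)
  also have "\<dots> = delta_I X T Q \<cdot> \<alpha>\<^sup>\<bullet> X (T\<^sup>-) Q \<cdot> ((\<langle>X\<rangle> \<bullet>\<^sub>a (\<r>\<^sup>\<bullet> (T\<^sup>-) \<cdot> \<l>\<^sup>\<odot> ?M)) \<bullet>\<^sub>a \<langle>Q\<rangle>)"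
    using bull.assoc_natural [of "\<langle>X\<rangle>" "\<r>\<^sup>\<bullet> (T\<^sup>-) \<cdot> \<l>\<^sup>\<odot> ?M" "\<langle>Q\<rangle>"] by simp
  finally have eq: "cap ?A Q \<cdot> (\<delta> X \<I> T \<J> \<bullet>\<^sub>a \<langle>Q\<rangle>) = \<dots>" .
  have "cap ?A Q \<cdot> (\<phi> X T \<bullet>\<^sub>a \<langle>Q\<rangle>) =
      (cap ?A Q \<cdot> (\<delta> X \<I> T \<J> \<bullet>\<^sub>a \<langle>Q\<rangle>)) \<cdot> ((\<langle>X\<rangle> \<bullet>\<^sub>a ((\<l>\<^sup>\<odot> ?M)\<inverse> \<cdot> (\<r>\<^sup>\<bullet> (T\<^sup>-))\<inverse>)) \<bullet>\<^sub>a \<langle>Q\<rangle>)"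
    by (simp add: bull.merge delta_I_def flip: delta_I_bull_unit)
  also have "\<dots> = delta_I X T Q \<cdot> \<alpha>\<^sup>\<bullet> X (T\<^sup>-) Q"
    by (simp add: eq bull.merge)
  finally show ?thesis by simp
qed

end

section \<open>Left inverses of Galois maps\<close>

locale galois_bimonoid = galois_reversion C + bimonoid_in C H m u d e
  for C :: "('o, 'm, 'x) reversion_scheme" (structure) and H m u d e +
  fixes S :: 'm
  assumes S_hom: "S \<in> H \<rightarrow> H\<^sup>-"
begin

lemma src_S [simp]: "src S = H" and tgt_S [simp]: "tgt S = H\<^sup>-"
  and src_m [simp]: "src m = H \<odot> H" and tgt_m [simp]: "tgt m = H"
  and src_u [simp]: "src u = \<I>" and tgt_u [simp]: "tgt u = H"
  and src_d [simp]: "src d = H" and tgt_d [simp]: "tgt d = H \<bullet> H"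
  and src_e [simp]: "src e = H" and tgt_e [simp]: "tgt e = \<J>"
  using S_hom mult_hom unit_hom comult_hom counit_hom by (simp_all add: circ.hom_iff)

lemma self_right_module: "right_module_in C (circ C) H m u H m"
  by unfold_locales (auto simp: mult_hom unit_hom mult_assoc mult_unit_left mult_unit_right)

lemma self_left_comodule: "left_comodule_in C (bull C) H d e H d"
  by unfold_locales (auto simp: comult_hom counit_hom comult_coassoc comult_counit_left comult_counit_right)

text \<open>The arrow called \<open>w\<close> in the introduction.\<close>

definition conv_action :: "'o \<Rightarrow> 'm \<Rightarrow> 'm"
  where "conv_action Q \<rho> =
    ((m \<bullet>\<^sub>a \<langle>\<I>\<rangle>) \<odot>\<^sub>a \<langle>Q\<rangle>) \<cdot> delta_I H H Q \<cdot> (\<langle>H\<rangle> \<bullet>\<^sub>a ((S \<bullet>\<^sub>a \<langle>Q\<rangle>) \<cdot> \<rho>)) \<cdot> \<rho>"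

text \<open>The arrow \<I> \<rightarrow> H \<bullet> \<I> through which 1 on the left factors;
  tensored with Q it is the value that w must take for \<kappa> to have the prescribed left
  inverse.\<close>

abbreviation "unit_I \<equiv> (u \<bullet>\<^sub>a \<langle>\<I>\<rangle>) \<cdot> \<Delta>\<^sub>I"

end

text \<open>Fixes one module and one comodule so that the types of \<mu> and \<rho> can be simp
  rules in the calculations with Galois maps.\<close>

locale galois_pair = galois_bimonoid +
  P: right_module_in C "circ C" H m u P \<mu> + Q: left_comodule_in C "bull C" H d e Q \<rho>
  for P \<mu> Q \<rho>
begin

lemma src_\<mu> [simp]: "src \<mu> = P \<odot> H" and tgt_\<mu> [simp]: "tgt \<mu> = P"
  and src_\<rho> [simp]: "src \<rho> = Q" and tgt_\<rho> [simp]: "tgt \<rho> = H \<bullet> Q"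
  using P.right_act_hom Q.left_coact_hom by (simp_all add: circ.hom_iff)

lemma src_conv_action [simp]: "src (conv_action Q \<rho>) = Q"
  and tgt_conv_action [simp]: "tgt (conv_action Q \<rho>) = (H \<bullet> \<I>) \<odot> Q"
  by (simp_all add: conv_action_def)

lemma galois_bar_galois:
  "galois_bar C H S P \<mu> X Q \<rho> \<cdot> galois C H P \<mu> X Q \<rho> =
    (((\<mu> \<bullet>\<^sub>a \<r>\<^sup>\<odot> X) \<cdot> \<zeta> P X H \<I>) \<odot>\<^sub>a \<langle>Q\<rangle>) \<cdot> (\<alpha>\<^sup>\<odot> (P \<bullet> X) (H \<bullet> \<I>) Q)\<inverse> \<cdot>
      (\<langle>P \<bullet> X\<rangle> \<odot>\<^sub>a conv_action Q \<rho>)"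
proof -
  let ?n = "(S \<bullet>\<^sub>a \<langle>Q\<rangle>) \<cdot> \<rho>" and ?N = "H\<^sup>- \<bullet> Q"
  have "galois_bar C H S P \<mu> X Q \<rho> \<cdot> galois C H P \<mu> X Q \<rho> =
      ((\<mu> \<bullet>\<^sub>a \<langle>X\<rangle>) \<odot>\<^sub>a \<langle>Q\<rangle>) \<cdot> (\<delta> P X H Q \<cdot> (\<mu> \<bullet>\<^sub>a \<langle>X \<odot> ?N\<rangle>)) \<cdot>
      (\<langle>P \<odot> H\<rangle> \<bullet>\<^sub>a (\<langle>X\<rangle> \<odot>\<^sub>a ?n)) \<cdot> \<zeta> P X H Q \<cdot> (\<langle>P \<bullet> X\<rangle> \<odot>\<^sub>a \<rho>)"
    by (simp add: galois_def galois_bar_def bull.merge_ext circ.merge)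
  also have "\<dots> = ((\<mu> \<bullet>\<^sub>a \<langle>X\<rangle>) \<odot>\<^sub>a \<langle>Q\<rangle>) \<cdot> ((((\<mu> \<odot>\<^sub>a \<langle>H\<rangle>) \<bullet>\<^sub>a \<langle>X\<rangle>) \<odot>\<^sub>a \<langle>Q\<rangle>) \<cdot> \<delta> (P \<odot> H) X H Q) \<cdot>
      ((\<langle>P \<odot> H\<rangle> \<bullet>\<^sub>a (\<langle>X\<rangle> \<odot>\<^sub>a ?n)) \<cdot> \<zeta> P X H Q) \<cdot> (\<langle>P \<bullet> X\<rangle> \<odot>\<^sub>a \<rho>)"
    using delta_natural [of \<mu> "\<langle>X\<rangle>" "\<langle>H\<rangle>" "\<langle>Q\<rangle>"] by simp
  also have "\<dots> = ((\<mu> \<bullet>\<^sub>a \<langle>X\<rangle>) \<odot>\<^sub>a \<langle>Q\<rangle>) \<cdot> ((((\<mu> \<odot>\<^sub>a \<langle>H\<rangle>) \<bullet>\<^sub>a \<langle>X\<rangle>) \<odot>\<^sub>a \<langle>Q\<rangle>) \<cdot> \<delta> (P \<odot> H) X H Q) \<cdot>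
      (\<zeta> P X H ?N \<cdot> (\<langle>P \<bullet> X\<rangle> \<odot>\<^sub>a (\<langle>H\<rangle> \<bullet>\<^sub>a ?n))) \<cdot> (\<langle>P \<bullet> X\<rangle> \<odot>\<^sub>a \<rho>)"
    using zeta_natural [of "\<langle>P\<rangle>" "\<langle>X\<rangle>" "\<langle>H\<rangle>" ?n] by simp
  also have "\<dots> = (((\<mu> \<cdot> (\<mu> \<odot>\<^sub>a \<langle>H\<rangle>)) \<bullet>\<^sub>a \<langle>X\<rangle>) \<odot>\<^sub>a \<langle>Q\<rangle>) \<cdot> \<delta> (P \<odot> H) X H Q \<cdot>
      \<zeta> P X H ?N \<cdot> (\<langle>P \<bullet> X\<rangle> \<odot>\<^sub>a ((\<langle>H\<rangle> \<bullet>\<^sub>a ?n) \<cdot> \<rho>))"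
    by (simp add: circ.merge_ext bull.merge circ.merge)
  \<comment> \<open>Associativity of the action frees P from the second copy of H: the two copies
    are now multiplied by m, which does not involve P and can be carried into w.\<close>
  also have "\<mu> \<cdot> (\<mu> \<odot>\<^sub>a \<langle>H\<rangle>) = \<mu> \<cdot> (\<langle>P\<rangle> \<odot>\<^sub>a m) \<cdot> \<alpha>\<^sup>\<odot> P H H"
    using P.right_act_mult by simp
  also have "((\<dots> \<bullet>\<^sub>a \<langle>X\<rangle>) \<odot>\<^sub>a \<langle>Q\<rangle>) \<cdot> \<delta> (P \<odot> H) X H Q \<cdot>
      \<zeta> P X H ?N \<cdot> (\<langle>P \<bullet> X\<rangle> \<odot>\<^sub>a ((\<langle>H\<rangle> \<bullet>\<^sub>a ?n) \<cdot> \<rho>)) =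
      (((\<mu> \<cdot> (\<langle>P\<rangle> \<odot>\<^sub>a m)) \<bullet>\<^sub>a \<langle>X\<rangle>) \<odot>\<^sub>a \<langle>Q\<rangle>) \<cdot> (((\<alpha>\<^sup>\<odot> P H H \<bullet>\<^sub>a \<langle>X\<rangle>) \<odot>\<^sub>a \<langle>Q\<rangle>) \<cdot> \<delta> (P \<odot> H) X H Q \<cdot>
      \<zeta> P X H ?N) \<cdot> (\<langle>P \<bullet> X\<rangle> \<odot>\<^sub>a ((\<langle>H\<rangle> \<bullet>\<^sub>a ?n) \<cdot> \<rho>))"
    by (simp add: circ.merge_ext bull.merge)
  also have "\<dots> = (((\<mu> \<bullet>\<^sub>a \<r>\<^sup>\<odot> X) \<cdot> (((\<langle>P\<rangle> \<odot>\<^sub>a m) \<bullet>\<^sub>a \<langle>X \<odot> \<I>\<rangle>) \<cdot> \<zeta> P X (H \<odot> H) \<I>)) \<odot>\<^sub>a \<langle>Q\<rangle>) \<cdot>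
      (\<alpha>\<^sup>\<odot> (P \<bullet> X) ((H \<odot> H) \<bullet> \<I>) Q)\<inverse> \<cdot> (\<langle>P \<bullet> X\<rangle> \<odot>\<^sub>a delta_I H H Q) \<cdot>
      (\<langle>P \<bullet> X\<rangle> \<odot>\<^sub>a ((\<langle>H\<rangle> \<bullet>\<^sub>a ?n) \<cdot> \<rho>))"
    unfolding delta_zeta by (simp add: circ.merge_ext bull.merge_ext)
  also have "\<dots> = (((\<mu> \<bullet>\<^sub>a \<r>\<^sup>\<odot> X) \<cdot> \<zeta> P X H \<I>) \<odot>\<^sub>a \<langle>Q\<rangle>) \<cdot> (((\<langle>P \<bullet> X\<rangle> \<odot>\<^sub>a (m \<bullet>\<^sub>a \<langle>\<I>\<rangle>)) \<odot>\<^sub>a \<langle>Q\<rangle>) \<cdot>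
      (\<alpha>\<^sup>\<odot> (P \<bullet> X) ((H \<odot> H) \<bullet> \<I>) Q)\<inverse>) \<cdot> (\<langle>P \<bullet> X\<rangle> \<odot>\<^sub>a delta_I H H Q) \<cdot>
      (\<langle>P \<bullet> X\<rangle> \<odot>\<^sub>a ((\<langle>H\<rangle> \<bullet>\<^sub>a ?n) \<cdot> \<rho>))"
    using zeta_natural [of "\<langle>P\<rangle>" "\<langle>X\<rangle>" m "\<langle>\<I>\<rangle>"] by (simp add: circ.merge_ext)
  also have "\<dots> = (((\<mu> \<bullet>\<^sub>a \<r>\<^sup>\<odot> X) \<cdot> \<zeta> P X H \<I>) \<odot>\<^sub>a \<langle>Q\<rangle>) \<cdot> (\<alpha>\<^sup>\<odot> (P \<bullet> X) (H \<bullet> \<I>) Q)\<inverse> \<cdot>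
      (\<langle>P \<bullet> X\<rangle> \<odot>\<^sub>a ((m \<bullet>\<^sub>a \<langle>\<I>\<rangle>) \<odot>\<^sub>a \<langle>Q\<rangle>)) \<cdot> (\<langle>P \<bullet> X\<rangle> \<odot>\<^sub>a delta_I H H Q) \<cdot>
      (\<langle>P \<bullet> X\<rangle> \<odot>\<^sub>a ((\<langle>H\<rangle> \<bullet>\<^sub>a ?n) \<cdot> \<rho>))"
    using circ.comp_extend [OF circ.assoc_inv_natural [of "\<langle>P \<bullet> X\<rangle>" "m \<bullet>\<^sub>a \<langle>\<I>\<rangle>" "\<langle>Q\<rangle>"]] by simp
  finally show ?thesis by (simp add: conv_action_def circ.merge circ.merge_ext)
qed

text \<open>Coassociativity turns the double coaction into d followed by a single coaction. S then
  acts on a leg of d, and \<open>delta_I_assoc\<close> separates Q from the part that contains H and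
  S.\<close>

lemma conv_action_cap: "conv_action Q \<rho> = cap H Q \<cdot> (conv_id_left C H m d S \<bullet>\<^sub>a \<langle>Q\<rangle>) \<cdot> \<rho>"
proof -
  have "conv_action Q \<rho> = ((m \<bullet>\<^sub>a \<langle>\<I>\<rangle>) \<odot>\<^sub>a \<langle>Q\<rangle>) \<cdot> delta_I H H Q \<cdot>
      (\<langle>H\<rangle> \<bullet>\<^sub>a (S \<bullet>\<^sub>a \<langle>Q\<rangle>)) \<cdot> ((\<langle>H\<rangle> \<bullet>\<^sub>a \<rho>) \<cdot> \<rho>)"
    by (simp add: conv_action_def bull.merge_ext)
  also have "\<dots> = ((m \<bullet>\<^sub>a \<langle>\<I>\<rangle>) \<odot>\<^sub>a \<langle>Q\<rangle>) \<cdot> delta_I H H Q \<cdot>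
      ((\<langle>H\<rangle> \<bullet>\<^sub>a (S \<bullet>\<^sub>a \<langle>Q\<rangle>)) \<cdot> \<alpha>\<^sup>\<bullet> H H Q) \<cdot> (d \<bullet>\<^sub>a \<langle>Q\<rangle>) \<cdot> \<rho>"
    by (simp flip: Q.left_coact_comult)
  also have "\<dots> = ((m \<bullet>\<^sub>a \<langle>\<I>\<rangle>) \<odot>\<^sub>a \<langle>Q\<rangle>) \<cdot> (delta_I H H Q \<cdot> \<alpha>\<^sup>\<bullet> H (H\<^sup>-) Q) \<cdot>
      ((\<langle>H\<rangle> \<bullet>\<^sub>a S) \<bullet>\<^sub>a \<langle>Q\<rangle>) \<cdot> (d \<bullet>\<^sub>a \<langle>Q\<rangle>) \<cdot> \<rho>"
    using circ.comp_extend [OF bull.assoc_natural [of "\<langle>H\<rangle>" S "\<langle>Q\<rangle>"]] by simp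
  also have "\<dots> = (((m \<bullet>\<^sub>a \<langle>\<I>\<rangle>) \<odot>\<^sub>a \<langle>Q\<rangle>) \<cdot> cap (H \<odot> H) Q) \<cdot> (\<phi> H H \<bullet>\<^sub>a \<langle>Q\<rangle>) \<cdot>
      ((\<langle>H\<rangle> \<bullet>\<^sub>a S) \<bullet>\<^sub>a \<langle>Q\<rangle>) \<cdot> (d \<bullet>\<^sub>a \<langle>Q\<rangle>) \<cdot> \<rho>"
    unfolding delta_I_assoc by simp
  also have "\<dots> = cap H Q \<cdot> (conv_id_left C H m d S \<bullet>\<^sub>a \<langle>Q\<rangle>) \<cdot> \<rho>"
    unfolding cap_natural [of m Q, simplified, symmetric]
    by (simp add: conv_id_left_def bull.merge_ext)
  finally show ?thesis .
qed

text \<open>With this w only u acts on P. The unit law of the action and the right unit axiom of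
  \<zeta>, which absorbs \<open>\<Delta>\<^sub>I\<close>, leave nothing but unit
  constraints.\<close>

lemma galois_left_inverse:
  assumes "conv_action Q \<rho> = (unit_I \<odot>\<^sub>a \<langle>Q\<rangle>) \<cdot> (\<l>\<^sup>\<odot> Q)\<inverse>"
  shows "galois_bar C H S P \<mu> X Q \<rho> \<cdot> galois C H P \<mu> X Q \<rho> = \<langle>(P \<bullet> X) \<odot> Q\<rangle>"
proof -
  let ?A = "P \<bullet> X"
  have z: "\<zeta> P X H \<I> \<cdot> (\<langle>?A\<rangle> \<odot>\<^sub>a unit_I) = ((\<langle>P\<rangle> \<odot>\<^sub>a u) \<bullet>\<^sub>a \<langle>X \<odot> \<I>\<rangle>) \<cdot> \<zeta> P X \<I> \<I> \<cdot> (\<langle>?A\<rangle> \<odot>\<^sub>a \<Delta>\<^sub>I)"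
  proof -
    have "\<zeta> P X H \<I> \<cdot> (\<langle>?A\<rangle> \<odot>\<^sub>a unit_I) =
        (\<zeta> P X H \<I> \<cdot> (\<langle>?A\<rangle> \<odot>\<^sub>a (u \<bullet>\<^sub>a \<langle>\<I>\<rangle>))) \<cdot> (\<langle>?A\<rangle> \<odot>\<^sub>a \<Delta>\<^sub>I)"
      by (simp add: circ.merge)
    then show ?thesis
      using circ.comp_extend [OF zeta_natural [of "\<langle>P\<rangle>" "\<langle>X\<rangle>" u "\<langle>\<I>\<rangle>"]] by simp
  qed
  have "galois_bar C H S P \<mu> X Q \<rho> \<cdot> galois C H P \<mu> X Q \<rho> =
      (((\<mu> \<bullet>\<^sub>a \<r>\<^sup>\<odot> X) \<cdot> \<zeta> P X H \<I>) \<odot>\<^sub>a \<langle>Q\<rangle>) \<cdot> ((\<alpha>\<^sup>\<odot> ?A (H \<bullet> \<I>) Q)\<inverse> \<cdot>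
      (\<langle>?A\<rangle> \<odot>\<^sub>a (unit_I \<odot>\<^sub>a \<langle>Q\<rangle>))) \<cdot> (\<langle>?A\<rangle> \<odot>\<^sub>a (\<l>\<^sup>\<odot> Q)\<inverse>)"
    by (simp add: galois_bar_galois assms circ.merge)
  also have "\<dots> = (((\<mu> \<bullet>\<^sub>a \<r>\<^sup>\<odot> X) \<cdot> (\<zeta> P X H \<I> \<cdot> (\<langle>?A\<rangle> \<odot>\<^sub>a unit_I))) \<odot>\<^sub>a \<langle>Q\<rangle>) \<cdot>
      ((\<alpha>\<^sup>\<odot> ?A \<I> Q)\<inverse> \<cdot> (\<langle>?A\<rangle> \<odot>\<^sub>a (\<l>\<^sup>\<odot> Q)\<inverse>))"
    using circ.assoc_inv_natural [of "\<langle>?A\<rangle>" unit_I "\<langle>Q\<rangle>"] by (simp add: circ.merge_ext)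
  also have "\<dots> = ((((\<mu> \<cdot> (\<langle>P\<rangle> \<odot>\<^sub>a u)) \<bullet>\<^sub>a \<r>\<^sup>\<odot> X) \<cdot> \<zeta> P X \<I> \<I> \<cdot> (\<langle>?A\<rangle> \<odot>\<^sub>a \<Delta>\<^sub>I)) \<odot>\<^sub>a \<langle>Q\<rangle>) \<cdot> ((\<r>\<^sup>\<odot> ?A)\<inverse> \<odot>\<^sub>a \<langle>Q\<rangle>)"
    unfolding z circ.triangle_inv' by (simp add: bull.merge_ext)
  also have "\<dots> = \<langle>?A \<odot> Q\<rangle>"
    using zeta_circ_right [of P X] by (simp add: P.right_act_unit circ.merge)
  finally show ?thesis .
qed

text \<open>The e contained in the convolution unit meets the coaction of Q, so the counit law
  removes both; \<open>cap_comult\<close> computes what is left.\<close>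

lemma conv_action_unit:
  assumes "conv_id_left C H m d S = conv_unit_left C u e"
  shows "conv_action Q \<rho> = (unit_I \<odot>\<^sub>a \<langle>Q\<rangle>) \<cdot> (\<l>\<^sup>\<odot> Q)\<inverse>"
proof -
  have "conv_action Q \<rho> = (cap H Q \<cdot> (((u \<bullet>\<^sub>a \<langle>\<I>\<rangle>) \<odot>\<^sub>a \<langle>\<J>\<rangle>) \<bullet>\<^sub>a \<langle>Q\<rangle>)) \<cdot> ((\<Delta>\<^sub>I \<odot>\<^sub>a \<langle>\<J>\<rangle>) \<bullet>\<^sub>a \<langle>Q\<rangle>) \<cdot>
      ((\<l>\<^sup>\<odot> \<J>)\<inverse> \<bullet>\<^sub>a \<langle>Q\<rangle>) \<cdot> (e \<bullet>\<^sub>a \<langle>Q\<rangle>) \<cdot> \<rho>"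
    by (simp add: conv_action_cap assms conv_unit_left_def bull.merge_ext)
  also have "\<dots> = ((u \<bullet>\<^sub>a \<langle>\<I>\<rangle>) \<odot>\<^sub>a \<langle>Q\<rangle>) \<cdot> (cap \<I> Q \<cdot> ((\<Delta>\<^sub>I \<odot>\<^sub>a \<langle>\<J>\<rangle>) \<bullet>\<^sub>a \<langle>Q\<rangle>)) \<cdot>
      ((\<l>\<^sup>\<odot> \<J>)\<inverse> \<bullet>\<^sub>a \<langle>Q\<rangle>) \<cdot> (e \<bullet>\<^sub>a \<langle>Q\<rangle>) \<cdot> \<rho>"
    using circ.comp_extend [OF cap_natural [of u Q]] by simp
  also have "\<dots> = (unit_I \<odot>\<^sub>a \<langle>Q\<rangle>) \<cdot> (\<l>\<^sup>\<odot> Q)\<inverse> \<cdot> (\<l>\<^sup>\<bullet> Q \<cdot> (e \<bullet>\<^sub>a \<langle>Q\<rangle>) \<cdot> \<rho>)"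
    unfolding cap_comult by (simp add: circ.merge_ext bull.merge_ext)
  also have "\<l>\<^sup>\<bullet> Q \<cdot> (e \<bullet>\<^sub>a \<langle>Q\<rangle>) \<cdot> \<rho> = \<langle>Q\<rangle>"
    using Q.left_coact_counit by simp
  finally show ?thesis by simp
qed

end

context galois_bimonoid
begin

lemma galois_pairI:
  assumes "right_module_in C (circ C) H m u P \<mu>" "left_comodule_in C (bull C) H d e Q \<rho>"
  shows "galois_pair C H m u d e S P \<mu> Q \<rho>"
  using assms galois_bimonoid_axioms
  by (simp add: galois_pair_def left_comodule_in_def right_module_in_def)

lemmas self_pair = galois_pairI [OF self_right_module self_left_comodule]

lemma conv_action_self:
  assumes "galois_bar C H S H m \<I> H d \<cdot> galois C H H m \<I> H d = \<langle>(H \<bullet> \<I>) \<odot> H\<rangle>"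
  shows "conv_action H d = (unit_I \<odot>\<^sub>a \<langle>H\<rangle>) \<cdot> (\<l>\<^sup>\<odot> H)\<inverse>"
proof -
  let ?w = "conv_action H d" and ?A = "H \<bullet> \<I>"
  have [simp]: "src ?w = H" "tgt ?w = ?A \<odot> H"
    by (simp_all add: conv_action_def)
  let ?z = "(m \<bullet>\<^sub>a \<r>\<^sup>\<odot> \<I>) \<cdot> \<zeta> H \<I> H \<I>"
  \<comment> \<open>Here P = H has a unit of its own, so \<I> maps into the factor H \<bullet> \<I>.
    By the left unit laws of m and \<zeta> the part of the composite that surrounds w becomes a unit
    constraint.\<close>
  have z: "?z \<cdot> (unit_I \<odot>\<^sub>a \<langle>?A\<rangle>) = \<l>\<^sup>\<odot> ?A"
  proof -
    have "?z \<cdot> (unit_I \<odot>\<^sub>a \<langle>?A\<rangle>) =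
        (m \<bullet>\<^sub>a \<l>\<^sup>\<odot> \<I>) \<cdot> (\<zeta> H \<I> H \<I> \<cdot> ((u \<bullet>\<^sub>a \<langle>\<I>\<rangle>) \<odot>\<^sub>a \<langle>?A\<rangle>)) \<cdot> (\<Delta>\<^sub>I \<odot>\<^sub>a \<langle>?A\<rangle>)"
      by (simp add: circ.merge circ.left_unit_eq_right_unit)
    also have "\<dots> = ((m \<cdot> (u \<odot>\<^sub>a \<langle>H\<rangle>)) \<bullet>\<^sub>a \<l>\<^sup>\<odot> \<I>) \<cdot> \<zeta> \<I> \<I> H \<I> \<cdot> (\<Delta>\<^sub>I \<odot>\<^sub>a \<langle>?A\<rangle>)"
      using zeta_natural [of u "\<langle>\<I>\<rangle>" "\<langle>H\<rangle>" "\<langle>\<I>\<rangle>"] by (simp add: bull.merge_ext)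
    also have "\<dots> = \<l>\<^sup>\<odot> ?A"
      using zeta_circ_left [of H \<I>] by (simp add: mult_unit_left)
    finally show ?thesis .
  qed
  have eq: "(?z \<odot>\<^sub>a \<langle>H\<rangle>) \<cdot> (\<alpha>\<^sup>\<odot> ?A ?A H)\<inverse> \<cdot> (\<langle>?A\<rangle> \<odot>\<^sub>a ?w) = \<langle>?A \<odot> H\<rangle>"
    using galois_pair.galois_bar_galois [OF self_pair, of \<I>] assms by simp
  \<comment> \<open>The composite assumed to be the identity is inserted before
    \<open>unit_I\<close>; computing it with z returns w up to the left unit constraint.\<close>
  have "unit_I \<odot>\<^sub>a \<langle>H\<rangle> = ((?z \<odot>\<^sub>a \<langle>H\<rangle>) \<cdot> (\<alpha>\<^sup>\<odot> ?A ?A H)\<inverse> \<cdot> (\<langle>?A\<rangle> \<odot>\<^sub>a ?w)) \<cdot> (unit_I \<odot>\<^sub>a \<langle>H\<rangle>)"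
    by (subst eq) simp
  also have "\<dots> = (?z \<odot>\<^sub>a \<langle>H\<rangle>) \<cdot> ((\<alpha>\<^sup>\<odot> ?A ?A H)\<inverse> \<cdot> (unit_I \<odot>\<^sub>a \<langle>?A \<odot> H\<rangle>)) \<cdot> (\<langle>\<I>\<rangle> \<odot>\<^sub>a ?w)"
    by (simp add: circ.merge)
  also have "\<dots> = ((?z \<cdot> (unit_I \<odot>\<^sub>a \<langle>?A\<rangle>)) \<odot>\<^sub>a \<langle>H\<rangle>) \<cdot> (\<alpha>\<^sup>\<odot> \<I> ?A H)\<inverse> \<cdot> (\<langle>\<I>\<rangle> \<odot>\<^sub>a ?w)"
    using circ.assoc_inv_natural [of unit_I "\<langle>?A\<rangle>" "\<langle>H\<rangle>"] by (simp add: circ.merge_ext)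
  also have "\<dots> = \<l>\<^sup>\<odot> (?A \<odot> H) \<cdot> (\<langle>\<I>\<rangle> \<odot>\<^sub>a ?w)"
    unfolding z by (simp flip: circ.left_tens)
  also have "\<dots> = ?w \<cdot> \<l>\<^sup>\<odot> H"
    using circ.left_natural [of ?w] by simp
  finally show ?thesis by simp
qed

text \<open>Since Q = H has a counit, e can be applied to the last factor. By naturality it turns
  the argument H of \<open>delta_I\<close> into \<J>, which gives \<open>varphi\<close>, and by the
  counit law it cancels the inner comultiplication.\<close>

lemma conv_action_self_counit: "(\<langle>H \<bullet> \<I>\<rangle> \<odot>\<^sub>a e) \<cdot> conv_action H d = conv_id_left C H m d S"
proof -
  have "(\<langle>H \<bullet> \<I>\<rangle> \<odot>\<^sub>a e) \<cdot> conv_action H d =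
      ((m \<bullet>\<^sub>a \<langle>\<I>\<rangle>) \<odot>\<^sub>a \<langle>\<J>\<rangle>) \<cdot> (((\<langle>(H \<odot> H) \<bullet> \<I>\<rangle> \<odot>\<^sub>a e) \<cdot> delta_I H H H)) \<cdot> (\<langle>H\<rangle> \<bullet>\<^sub>a ((S \<bullet>\<^sub>a \<langle>H\<rangle>) \<cdot> d)) \<cdot> d"
    by (simp add: conv_action_def circ.merge_ext)
  also have "\<dots> = ((m \<bullet>\<^sub>a \<langle>\<I>\<rangle>) \<odot>\<^sub>a \<langle>\<J>\<rangle>) \<cdot> (delta_I H H \<J> \<cdot> (\<langle>H\<rangle> \<bullet>\<^sub>a (\<langle>H\<^sup>-\<rangle> \<bullet>\<^sub>a e))) \<cdot>
      (\<langle>H\<rangle> \<bullet>\<^sub>a ((S \<bullet>\<^sub>a \<langle>H\<rangle>) \<cdot> d)) \<cdot> d"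
    using delta_I_natural [of "\<langle>H\<rangle>" "\<langle>H\<rangle>" e] by simp
  also have "\<dots> = ((m \<bullet>\<^sub>a \<langle>\<I>\<rangle>) \<odot>\<^sub>a \<langle>\<J>\<rangle>) \<cdot> delta_I H H \<J> \<cdot>
      (\<langle>H\<rangle> \<bullet>\<^sub>a ((S \<bullet>\<^sub>a \<langle>\<J>\<rangle>) \<cdot> ((\<langle>H\<rangle> \<bullet>\<^sub>a e) \<cdot> d))) \<cdot> d"
    by (simp add: bull.merge_ext)
  also have "(\<langle>H\<rangle> \<bullet>\<^sub>a e) \<cdot> d = (\<r>\<^sup>\<bullet> H)\<inverse>"
    by (rule circ.iso_left_cancel [of "\<r>\<^sup>\<bullet> H"]) (use comult_counit_right in simp_all)
  also have "(S \<bullet>\<^sub>a \<langle>\<J>\<rangle>) \<cdot> (\<r>\<^sup>\<bullet> H)\<inverse> = (\<r>\<^sup>\<bullet> (H\<^sup>-))\<inverse> \<cdot> S"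
    using bull.right_inv_natural [of S] by simp
  also have "((m \<bullet>\<^sub>a \<langle>\<I>\<rangle>) \<odot>\<^sub>a \<langle>\<J>\<rangle>) \<cdot> delta_I H H \<J> \<cdot> (\<langle>H\<rangle> \<bullet>\<^sub>a ((\<r>\<^sup>\<bullet> (H\<^sup>-))\<inverse> \<cdot> S)) \<cdot> d =
      conv_id_left C H m d S"
    by (simp add: conv_id_left_def bull.merge_ext circ.merge_ext flip: delta_I_bull_unit)
  finally show ?thesis .
qed

lemma galois_self_iff:
  "galois_bar C H S H m \<I> H d \<cdot> galois C H H m \<I> H d = \<langle>(H \<bullet> \<I>) \<odot> H\<rangle> \<longleftrightarrow>
    conv_id_left C H m d S = conv_unit_left C u e" (is "?l \<longleftrightarrow> ?r")
proof
  assume ?r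
  then show ?l
    using galois_pair.galois_left_inverse [OF self_pair galois_pair.conv_action_unit [OF self_pair]] by simp
next
  assume ?l
  then have "conv_id_left C H m d S = (\<langle>H \<bullet> \<I>\<rangle> \<odot>\<^sub>a e) \<cdot> (unit_I \<odot>\<^sub>a \<langle>H\<rangle>) \<cdot> (\<l>\<^sup>\<odot> H)\<inverse>"
    by (simp add: conv_action_self flip: conv_action_self_counit)
  also have "\<dots> = (unit_I \<odot>\<^sub>a \<langle>\<J>\<rangle>) \<cdot> ((\<langle>\<I>\<rangle> \<odot>\<^sub>a e) \<cdot> (\<l>\<^sup>\<odot> H)\<inverse>)"
    by (simp add: circ.merge_ext)
  also have "\<dots> = conv_unit_left C u e"
    using circ.left_inv_natural [of e] by (simp add: conv_unit_left_def circ.merge_ext)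
  finally show ?r .
qed

lemma galois_bar_galois_ident:
  assumes "right_module_in C (circ C) H m u P \<mu>" "left_comodule_in C (bull C) H d e Q \<rho>"
    and "conv_id_left C H m d S = conv_unit_left C u e"
  shows "galois_bar C H S P \<mu> X Q \<rho> \<cdot> galois C H P \<mu> X Q \<rho> = \<langle>(P \<bullet> X) \<odot> Q\<rangle>"
  using galois_pairI [OF assms(1,2)] assms(3)
  by (intro galois_pair.galois_left_inverse galois_pair.conv_action_unit)

end

section \<open>Reversing both tensor products\<close>

text \<open>All words are read backwards, so every argument list is reversed. The source and target
  of \<delta>, read this way, have the shape required of \<gamma>, and conversely. Objects, arrows
  and composition are those of \<open>C\<close>.\<close>

definition reversal :: "('o, 'm, 'x) reversion_scheme \<Rightarrow> ('o, 'm, 'x) reversion_scheme"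
  where "reversal C = C\<lparr>circ := rev_tensor C (circ C), bull := rev_tensor C (bull C),
    interchange := (\<lambda>A B D E. interchange C E D B A), phi_circ := (\<lambda>X Y. phi_circ C Y X),
    gamma := (\<lambda>X Y Z T. delta C T Z Y X), delta := (\<lambda>X Y Z T. gamma C T Z Y X)\<rparr>"

lemma reversal_simps [simp]:
  "src\<^bsub>reversal C\<^esub> = src\<^bsub>C\<^esub>" "tgt\<^bsub>reversal C\<^esub> = tgt\<^bsub>C\<^esub>"
  "cat.ident (reversal C) = cat.ident C" "cat.comp (reversal C) = cat.comp C"
  "circ (reversal C) = rev_tensor C (circ C)" "bull (reversal C) = rev_tensor C (bull C)"
  "interchange (reversal C) A B D E = interchange C E D B A"
  "comult_I (reversal C) = comult_I C" "mult_J (reversal C) = mult_J C" "counit_I (reversal C) = counit_I C"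
  "rev_ob (reversal C) = rev_ob C" "rev_arr (reversal C) = rev_arr C"
  "phi_circ (reversal C) X Y = phi_circ C Y X" "phi_circ_0 (reversal C) = phi_circ_0 C"
  "gamma (reversal C) X Y Z T = delta C T Z Y X" "delta (reversal C) X Y Z T = gamma C T Z Y X"
  by (simp_all add: reversal_def)

lemma hom_reversal [simp]: "hom (reversal C) = hom C"
  by (simp add: hom_def fun_eq_iff)

lemma inverse_of_reversal [simp]: "inverse_of (reversal C) = inverse_of C"
  by (simp add: inverse_of_def fun_eq_iff)

lemma inv_arr_reversal [simp]: "inv_arr (reversal C) = inv_arr C" and is_iso_reversal [simp]: "is_iso (reversal C) = is_iso C"
  by (simp_all add: inv_arr_def is_iso_def fun_eq_iff)

lemma rev_tensor_reversal [simp]: "rev_tensor (reversal C) = rev_tensor C"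
  by (simp add: rev_tensor_def fun_eq_iff)

text \<open>The tensor product is a separate parameter of \<open>monoidal_category\<close>;
  \<open>C\<close> enters only through sources, targets, identities and composition, which reversal
  preserves.\<close>

lemma monoidal_category_reversal: "monoidal_category (reversal C) T \<longleftrightarrow> monoidal_category C T"
  by (simp add: monoidal_category_def monoidal_category_axioms_def category_def)

lemma endofunctor_reversal: "endofunctor (reversal C) F F' \<longleftrightarrow> endofunctor C F F'"
  by (simp add: endofunctor_def endofunctor_axioms_def category_def)

lemma structures_reversal [simp]:
  "monoid_in (reversal C) = monoid_in C" "comonoid_in (reversal C) = comonoid_in C"
  "right_module_in (reversal C) = right_module_in C"
  "left_comodule_in (reversal C) = left_comodule_in C"
  by (simp_all add: fun_eq_iff monoid_in_def comonoid_in_def right_module_in_def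
      right_module_in_axioms_def left_comodule_in_def left_comodule_in_axioms_def)

section \<open>Monoids, comonoids, modules and comodules for the reversed tensor product\<close>

context monoidal_category
begin

lemma monoid_rev: "monoid_in C T M m u \<Longrightarrow> monoid_in C (rev_tensor C T) M m u"
  unfolding monoid_in_def by (auto simp: hom_iff)

lemma comonoid_rev:
  assumes "comonoid_in C T M d e" shows "comonoid_in C (rev_tensor C T) M d e"
proof -
  interpret comonoid_in C T M d e by (rule assms)
  have [simp]: "src d = M" "tgt d = M \<otimes>\<^bsub>T\<^esub> M" "src e = M" "tgt e = \<one>\<^bsub>T\<^esub>"
    using comult_hom counit_hom by (simp_all add: hom_iff)
  show ?thesis
    by unfold_locales
      (use comult_coassoc comult_counit_left comult_counit_right in
        \<open>simp_all add: hom_iff flip: comult_coassoc\<close>)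
qed

lemma left_module_rev:
  assumes "left_module_in C T M m u Q \<mu>" shows "right_module_in C (rev_tensor C T) M m u Q \<mu>"
proof -
  interpret left_module_in C T M m u Q \<mu> by (rule assms)
  have [simp]: "src m = M \<otimes>\<^bsub>T\<^esub> M" "tgt m = M" "src \<mu> = M \<otimes>\<^bsub>T\<^esub> Q" "tgt \<mu> = Q"
    using mult_hom left_act_hom by (simp_all add: hom_iff)
  show ?thesis
    unfolding right_module_in_def right_module_in_axioms_def
    using monoid_rev [OF monoid_in_axioms] left_act_mult left_act_unit
    by (simp add: hom_iff)
qed

lemma right_comodule_rev:
  assumes "right_comodule_in C T M d e P \<rho>" shows "left_comodule_in C (rev_tensor C T) M d e P \<rho>"
proof -
  interpret right_comodule_in C T M d e P \<rho> by (rule assms)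
  have [simp]: "src d = M" "tgt d = M \<otimes>\<^bsub>T\<^esub> M" "src \<rho> = P" "tgt \<rho> = P \<otimes>\<^bsub>T\<^esub> M"
    using comult_hom right_coact_hom by (simp_all add: hom_iff)
  show ?thesis
    unfolding left_comodule_in_def left_comodule_in_axioms_def
    using comonoid_rev [OF comonoid_in_axioms] right_coact_counit
    by (simp add: hom_iff flip: right_coact_comult)
qed

end

context duoidal_category
begin

text \<open>Reversal inverts associators, so the mirror image of the associativity axiom of \<zeta>
  carries them inverted and on the other side.\<close>

lemma zeta_circ_assoc_inv:
  "((\<alpha>\<^sup>\<odot> A D F)\<inverse> \<bullet>\<^sub>a (\<alpha>\<^sup>\<odot> B E G)\<inverse>) \<cdot> \<zeta> A B (D \<odot> F) (E \<odot> G) \<cdot> (\<langle>A \<bullet> B\<rangle> \<odot>\<^sub>a \<zeta> D E F G) =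
    \<zeta> (A \<odot> D) (B \<odot> E) F G \<cdot> (\<zeta> A B D E \<odot>\<^sub>a \<langle>F \<bullet> G\<rangle>) \<cdot> (\<alpha>\<^sup>\<odot> (A \<bullet> B) (D \<bullet> E) (F \<bullet> G))\<inverse>"
  using circ.inverse_of_nat [of "\<alpha>\<^sup>\<odot> (A \<bullet> B) (D \<bullet> E) (F \<bullet> G)" "\<alpha>\<^sup>\<odot> A D F \<bullet>\<^sub>a \<alpha>\<^sup>\<odot> B E G"
      "\<zeta> (A \<odot> D) (B \<odot> E) F G \<cdot> (\<zeta> A B D E \<odot>\<^sub>a \<langle>F \<bullet> G\<rangle>)"
      "\<zeta> A B (D \<odot> F) (E \<odot> G) \<cdot> (\<langle>A \<bullet> B\<rangle> \<odot>\<^sub>a \<zeta> D E F G)"]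
    zeta_circ_assoc [of A B D F E G]
  by (simp add: bull.inv_tens)

lemma zeta_bull_assoc_inv:
  "(\<alpha>\<^sup>\<bullet> (A \<odot> E) (B \<odot> F) (D \<odot> G))\<inverse> \<cdot> (\<langle>A \<odot> E\<rangle> \<bullet>\<^sub>a \<zeta> B D F G) \<cdot> \<zeta> A (B \<bullet> D) E (F \<bullet> G) =
    (\<zeta> A B E F \<bullet>\<^sub>a \<langle>D \<odot> G\<rangle>) \<cdot> \<zeta> (A \<bullet> B) D (E \<bullet> F) G \<cdot> ((\<alpha>\<^sup>\<bullet> A B D)\<inverse> \<odot>\<^sub>a (\<alpha>\<^sup>\<bullet> E F G)\<inverse>)"
  using circ.inverse_of_nat [of "\<alpha>\<^sup>\<bullet> A B D \<odot>\<^sub>a \<alpha>\<^sup>\<bullet> E F G" "\<alpha>\<^sup>\<bullet> (A \<odot> E) (B \<odot> F) (D \<odot> G)"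
      "(\<zeta> A B E F \<bullet>\<^sub>a \<langle>D \<odot> G\<rangle>) \<cdot> \<zeta> (A \<bullet> B) D (E \<bullet> F) G"
      "(\<langle>A \<odot> E\<rangle> \<bullet>\<^sub>a \<zeta> B D F G) \<cdot> \<zeta> A (B \<bullet> D) E (F \<bullet> G)"]
    zeta_bull_assoc [of A E B D F G]
  by (simp add: circ.inv_tens)

end

lemma (in galois_reversion) galois_reversion_reversal: "galois_reversion (reversal C)"
proof -
  have J: "monoid_in C (rev_tensor C (circ C)) \<J> m\<^sub>J \<epsilon>\<^sub>I"
    using circ.monoid_rev [OF J_monoid] by simp
  have I: "comonoid_in C (rev_tensor C (bull C)) \<I> \<Delta>\<^sub>I \<epsilon>\<^sub>I"
    using bull.comonoid_rev [OF I_comonoid] by simp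
  show ?thesis
    unfolding galois_reversion_def
  proof (rule conjI)
    show "duoidal_category (reversal C)"
      unfolding duoidal_category_def duoidal_category_axioms_def
      apply (simp add: monoidal_category_reversal circ.monoidal_rev bull.monoidal_rev J I)
      apply (intro conjI allI impI)
      subgoal by (simp add: zeta_hom)
      subgoal by (auto simp: circ.hom_iff zeta_natural)
      subgoal using zeta_circ_assoc_inv by simp
      subgoal using zeta_bull_assoc_inv by simp
      subgoal using zeta_circ_right by simp
      subgoal using zeta_circ_left by simp
      subgoal using zeta_bull_right by simp
      subgoal using zeta_bull_left by simp
      done
    show "galois_reversion_axioms (reversal C)"
      unfolding galois_reversion_axioms_def
      apply (simp add: endofunctor_reversal rev_functor)
      apply (intro conjI allI impI)
      subgoal by (simp add: phi_circ_hom)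
      subgoal by (simp add: phi_circ_0_hom)
      subgoal using phi_circ_right by simp
      subgoal using phi_circ_left by simp
      subgoal by (simp add: delta_hom)
      subgoal by (auto simp: circ.hom_iff delta_natural)
      subgoal by (simp add: gamma_hom)
      subgoal by (auto simp: circ.hom_iff gamma_natural)
      \<comment> \<open>The goals from here on are (R1) to (R9) of the reversed structure. Each
        follows from its partner at the objects in reverse order; where an associator stands on the
        wrong side, \<open>eq_inv_comp\<close> or \<open>eq_comp_inv\<close> moves it
        across.\<close>
      subgoal for X Y Z U T V
        using circ.eq_inv_comp [of "(\<alpha>\<^sup>\<odot> V T Y \<bullet>\<^sub>a \<langle>U \<odot> Z\<rangle>) \<odot>\<^sub>a \<langle>X\<rangle>"
            "\<delta> (V \<odot> T) (U \<odot> Z) Y X \<cdot> (\<langle>V \<odot> T\<rangle> \<bullet>\<^sub>a (\<alpha>\<^sup>\<odot> U Z (Y\<^sup>- \<bullet> X))\<inverse>) \<cdot> \<zeta> V U T (Z \<odot> (Y\<^sup>- \<bullet> X))"]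
          R3 [of V T Y U Z X]
        by (simp add: circ.inv_tens bull.inv_tens)
      subgoal for X T Y Z U V
        using circ.eq_comp_inv [of _ "\<langle>V\<rangle> \<bullet>\<^sub>a (\<langle>U \<bullet> T\<rangle> \<odot>\<^sub>a \<alpha>\<^sup>\<bullet> (Z\<^sup>-) Y X)", OF R4 [of V U Z Y T X, symmetric]]
        by (simp add: circ.inv_tens bull.inv_tens)
      subgoal for X Z U Y T V
        using circ.eq_inv_comp [of "\<langle>V\<rangle> \<odot>\<^sub>a (\<langle>T \<odot> Y\<rangle> \<bullet>\<^sub>a \<alpha>\<^sup>\<odot> U Z X)"
            "(\<langle>V\<rangle> \<odot>\<^sub>a \<zeta> T (U \<odot> Z) Y X) \<cdot> \<alpha>\<^sup>\<odot> V (T \<bullet> (U \<odot> Z)) (Y \<bullet> X) \<cdot> (\<gamma> V U T Z \<odot>\<^sub>a \<langle>Y \<bullet> X\<rangle>)"]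
          R1 [of V U T Y Z X]
        by (simp add: circ.inv_tens bull.inv_tens)
      subgoal for X Y T U Z V
        using circ.eq_comp_inv [of _ "(\<alpha>\<^sup>\<bullet> V U (T\<^sup>-) \<odot>\<^sub>a \<langle>Z \<bullet> Y\<rangle>) \<bullet>\<^sub>a \<langle>X\<rangle>", OF R2 [of V Z U T Y X]]
        by (simp add: circ.inv_tens bull.inv_tens)
      subgoal for X Y T U Z V
        using circ.eq_comp_inv [of _ "\<alpha>\<^sup>\<bullet> V ((U \<bullet> T\<^sup>-) \<odot> (Z\<^sup>- \<bullet> Y)) X", OF R5 [of V U Z Y T X]]
        by simp
      subgoal using R7 by simp
      subgoal using R6 by simp
      subgoal for X Z Y U using R9 [of U Y Z X] by simp
      subgoal for X Z Y U using R8 [of U Y Z X] by simp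
      done
  qed
qed

section \<open>Right inverses of Galois maps\<close>

context galois_reversion
begin

text \<open>\<open>gamma_unit\<close> in the reversed category, hence (R7) extended to arbitrary
  objects by (R3).\<close>

lemma delta_unit:
  "\<r>\<^sup>\<odot> (X \<bullet> Y) \<cdot> ((\<r>\<^sup>\<odot> X \<bullet>\<^sub>a \<langle>Y\<rangle>) \<odot>\<^sub>a \<langle>\<I>\<rangle>) \<cdot> \<delta> X Y \<I> \<I> \<cdot> (\<langle>X\<rangle> \<bullet>\<^sub>a (\<langle>Y\<rangle> \<odot>\<^sub>a \<^bold>k)) =
    \<langle>X\<rangle> \<bullet>\<^sub>a \<r>\<^sup>\<odot> Y"
  using galois_reversion.gamma_unit [OF galois_reversion_reversal, of Y X] by simp

text \<open>Replacing X by \<J> \<bullet> X gives (R4) something to split: \<J> stays inside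
  \<delta>, while X leaves together with V. The action on P thus meets a \<delta> that contains
  neither X nor V.\<close>

lemma zeta_delta:
  fixes U X V P T
  defines "N \<equiv> T\<^sup>- \<bullet> U"
  shows "\<zeta> (P \<odot> T) X U V \<cdot> \<delta> P X T (U \<bullet> V) \<cdot> (\<langle>P\<rangle> \<bullet>\<^sub>a (\<langle>X\<rangle> \<odot>\<^sub>a \<alpha>\<^sup>\<bullet> (T\<^sup>-) U V)) =
    (((\<r>\<^sup>\<bullet> (P \<odot> T) \<odot>\<^sub>a \<langle>U\<rangle>) \<cdot> \<delta> P \<J> T U) \<bullet>\<^sub>a \<langle>X \<odot> V\<rangle>) \<cdot> (\<alpha>\<^sup>\<bullet> P (\<J> \<odot> N) (X \<odot> V))\<inverse> \<cdot>
      (\<langle>P\<rangle> \<bullet>\<^sub>a (\<zeta> \<J> X N V \<cdot> ((\<l>\<^sup>\<bullet> X)\<inverse> \<odot>\<^sub>a \<langle>N \<bullet> V\<rangle>)))" (is "?lhs = ?rhs")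
proof -
  let ?A = "P \<odot> T"
  let ?q = "\<langle>P\<rangle> \<bullet>\<^sub>a ((\<l>\<^sup>\<bullet> X)\<inverse> \<odot>\<^sub>a \<langle>N \<bullet> V\<rangle>)"
  have "?rhs = ((\<r>\<^sup>\<bullet> ?A \<odot>\<^sub>a \<langle>U\<rangle>) \<bullet>\<^sub>a \<langle>X \<odot> V\<rangle>) \<cdot> ((\<delta> P \<J> T U \<bullet>\<^sub>a \<langle>X \<odot> V\<rangle>) \<cdot>
      (\<alpha>\<^sup>\<bullet> P (\<J> \<odot> N) (X \<odot> V))\<inverse> \<cdot> (\<langle>P\<rangle> \<bullet>\<^sub>a \<zeta> \<J> X N V)) \<cdot> ?q"
    by (simp add: N_def bull.merge bull.merge_ext)
  also have "\<dots> = (((\<r>\<^sup>\<bullet> ?A \<odot>\<^sub>a \<langle>U\<rangle>) \<bullet>\<^sub>a \<langle>X \<odot> V\<rangle>) \<cdot> \<zeta> (?A \<bullet> \<J>) X U V) \<cdot>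
      ((\<alpha>\<^sup>\<bullet> ?A \<J> X)\<inverse> \<odot>\<^sub>a \<langle>U \<bullet> V\<rangle>) \<cdot> \<delta> P (\<J> \<bullet> X) T (U \<bullet> V) \<cdot>
      (\<langle>P\<rangle> \<bullet>\<^sub>a (\<langle>\<J> \<bullet> X\<rangle> \<odot>\<^sub>a \<alpha>\<^sup>\<bullet> (T\<^sup>-) U V)) \<cdot> ?q"
    unfolding N_def by (subst R4) simp
  also have "\<dots> = \<zeta> ?A X U V \<cdot> (((\<r>\<^sup>\<bullet> ?A \<bullet>\<^sub>a \<langle>X\<rangle>) \<cdot> (\<alpha>\<^sup>\<bullet> ?A \<J> X)\<inverse>) \<odot>\<^sub>a \<langle>U \<bullet> V\<rangle>) \<cdot>
      \<delta> P (\<J> \<bullet> X) T (U \<bullet> V) \<cdot> (\<langle>P\<rangle> \<bullet>\<^sub>a (\<langle>\<J> \<bullet> X\<rangle> \<odot>\<^sub>a \<alpha>\<^sup>\<bullet> (T\<^sup>-) U V)) \<cdot> ?q"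
    using zeta_natural [of "\<r>\<^sup>\<bullet> ?A" "\<langle>X\<rangle>" "\<langle>U\<rangle>" "\<langle>V\<rangle>", symmetric]
    by (simp add: N_def circ.merge_ext)
  \<comment> \<open>The triangle turns the right constraint at P \<odot> T into the left constraint
    at X, which naturality of \<delta> cancels against the inverse inserted before.\<close>
  also have "\<dots> = \<zeta> ?A X U V \<cdot> ((\<langle>?A\<rangle> \<bullet>\<^sub>a \<l>\<^sup>\<bullet> X) \<odot>\<^sub>a \<langle>U \<bullet> V\<rangle>) \<cdot>
      (\<delta> P (\<J> \<bullet> X) T (U \<bullet> V) \<cdot> (\<langle>P\<rangle> \<bullet>\<^sub>a ((\<l>\<^sup>\<bullet> X)\<inverse> \<odot>\<^sub>a \<langle>T\<^sup>- \<bullet> (U \<bullet> V)\<rangle>))) \<cdot>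
      (\<langle>P\<rangle> \<bullet>\<^sub>a (\<langle>X\<rangle> \<odot>\<^sub>a \<alpha>\<^sup>\<bullet> (T\<^sup>-) U V))"
    unfolding bull.triangle_inv by (simp add: N_def bull.merge circ.merge)
  also have "\<dots> = ?lhs"
    using delta_natural [of "\<langle>P\<rangle>" "(\<l>\<^sup>\<bullet> X)\<inverse>" "\<langle>T\<rangle>" "\<langle>U \<bullet> V\<rangle>"]
    by (simp add: circ.merge_ext bull.merge)
  finally show ?thesis by simp
qed

text \<open>
  Its role is dual to that of \<open>cap\<close>: by (R9), \<open>theta\<close> rebuilds the arrow \<open>\<delta> X \<J> Y U\<close> from \<open>\<psi> Y U\<close>.
\<close>

definition theta :: "'o \<Rightarrow> 'o \<Rightarrow> 'm"
  where "theta X A = ((\<r>\<^sup>\<odot> X \<cdot> \<r>\<^sup>\<bullet> (X \<odot> \<I>)) \<odot>\<^sub>a \<langle>A\<rangle>) \<cdot> \<delta> X \<J> \<I> A \<cdot> (\<langle>X\<rangle> \<bullet>\<^sub>a (\<langle>\<J>\<rangle> \<odot>\<^sub>a (\<phi>\<^sup>\<odot>\<^sub>0 \<bullet>\<^sub>a \<langle>A\<rangle>)))"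

lemma src_theta [simp]: "src (theta X A) = X \<bullet> (\<J> \<odot> (\<I> \<bullet> A))"
  and tgt_theta [simp]: "tgt (theta X A) = X \<odot> A"
  by (simp_all add: theta_def)

lemma theta_natural:
  "theta X (tgt f) \<cdot> (\<langle>X\<rangle> \<bullet>\<^sub>a (\<langle>\<J>\<rangle> \<odot>\<^sub>a (\<langle>\<I>\<rangle> \<bullet>\<^sub>a f))) = (\<langle>X\<rangle> \<odot>\<^sub>a f) \<cdot> theta X (src f)"
proof -
  let ?r = "\<r>\<^sup>\<odot> X \<cdot> \<r>\<^sup>\<bullet> (X \<odot> \<I>)"
  have "theta X (tgt f) \<cdot> (\<langle>X\<rangle> \<bullet>\<^sub>a (\<langle>\<J>\<rangle> \<odot>\<^sub>a (\<langle>\<I>\<rangle> \<bullet>\<^sub>a f))) =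
      (?r \<odot>\<^sub>a \<langle>tgt f\<rangle>) \<cdot> (\<delta> X \<J> \<I> (tgt f) \<cdot> (\<langle>X\<rangle> \<bullet>\<^sub>a (\<langle>\<J>\<rangle> \<odot>\<^sub>a (\<langle>\<I>\<^sup>-\<rangle> \<bullet>\<^sub>a f)))) \<cdot>
      (\<langle>X\<rangle> \<bullet>\<^sub>a (\<langle>\<J>\<rangle> \<odot>\<^sub>a (\<phi>\<^sup>\<odot>\<^sub>0 \<bullet>\<^sub>a \<langle>src f\<rangle>)))"
    by (simp add: theta_def bull.merge circ.merge)
  also have "\<dots> = (\<langle>X\<rangle> \<odot>\<^sub>a f) \<cdot> theta X (src f)"
    using delta_natural [of "\<langle>X\<rangle>" "\<langle>\<J>\<rangle>" "\<langle>\<I>\<rangle>" f] by (simp add: theta_def circ.merge_ext)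
  finally show ?thesis .
qed

text \<open>Counterpart of \<open>cap_comult\<close>, used to evaluate
  \<open>conv_unit_right\<close>. A right unit constraint is added in front so that naturality
  brings the term into the form of \<open>delta_unit\<close> at Y = \<J>, and is inverted at the
  end.\<close>

lemma theta_comult: "theta X \<I> \<cdot> (\<langle>X\<rangle> \<bullet>\<^sub>a (\<langle>\<J>\<rangle> \<odot>\<^sub>a \<Delta>\<^sub>I)) = (\<r>\<^sup>\<odot> X)\<inverse> \<cdot> \<r>\<^sup>\<bullet> X \<cdot> (\<langle>X\<rangle> \<bullet>\<^sub>a \<r>\<^sup>\<odot> \<J>)"
proof -
  have "\<r>\<^sup>\<odot> X \<cdot> theta X \<I> \<cdot> (\<langle>X\<rangle> \<bullet>\<^sub>a (\<langle>\<J>\<rangle> \<odot>\<^sub>a \<Delta>\<^sub>I)) =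
      \<r>\<^sup>\<odot> X \<cdot> (((\<r>\<^sup>\<odot> X \<cdot> \<r>\<^sup>\<bullet> (X \<odot> \<I>)) \<odot>\<^sub>a \<langle>\<I>\<rangle>) \<cdot> \<delta> X \<J> \<I> \<I> \<cdot> (\<langle>X\<rangle> \<bullet>\<^sub>a (\<langle>\<J>\<rangle> \<odot>\<^sub>a \<^bold>k)))"
    by (simp add: theta_def bull.merge circ.merge)
  also have "\<r>\<^sup>\<odot> X \<cdot> \<r>\<^sup>\<bullet> (X \<odot> \<I>) = \<r>\<^sup>\<bullet> X \<cdot> (\<r>\<^sup>\<odot> X \<bullet>\<^sub>a \<langle>\<J>\<rangle>)"
    using bull.right_natural [of "\<r>\<^sup>\<odot> X"] by simp
  also have "\<r>\<^sup>\<odot> X \<cdot> ((\<dots> \<odot>\<^sub>a \<langle>\<I>\<rangle>) \<cdot> \<delta> X \<J> \<I> \<I> \<cdot> (\<langle>X\<rangle> \<bullet>\<^sub>a (\<langle>\<J>\<rangle> \<odot>\<^sub>a \<^bold>k))) =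
      (\<r>\<^sup>\<odot> X \<cdot> (\<r>\<^sup>\<bullet> X \<odot>\<^sub>a \<langle>\<I>\<rangle>)) \<cdot> ((\<r>\<^sup>\<odot> X \<bullet>\<^sub>a \<langle>\<J>\<rangle>) \<odot>\<^sub>a \<langle>\<I>\<rangle>) \<cdot> \<delta> X \<J> \<I> \<I> \<cdot> (\<langle>X\<rangle> \<bullet>\<^sub>a (\<langle>\<J>\<rangle> \<odot>\<^sub>a \<^bold>k))"
    by (simp add: circ.merge_ext)
  also have "\<r>\<^sup>\<odot> X \<cdot> (\<r>\<^sup>\<bullet> X \<odot>\<^sub>a \<langle>\<I>\<rangle>) = \<r>\<^sup>\<bullet> X \<cdot> \<r>\<^sup>\<odot> (X \<bullet> \<J>)"
    using circ.right_natural [of "\<r>\<^sup>\<bullet> X"] by simp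
  also have "\<dots> \<cdot> ((\<r>\<^sup>\<odot> X \<bullet>\<^sub>a \<langle>\<J>\<rangle>) \<odot>\<^sub>a \<langle>\<I>\<rangle>) \<cdot> \<delta> X \<J> \<I> \<I> \<cdot> (\<langle>X\<rangle> \<bullet>\<^sub>a (\<langle>\<J>\<rangle> \<odot>\<^sub>a \<^bold>k)) =
      \<r>\<^sup>\<bullet> X \<cdot> (\<langle>X\<rangle> \<bullet>\<^sub>a \<r>\<^sup>\<odot> \<J>)"
    using delta_unit [of X \<J>] by simp
  finally have "\<r>\<^sup>\<odot> X \<cdot> (theta X \<I> \<cdot> (\<langle>X\<rangle> \<bullet>\<^sub>a (\<langle>\<J>\<rangle> \<odot>\<^sub>a \<Delta>\<^sub>I))) = \<r>\<^sup>\<bullet> X \<cdot> (\<langle>X\<rangle> \<bullet>\<^sub>a \<r>\<^sup>\<odot> \<J>)"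
    by simp
  from circ.eq_inv_comp [OF this] show ?thesis by simp
qed

text \<open>(R9) at Z = \<I>, composed with corrections on both ends. Feeding
  \<open>\<phi>\<^sup>\<odot>\<^sub>0\<close> into the argument \<open>\<I>\<^sup>-\<close> produces
  \<open>psi\<close> on the \<gamma> side of (R9) and reduces \<I> \<odot> Y to Y on the other;
  \<open>m\<^sub>J\<close> merges the two copies of \<J> that (R9) contains.\<close>

lemma delta_theta:
  "\<alpha>\<^sup>\<odot> X Y U \<cdot> (\<r>\<^sup>\<bullet> (X \<odot> Y) \<odot>\<^sub>a \<langle>U\<rangle>) \<cdot> \<delta> X \<J> Y U =
    theta X (Y \<odot> U) \<cdot> (\<langle>X\<rangle> \<bullet>\<^sub>a ((m\<^sub>J \<odot>\<^sub>a \<langle>\<I> \<bullet> (Y \<odot> U)\<rangle>) \<cdot> (\<alpha>\<^sup>\<odot> \<J> \<J> (\<I> \<bullet> (Y \<odot> U)))\<inverse> \<cdot> (\<langle>\<J>\<rangle> \<odot>\<^sub>a \<psi> Y U)))"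
proof -
  let ?A = "Y \<odot> U" and ?M = "\<I>\<^sup>- \<bullet> (Y \<odot> U)"
  \<comment> \<open>\<open>?q\<close> supplies \<open>\<phi>\<^sup>\<odot>\<^sub>0\<close> before
    (R9), \<open>?p\<close> applies \<open>m\<^sub>J\<close> and the unit constraints after it.
    \<open>l\<close> and \<open>r\<close> evaluate the two sides of (R9) between them.\<close>
  let ?q = "\<langle>X\<rangle> \<bullet>\<^sub>a (\<langle>\<J>\<rangle> \<odot>\<^sub>a (((\<langle>Y\<^sup>-\<rangle> \<odot>\<^sub>a \<phi>\<^sup>\<odot>\<^sub>0) \<cdot> (\<r>\<^sup>\<odot> (Y\<^sup>-))\<inverse>) \<bullet>\<^sub>a \<langle>U\<rangle>))"
  let ?p = "\<r>\<^sup>\<odot> X \<cdot> \<r>\<^sup>\<bullet> (X \<odot> \<I>) \<cdot> (\<langle>X \<odot> \<I>\<rangle> \<bullet>\<^sub>a m\<^sub>J)"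
  let ?l = "\<delta> X (\<J> \<odot> \<J>) \<I> ?A \<cdot> (\<langle>X\<rangle> \<bullet>\<^sub>a (\<alpha>\<^sup>\<odot> \<J> \<J> ?M)\<inverse>) \<cdot> (\<langle>X\<rangle> \<bullet>\<^sub>a (\<langle>\<J>\<rangle> \<odot>\<^sub>a \<gamma> \<J> Y (\<I>\<^sup>-) U)) \<cdot>
        (\<langle>X\<rangle> \<bullet>\<^sub>a (\<langle>\<J>\<rangle> \<odot>\<^sub>a (((\<l>\<^sup>\<bullet> (Y\<^sup>-))\<inverse> \<odot>\<^sub>a \<langle>\<I>\<^sup>-\<rangle>) \<bullet>\<^sub>a \<langle>U\<rangle>)))"
  let ?r = "(\<zeta> X \<J> \<I> \<J> \<odot>\<^sub>a \<langle>?A\<rangle>) \<cdot> (((\<r>\<^sup>\<bullet> X)\<inverse> \<odot>\<^sub>a (\<r>\<^sup>\<bullet> \<I>)\<inverse>) \<odot>\<^sub>a \<langle>?A\<rangle>) \<cdot>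
        \<alpha>\<^sup>\<odot> (X \<odot> \<I>) Y U \<cdot> ((\<alpha>\<^sup>\<odot> X \<I> Y)\<inverse> \<odot>\<^sub>a \<langle>U\<rangle>) \<cdot> (\<r>\<^sup>\<bullet> (X \<odot> (\<I> \<odot> Y)) \<odot>\<^sub>a \<langle>U\<rangle>) \<cdot>
        \<delta> X \<J> (\<I> \<odot> Y) U \<cdot> (\<langle>X\<rangle> \<bullet>\<^sub>a (\<langle>\<J>\<rangle> \<odot>\<^sub>a (\<phi>\<^sup>\<odot> Y \<I> \<bullet>\<^sub>a \<langle>U\<rangle>)))"
  have R: "?l = ?r" by (rule R9)
  have l: "(?p \<odot>\<^sub>a \<langle>?A\<rangle>) \<cdot> ?l \<cdot> ?q = theta X ?A \<cdot>
      (\<langle>X\<rangle> \<bullet>\<^sub>a ((m\<^sub>J \<odot>\<^sub>a \<langle>\<I> \<bullet> ?A\<rangle>) \<cdot> (\<alpha>\<^sup>\<odot> \<J> \<J> (\<I> \<bullet> ?A))\<inverse> \<cdot> (\<langle>\<J>\<rangle> \<odot>\<^sub>a \<psi> Y U)))"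
  proof -
    \<comment> \<open>Naturality of \<gamma> in the third argument:
      \<open>\<phi>\<^sup>\<odot>\<^sub>0\<close> passes through and leaves \<I> in its place, as
      the definition of \<open>psi\<close> requires.\<close>
    have g: "\<gamma> \<J> Y (\<I>\<^sup>-) U \<cdot> (((((\<l>\<^sup>\<bullet> (Y\<^sup>-))\<inverse> \<odot>\<^sub>a \<langle>\<I>\<^sup>-\<rangle>) \<cdot> (\<langle>Y\<^sup>-\<rangle> \<odot>\<^sub>a \<phi>\<^sup>\<odot>\<^sub>0)) \<cdot> (\<r>\<^sup>\<odot> (Y\<^sup>-))\<inverse>) \<bullet>\<^sub>a \<langle>U\<rangle>) =
        (\<langle>\<J>\<rangle> \<odot>\<^sub>a (\<phi>\<^sup>\<odot>\<^sub>0 \<bullet>\<^sub>a \<langle>?A\<rangle>)) \<cdot> \<psi> Y U"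
    proof -
      have "\<gamma> \<J> Y (\<I>\<^sup>-) U \<cdot> (((((\<l>\<^sup>\<bullet> (Y\<^sup>-))\<inverse> \<odot>\<^sub>a \<langle>\<I>\<^sup>-\<rangle>) \<cdot> (\<langle>Y\<^sup>-\<rangle> \<odot>\<^sub>a \<phi>\<^sup>\<odot>\<^sub>0)) \<cdot> (\<r>\<^sup>\<odot> (Y\<^sup>-))\<inverse>) \<bullet>\<^sub>a \<langle>U\<rangle>) =
        (\<gamma> \<J> Y (\<I>\<^sup>-) U \<cdot> ((\<langle>\<J> \<bullet> Y\<^sup>-\<rangle> \<odot>\<^sub>a \<phi>\<^sup>\<odot>\<^sub>0) \<bullet>\<^sub>a \<langle>U\<rangle>)) \<cdot>
          (((\<l>\<^sup>\<bullet> (Y\<^sup>-))\<inverse> \<odot>\<^sub>a \<langle>\<I>\<rangle>) \<bullet>\<^sub>a \<langle>U\<rangle>) \<cdot> ((\<r>\<^sup>\<odot> (Y\<^sup>-))\<inverse> \<bullet>\<^sub>a \<langle>U\<rangle>)"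
        by (simp add: bull.merge circ.merge circ.merge_ext)
      then show ?thesis
        using circ.comp_extend [OF gamma_natural [of "\<langle>\<J>\<rangle>" "\<langle>Y\<rangle>" "\<phi>\<^sup>\<odot>\<^sub>0" "\<langle>U\<rangle>"]]
        by (simp add: psi_def)
    qed
    have "(?p \<odot>\<^sub>a \<langle>?A\<rangle>) \<cdot> ?l \<cdot> ?q = (?p \<odot>\<^sub>a \<langle>?A\<rangle>) \<cdot> \<delta> X (\<J> \<odot> \<J>) \<I> ?A \<cdot> (\<langle>X\<rangle> \<bullet>\<^sub>a ((\<alpha>\<^sup>\<odot> \<J> \<J> ?M)\<inverse> \<cdot> (\<langle>\<J>\<rangle> \<odot>\<^sub>a
        (\<gamma> \<J> Y (\<I>\<^sup>-) U \<cdot> (((((\<l>\<^sup>\<bullet> (Y\<^sup>-))\<inverse> \<odot>\<^sub>a \<langle>\<I>\<^sup>-\<rangle>) \<cdot> (\<langle>Y\<^sup>-\<rangle> \<odot>\<^sub>a \<phi>\<^sup>\<odot>\<^sub>0)) \<cdot> (\<r>\<^sup>\<odot> (Y\<^sup>-))\<inverse>) \<bullet>\<^sub>a \<langle>U\<rangle>)))))"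
      by (simp add: bull.merge circ.merge circ.merge_ext)
    also have "\<dots> = ((\<r>\<^sup>\<odot> X \<cdot> \<r>\<^sup>\<bullet> (X \<odot> \<I>)) \<odot>\<^sub>a \<langle>?A\<rangle>) \<cdot>
        (((\<langle>X \<odot> \<I>\<rangle> \<bullet>\<^sub>a m\<^sub>J) \<odot>\<^sub>a \<langle>?A\<rangle>) \<cdot> \<delta> X (\<J> \<odot> \<J>) \<I> ?A) \<cdot> (\<langle>X\<rangle> \<bullet>\<^sub>a ((\<alpha>\<^sup>\<odot> \<J> \<J> ?M)\<inverse> \<cdot>
        (\<langle>\<J>\<rangle> \<odot>\<^sub>a (\<langle>\<J>\<rangle> \<odot>\<^sub>a (\<phi>\<^sup>\<odot>\<^sub>0 \<bullet>\<^sub>a \<langle>?A\<rangle>))) \<cdot> (\<langle>\<J>\<rangle> \<odot>\<^sub>a \<psi> Y U)))"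
      unfolding g by (simp add: circ.merge circ.merge_ext)
    also have "\<dots> = ((\<r>\<^sup>\<odot> X \<cdot> \<r>\<^sup>\<bullet> (X \<odot> \<I>)) \<odot>\<^sub>a \<langle>?A\<rangle>) \<cdot>
        (\<delta> X \<J> \<I> ?A \<cdot> (\<langle>X\<rangle> \<bullet>\<^sub>a (m\<^sub>J \<odot>\<^sub>a \<langle>?M\<rangle>))) \<cdot> (\<langle>X\<rangle> \<bullet>\<^sub>a (((\<langle>\<J> \<odot> \<J>\<rangle> \<odot>\<^sub>a (\<phi>\<^sup>\<odot>\<^sub>0 \<bullet>\<^sub>a \<langle>?A\<rangle>)) \<cdot>
        (\<alpha>\<^sup>\<odot> \<J> \<J> (\<I> \<bullet> ?A))\<inverse>) \<cdot> (\<langle>\<J>\<rangle> \<odot>\<^sub>a \<psi> Y U)))"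
      using delta_natural [of "\<langle>X\<rangle>" "m\<^sub>J" "\<langle>\<I>\<rangle>" "\<langle>?A\<rangle>"]
        circ.comp_extend [OF circ.assoc_inv_natural [of "\<langle>\<J>\<rangle>" "\<langle>\<J>\<rangle>" "\<phi>\<^sup>\<odot>\<^sub>0 \<bullet>\<^sub>a \<langle>?A\<rangle>"]] by simp
    also have "\<dots> = theta X ?A \<cdot>
      (\<langle>X\<rangle> \<bullet>\<^sub>a ((m\<^sub>J \<odot>\<^sub>a \<langle>\<I> \<bullet> ?A\<rangle>) \<cdot> (\<alpha>\<^sup>\<odot> \<J> \<J> (\<I> \<bullet> ?A))\<inverse> \<cdot> (\<langle>\<J>\<rangle> \<odot>\<^sub>a \<psi> Y U)))"
      by (simp add: theta_def bull.merge bull.merge_ext circ.merge circ.merge_ext)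
    finally show ?thesis .
  qed
  have r: "(?p \<odot>\<^sub>a \<langle>?A\<rangle>) \<cdot> ?r \<cdot> ?q = \<alpha>\<^sup>\<odot> X Y U \<cdot> (\<r>\<^sup>\<bullet> (X \<odot> Y) \<odot>\<^sub>a \<langle>U\<rangle>) \<cdot> \<delta> X \<J> Y U"
  proof -
    \<comment> \<open>A unit law of the lax structure, solved for its last two factors by applying
      the reversion functor to the inverse of a unit constraint.\<close>
    have ph: "\<phi>\<^sup>\<odot> Y \<I> \<cdot> (\<langle>Y\<^sup>-\<rangle> \<odot>\<^sub>a \<phi>\<^sup>\<odot>\<^sub>0) \<cdot> (\<r>\<^sup>\<odot> (Y\<^sup>-))\<inverse> = ((\<l>\<^sup>\<odot> Y)\<inverse>)\<^sup>-\<^sub>a"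
    proof -
      have "\<phi>\<^sup>\<odot> Y \<I> \<cdot> (\<langle>Y\<^sup>-\<rangle> \<odot>\<^sub>a \<phi>\<^sup>\<odot>\<^sub>0) \<cdot> (\<r>\<^sup>\<odot> (Y\<^sup>-))\<inverse> =
          ((\<l>\<^sup>\<odot> Y)\<inverse> \<cdot> \<l>\<^sup>\<odot> Y)\<^sup>-\<^sub>a \<cdot> (\<phi>\<^sup>\<odot> Y \<I> \<cdot> (\<langle>Y\<^sup>-\<rangle> \<odot>\<^sub>a \<phi>\<^sup>\<odot>\<^sub>0) \<cdot> (\<r>\<^sup>\<odot> (Y\<^sup>-))\<inverse>)"
        by simp
      also have "\<dots> = ((\<l>\<^sup>\<odot> Y)\<inverse>)\<^sup>-\<^sub>a \<cdot> ((\<l>\<^sup>\<odot> Y)\<^sup>-\<^sub>a \<cdot> \<phi>\<^sup>\<odot> Y \<I> \<cdot> (\<langle>Y\<^sup>-\<rangle> \<odot>\<^sub>a \<phi>\<^sup>\<odot>\<^sub>0)) \<cdot> (\<r>\<^sup>\<odot> (Y\<^sup>-))\<inverse>"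
        by (subst rev_comp) simp_all
      also have "\<dots> = ((\<l>\<^sup>\<odot> Y)\<inverse>)\<^sup>-\<^sub>a" by (subst phi_circ_right) simp
      finally show ?thesis .
    qed
    \<comment> \<open>The reason for \<open>m\<^sub>J\<close> in \<open>?p\<close>: with it \<zeta>
      becomes a tensor product of unit constraints by \<open>zeta_bull_right\<close>, and these
      cancel.\<close>
    have pz: "?p \<cdot> \<zeta> X \<J> \<I> \<J> \<cdot> ((\<r>\<^sup>\<bullet> X)\<inverse> \<odot>\<^sub>a (\<r>\<^sup>\<bullet> \<I>)\<inverse>) = \<r>\<^sup>\<odot> X"
    proof -
      have "?p \<cdot> \<zeta> X \<J> \<I> \<J> \<cdot> ((\<r>\<^sup>\<bullet> X)\<inverse> \<odot>\<^sub>a (\<r>\<^sup>\<bullet> \<I>)\<inverse>) =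
          \<r>\<^sup>\<odot> X \<cdot> (\<r>\<^sup>\<bullet> (X \<odot> \<I>) \<cdot> (\<langle>X \<odot> \<I>\<rangle> \<bullet>\<^sub>a m\<^sub>J) \<cdot> \<zeta> X \<J> \<I> \<J>) \<cdot> ((\<r>\<^sup>\<bullet> X)\<inverse> \<odot>\<^sub>a (\<r>\<^sup>\<bullet> \<I>)\<inverse>)"
        by simp
      also have "\<dots> = \<r>\<^sup>\<odot> X" unfolding zeta_bull_right by (simp add: circ.merge)
      finally show ?thesis .
    qed
    have "(?p \<odot>\<^sub>a \<langle>?A\<rangle>) \<cdot> ?r \<cdot> ?q = ((?p \<cdot> \<zeta> X \<J> \<I> \<J> \<cdot> ((\<r>\<^sup>\<bullet> X)\<inverse> \<odot>\<^sub>a (\<r>\<^sup>\<bullet> \<I>)\<inverse>)) \<odot>\<^sub>a \<langle>?A\<rangle>) \<cdot>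
        \<alpha>\<^sup>\<odot> (X \<odot> \<I>) Y U \<cdot> ((\<alpha>\<^sup>\<odot> X \<I> Y)\<inverse> \<odot>\<^sub>a \<langle>U\<rangle>) \<cdot> (\<r>\<^sup>\<bullet> (X \<odot> (\<I> \<odot> Y)) \<odot>\<^sub>a \<langle>U\<rangle>) \<cdot>
        \<delta> X \<J> (\<I> \<odot> Y) U \<cdot> (\<langle>X\<rangle> \<bullet>\<^sub>a (\<langle>\<J>\<rangle> \<odot>\<^sub>a
        ((\<phi>\<^sup>\<odot> Y \<I> \<cdot> (\<langle>Y\<^sup>-\<rangle> \<odot>\<^sub>a \<phi>\<^sup>\<odot>\<^sub>0) \<cdot> (\<r>\<^sup>\<odot> (Y\<^sup>-))\<inverse>) \<bullet>\<^sub>a \<langle>U\<rangle>)))"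
      by (simp add: bull.merge circ.merge circ.merge_ext)
    also have "\<dots> = ((\<r>\<^sup>\<odot> X \<odot>\<^sub>a \<langle>?A\<rangle>) \<cdot> \<alpha>\<^sup>\<odot> (X \<odot> \<I>) Y U) \<cdot> ((\<alpha>\<^sup>\<odot> X \<I> Y)\<inverse> \<odot>\<^sub>a \<langle>U\<rangle>) \<cdot> (\<r>\<^sup>\<bullet> (X \<odot> (\<I> \<odot> Y)) \<odot>\<^sub>a \<langle>U\<rangle>) \<cdot>
        (\<delta> X \<J> (\<I> \<odot> Y) U \<cdot> (\<langle>X\<rangle> \<bullet>\<^sub>a (\<langle>\<J>\<rangle> \<odot>\<^sub>a (((\<l>\<^sup>\<odot> Y)\<inverse>)\<^sup>-\<^sub>a \<bullet>\<^sub>a \<langle>U\<rangle>))))"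
      unfolding pz ph by simp
    also have "\<dots> = (\<alpha>\<^sup>\<odot> X Y U \<cdot> ((\<r>\<^sup>\<odot> X \<odot>\<^sub>a \<langle>Y\<rangle>) \<odot>\<^sub>a \<langle>U\<rangle>)) \<cdot> ((\<alpha>\<^sup>\<odot> X \<I> Y)\<inverse> \<odot>\<^sub>a \<langle>U\<rangle>) \<cdot> (\<r>\<^sup>\<bullet> (X \<odot> (\<I> \<odot> Y)) \<odot>\<^sub>a \<langle>U\<rangle>) \<cdot>
        ((((\<langle>X\<rangle> \<odot>\<^sub>a (\<l>\<^sup>\<odot> Y)\<inverse>) \<bullet>\<^sub>a \<langle>\<J>\<rangle>) \<odot>\<^sub>a \<langle>U\<rangle>) \<cdot> \<delta> X \<J> Y U)"
      using circ.assoc_natural [of "\<r>\<^sup>\<odot> X" "\<langle>Y\<rangle>" "\<langle>U\<rangle>"] delta_natural [of "\<langle>X\<rangle>" "\<langle>\<J>\<rangle>" "(\<l>\<^sup>\<odot> Y)\<inverse>" "\<langle>U\<rangle>"] by simp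
    also have "\<dots> = \<alpha>\<^sup>\<odot> X Y U \<cdot> ((((\<r>\<^sup>\<odot> X \<odot>\<^sub>a \<langle>Y\<rangle>) \<cdot> (\<alpha>\<^sup>\<odot> X \<I> Y)\<inverse>) \<cdot> (\<r>\<^sup>\<bullet> (X \<odot> (\<I> \<odot> Y)) \<cdot>
        ((\<langle>X\<rangle> \<odot>\<^sub>a (\<l>\<^sup>\<odot> Y)\<inverse>) \<bullet>\<^sub>a \<langle>\<J>\<rangle>))) \<odot>\<^sub>a \<langle>U\<rangle>) \<cdot> \<delta> X \<J> Y U"
      by (simp add: circ.merge_ext)
    also have "\<r>\<^sup>\<bullet> (X \<odot> (\<I> \<odot> Y)) \<cdot> ((\<langle>X\<rangle> \<odot>\<^sub>a (\<l>\<^sup>\<odot> Y)\<inverse>) \<bullet>\<^sub>a \<langle>\<J>\<rangle>) = (\<langle>X\<rangle> \<odot>\<^sub>a (\<l>\<^sup>\<odot> Y)\<inverse>) \<cdot> \<r>\<^sup>\<bullet> (X \<odot> Y)"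
      using bull.right_natural [of "\<langle>X\<rangle> \<odot>\<^sub>a (\<l>\<^sup>\<odot> Y)\<inverse>"] by simp
    also have "(\<r>\<^sup>\<odot> X \<odot>\<^sub>a \<langle>Y\<rangle>) \<cdot> (\<alpha>\<^sup>\<odot> X \<I> Y)\<inverse> = \<langle>X\<rangle> \<odot>\<^sub>a \<l>\<^sup>\<odot> Y"
      by (rule circ.triangle_inv)
    also have "(\<langle>X\<rangle> \<odot>\<^sub>a \<l>\<^sup>\<odot> Y) \<cdot> ((\<langle>X\<rangle> \<odot>\<^sub>a (\<l>\<^sup>\<odot> Y)\<inverse>) \<cdot> \<r>\<^sup>\<bullet> (X \<odot> Y)) = \<r>\<^sup>\<bullet> (X \<odot> Y)"
      by (simp add: circ.merge_ext)
    finally show ?thesis by simp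
  qed
  show ?thesis using l unfolding R r .
qed

end

context galois_bimonoid
begin

text \<open>The right-hand side contains neither S nor \<mu>: once S \<star> Id is the convolution
  unit, its u is absorbed by the unit law of the action and only e remains, multiplied into \<J> by
  \<open>m\<^sub>J\<close>.\<close>

lemma action_delta:
  assumes "right_module_in C (circ C) H m u P \<mu>"
    and "conv_id_right C H m d S = conv_unit_right C u e"
  shows "\<mu> \<cdot> (\<mu> \<odot>\<^sub>a \<langle>H\<rangle>) \<cdot> (\<r>\<^sup>\<bullet> (P \<odot> H) \<odot>\<^sub>a \<langle>H\<rangle>) \<cdot> \<delta> P \<J> H H \<cdot>
      (\<langle>P\<rangle> \<bullet>\<^sub>a (\<langle>\<J>\<rangle> \<odot>\<^sub>a ((S \<bullet>\<^sub>a \<langle>H\<rangle>) \<cdot> d))) =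
    \<r>\<^sup>\<bullet> P \<cdot> (\<langle>P\<rangle> \<bullet>\<^sub>a (m\<^sub>J \<cdot> (\<langle>\<J>\<rangle> \<odot>\<^sub>a e)))"
proof -
  interpret P: right_module_in C "circ C" H m u P \<mu> by (rule assms)
  have [simp]: "src \<mu> = P \<odot> H" "tgt \<mu> = P"
    using P.right_act_hom by (simp_all add: circ.hom_iff)
  let ?A = "H \<odot> H" and ?s = "(S \<bullet>\<^sub>a \<langle>H\<rangle>) \<cdot> d"
  have "\<mu> \<cdot> (\<mu> \<odot>\<^sub>a \<langle>H\<rangle>) \<cdot> (\<r>\<^sup>\<bullet> (P \<odot> H) \<odot>\<^sub>a \<langle>H\<rangle>) \<cdot> \<delta> P \<J> H H \<cdot> (\<langle>P\<rangle> \<bullet>\<^sub>a (\<langle>\<J>\<rangle> \<odot>\<^sub>a ?s)) =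
      \<mu> \<cdot> (\<langle>P\<rangle> \<odot>\<^sub>a m) \<cdot> (\<alpha>\<^sup>\<odot> P H H \<cdot> (\<r>\<^sup>\<bullet> (P \<odot> H) \<odot>\<^sub>a \<langle>H\<rangle>) \<cdot> \<delta> P \<J> H H) \<cdot> (\<langle>P\<rangle> \<bullet>\<^sub>a (\<langle>\<J>\<rangle> \<odot>\<^sub>a ?s))"
    unfolding P.right_act_mult by simp
  also have "\<dots> = \<mu> \<cdot> ((\<langle>P\<rangle> \<odot>\<^sub>a m) \<cdot> theta P ?A) \<cdot> (\<langle>P\<rangle> \<bullet>\<^sub>a ((m\<^sub>J \<odot>\<^sub>a \<langle>\<I> \<bullet> ?A\<rangle>) \<cdot> (\<alpha>\<^sup>\<odot> \<J> \<J> (\<I> \<bullet> ?A))\<inverse> \<cdot>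
      (\<langle>\<J>\<rangle> \<odot>\<^sub>a (\<psi> H H \<cdot> ?s))))"
    unfolding delta_theta by (simp add: bull.merge circ.merge)
  also have "\<dots> = \<mu> \<cdot> (theta P H \<cdot> (\<langle>P\<rangle> \<bullet>\<^sub>a (\<langle>\<J>\<rangle> \<odot>\<^sub>a (\<langle>\<I>\<rangle> \<bullet>\<^sub>a m)))) \<cdot> (\<langle>P\<rangle> \<bullet>\<^sub>a ((m\<^sub>J \<odot>\<^sub>a \<langle>\<I> \<bullet> ?A\<rangle>) \<cdot>
      (\<alpha>\<^sup>\<odot> \<J> \<J> (\<I> \<bullet> ?A))\<inverse> \<cdot> (\<langle>\<J>\<rangle> \<odot>\<^sub>a (\<psi> H H \<cdot> ?s))))"
    using theta_natural [of P m] by simp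
  also have "\<dots> = \<mu> \<cdot> theta P H \<cdot> (\<langle>P\<rangle> \<bullet>\<^sub>a ((m\<^sub>J \<odot>\<^sub>a \<langle>\<I> \<bullet> H\<rangle>) \<cdot> ((\<langle>\<J> \<odot> \<J>\<rangle> \<odot>\<^sub>a (\<langle>\<I>\<rangle> \<bullet>\<^sub>a m)) \<cdot>
      (\<alpha>\<^sup>\<odot> \<J> \<J> (\<I> \<bullet> ?A))\<inverse>) \<cdot> (\<langle>\<J>\<rangle> \<odot>\<^sub>a (\<psi> H H \<cdot> ?s))))"
    by (simp add: bull.merge circ.merge_ext)
  also have "\<dots> = \<mu> \<cdot> theta P H \<cdot> (\<langle>P\<rangle> \<bullet>\<^sub>a ((m\<^sub>J \<odot>\<^sub>a \<langle>\<I> \<bullet> H\<rangle>) \<cdot> ((\<alpha>\<^sup>\<odot> \<J> \<J> (\<I> \<bullet> H))\<inverse> \<cdot>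
      (\<langle>\<J>\<rangle> \<odot>\<^sub>a (\<langle>\<J>\<rangle> \<odot>\<^sub>a (\<langle>\<I>\<rangle> \<bullet>\<^sub>a m)))) \<cdot> (\<langle>\<J>\<rangle> \<odot>\<^sub>a (\<psi> H H \<cdot> ?s))))"
    using circ.assoc_inv_natural [of "\<langle>\<J>\<rangle>" "\<langle>\<J>\<rangle>" "\<langle>\<I>\<rangle> \<bullet>\<^sub>a m"] by simp
  also have "\<dots> = \<mu> \<cdot> theta P H \<cdot> (\<langle>P\<rangle> \<bullet>\<^sub>a ((m\<^sub>J \<odot>\<^sub>a \<langle>\<I> \<bullet> H\<rangle>) \<cdot> (\<alpha>\<^sup>\<odot> \<J> \<J> (\<I> \<bullet> H))\<inverse> \<cdot>
      (\<langle>\<J>\<rangle> \<odot>\<^sub>a conv_id_right C H m d S)))"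
    by (simp add: conv_id_right_def circ.merge)
  also have "conv_id_right C H m d S = (\<langle>\<J>\<rangle> \<odot>\<^sub>a ((\<langle>\<I>\<rangle> \<bullet>\<^sub>a u) \<cdot> \<Delta>\<^sub>I)) \<cdot> (\<r>\<^sup>\<odot> \<J>)\<inverse> \<cdot> e"
    using assms(2) by (simp add: conv_unit_right_def circ.merge_ext)
  \<comment> \<open>Naturality lets \<open>m\<^sub>J\<close> pass the unit factor that carries u, so
    that it acts directly on \<J> \<odot> e.\<close>
  also have "(m\<^sub>J \<odot>\<^sub>a \<langle>\<I> \<bullet> H\<rangle>) \<cdot> (\<alpha>\<^sup>\<odot> \<J> \<J> (\<I> \<bullet> H))\<inverse> \<cdot> (\<langle>\<J>\<rangle> \<odot>\<^sub>a \<dots>) =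
      (\<langle>\<J>\<rangle> \<odot>\<^sub>a ((\<langle>\<I>\<rangle> \<bullet>\<^sub>a u) \<cdot> \<Delta>\<^sub>I)) \<cdot> (\<r>\<^sup>\<odot> \<J>)\<inverse> \<cdot> m\<^sub>J \<cdot> (\<langle>\<J>\<rangle> \<odot>\<^sub>a e)"
  proof -
    let ?v = "(\<langle>\<I>\<rangle> \<bullet>\<^sub>a u) \<cdot> \<Delta>\<^sub>I"
    have "(m\<^sub>J \<odot>\<^sub>a \<langle>\<I> \<bullet> H\<rangle>) \<cdot> (\<alpha>\<^sup>\<odot> \<J> \<J> (\<I> \<bullet> H))\<inverse> \<cdot> (\<langle>\<J>\<rangle> \<odot>\<^sub>a ((\<langle>\<J>\<rangle> \<odot>\<^sub>a ?v) \<cdot> (\<r>\<^sup>\<odot> \<J>)\<inverse> \<cdot> e)) =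
        (m\<^sub>J \<odot>\<^sub>a \<langle>\<I> \<bullet> H\<rangle>) \<cdot> ((\<alpha>\<^sup>\<odot> \<J> \<J> (\<I> \<bullet> H))\<inverse> \<cdot> (\<langle>\<J>\<rangle> \<odot>\<^sub>a (\<langle>\<J>\<rangle> \<odot>\<^sub>a ?v))) \<cdot>
        (\<langle>\<J>\<rangle> \<odot>\<^sub>a (\<r>\<^sup>\<odot> \<J>)\<inverse>) \<cdot> (\<langle>\<J>\<rangle> \<odot>\<^sub>a e)"
      by (simp add: circ.merge)
    also have "\<dots> = (m\<^sub>J \<odot>\<^sub>a ?v) \<cdot> ((\<alpha>\<^sup>\<odot> \<J> \<J> \<I>)\<inverse> \<cdot> (\<langle>\<J>\<rangle> \<odot>\<^sub>a (\<r>\<^sup>\<odot> \<J>)\<inverse>)) \<cdot> (\<langle>\<J>\<rangle> \<odot>\<^sub>a e)"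
      using circ.assoc_inv_natural [of "\<langle>\<J>\<rangle>" "\<langle>\<J>\<rangle>" ?v] by (simp add: circ.merge_ext)
    also have "(\<alpha>\<^sup>\<odot> \<J> \<J> \<I>)\<inverse> \<cdot> (\<langle>\<J>\<rangle> \<odot>\<^sub>a (\<r>\<^sup>\<odot> \<J>)\<inverse>) = (\<r>\<^sup>\<odot> (\<J> \<odot> \<J>))\<inverse>"
      by (rule circ.right_tens_inv)
    also have "(m\<^sub>J \<odot>\<^sub>a ?v) \<cdot> (\<r>\<^sup>\<odot> (\<J> \<odot> \<J>))\<inverse> \<cdot> (\<langle>\<J>\<rangle> \<odot>\<^sub>a e) =
        (\<langle>\<J>\<rangle> \<odot>\<^sub>a ?v) \<cdot> ((m\<^sub>J \<odot>\<^sub>a \<langle>\<I>\<rangle>) \<cdot> (\<r>\<^sup>\<odot> (\<J> \<odot> \<J>))\<inverse>) \<cdot> (\<langle>\<J>\<rangle> \<odot>\<^sub>a e)"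
      by (simp add: circ.merge_ext)
    also have "(m\<^sub>J \<odot>\<^sub>a \<langle>\<I>\<rangle>) \<cdot> (\<r>\<^sup>\<odot> (\<J> \<odot> \<J>))\<inverse> = (\<r>\<^sup>\<odot> \<J>)\<inverse> \<cdot> m\<^sub>J"
      using circ.right_inv_natural [of m\<^sub>J] by simp
    finally show ?thesis by simp
  qed
  also have "\<mu> \<cdot> theta P H \<cdot> (\<langle>P\<rangle> \<bullet>\<^sub>a \<dots>) = \<mu> \<cdot> (theta P H \<cdot> (\<langle>P\<rangle> \<bullet>\<^sub>a (\<langle>\<J>\<rangle> \<odot>\<^sub>a (\<langle>\<I>\<rangle> \<bullet>\<^sub>a u)))) \<cdot>
      (\<langle>P\<rangle> \<bullet>\<^sub>a (\<langle>\<J>\<rangle> \<odot>\<^sub>a \<Delta>\<^sub>I)) \<cdot> (\<langle>P\<rangle> \<bullet>\<^sub>a ((\<r>\<^sup>\<odot> \<J>)\<inverse> \<cdot> m\<^sub>J \<cdot> (\<langle>\<J>\<rangle> \<odot>\<^sub>a e)))"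
    by (simp add: bull.merge circ.merge circ.merge_ext)
  also have "theta P H \<cdot> (\<langle>P\<rangle> \<bullet>\<^sub>a (\<langle>\<J>\<rangle> \<odot>\<^sub>a (\<langle>\<I>\<rangle> \<bullet>\<^sub>a u))) = (\<langle>P\<rangle> \<odot>\<^sub>a u) \<cdot> theta P \<I>"
    using theta_natural [of P u] by simp
  also have "\<mu> \<cdot> ((\<langle>P\<rangle> \<odot>\<^sub>a u) \<cdot> theta P \<I>) \<cdot> (\<langle>P\<rangle> \<bullet>\<^sub>a (\<langle>\<J>\<rangle> \<odot>\<^sub>a \<Delta>\<^sub>I)) \<cdot>
      (\<langle>P\<rangle> \<bullet>\<^sub>a ((\<r>\<^sup>\<odot> \<J>)\<inverse> \<cdot> m\<^sub>J \<cdot> (\<langle>\<J>\<rangle> \<odot>\<^sub>a e))) =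
      (\<mu> \<cdot> (\<langle>P\<rangle> \<odot>\<^sub>a u)) \<cdot> (theta P \<I> \<cdot> (\<langle>P\<rangle> \<bullet>\<^sub>a (\<langle>\<J>\<rangle> \<odot>\<^sub>a \<Delta>\<^sub>I))) \<cdot>
      (\<langle>P\<rangle> \<bullet>\<^sub>a ((\<r>\<^sup>\<odot> \<J>)\<inverse> \<cdot> m\<^sub>J \<cdot> (\<langle>\<J>\<rangle> \<odot>\<^sub>a e)))"
    by simp
  also have "\<dots> = \<r>\<^sup>\<bullet> P \<cdot> (\<langle>P\<rangle> \<bullet>\<^sub>a (m\<^sub>J \<cdot> (\<langle>\<J>\<rangle> \<odot>\<^sub>a e)))"
    unfolding theta_comult P.right_act_unit by (simp add: bull.merge)
  finally show ?thesis .
qed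

end

context galois_pair
begin

lemma galois_galois_bar:
  assumes "conv_id_right C H m d S = conv_unit_right C u e"
  shows "galois C H P \<mu> X Q \<rho> \<cdot> galois_bar C H S P \<mu> X Q \<rho> = \<langle>P \<bullet> (X \<odot> Q)\<rangle>"
proof -
  let ?n = "(S \<bullet>\<^sub>a \<langle>Q\<rangle>) \<cdot> \<rho>" and ?s = "(S \<bullet>\<^sub>a \<langle>H\<rangle>) \<cdot> d" and ?N = "H\<^sup>- \<bullet> H" and ?V = "X \<odot> Q"
  let ?z = "\<zeta> \<J> X H Q \<cdot> ((\<l>\<^sup>\<bullet> X)\<inverse> \<odot>\<^sub>a \<rho>)"
  have "galois C H P \<mu> X Q \<rho> \<cdot> galois_bar C H S P \<mu> X Q \<rho> =
      (\<mu> \<bullet>\<^sub>a \<langle>?V\<rangle>) \<cdot> (\<zeta> P X H Q \<cdot> ((\<mu> \<bullet>\<^sub>a \<langle>X\<rangle>) \<odot>\<^sub>a \<langle>H \<bullet> Q\<rangle>)) \<cdot>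
      ((\<langle>(P \<odot> H) \<bullet> X\<rangle> \<odot>\<^sub>a \<rho>) \<cdot> \<delta> P X H Q) \<cdot> (\<langle>P\<rangle> \<bullet>\<^sub>a (\<langle>X\<rangle> \<odot>\<^sub>a ?n))"
    by (simp add: galois_def galois_bar_def circ.merge_ext)
  also have "\<dots> = (\<mu> \<bullet>\<^sub>a \<langle>?V\<rangle>) \<cdot> (((\<mu> \<odot>\<^sub>a \<langle>H\<rangle>) \<bullet>\<^sub>a \<langle>?V\<rangle>) \<cdot> \<zeta> (P \<odot> H) X H Q) \<cdot>
      (\<delta> P X H (H \<bullet> Q) \<cdot> (\<langle>P\<rangle> \<bullet>\<^sub>a (\<langle>X\<rangle> \<odot>\<^sub>a (\<langle>H\<^sup>-\<rangle> \<bullet>\<^sub>a \<rho>)))) \<cdot> (\<langle>P\<rangle> \<bullet>\<^sub>a (\<langle>X\<rangle> \<odot>\<^sub>a ?n))"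
    using zeta_natural [of \<mu> "\<langle>X\<rangle>" "\<langle>H\<rangle>" "\<langle>Q\<rangle>"] delta_natural [of "\<langle>P\<rangle>" "\<langle>X\<rangle>" "\<langle>H\<rangle>" \<rho>] by simp
  also have "\<dots> = ((\<mu> \<cdot> (\<mu> \<odot>\<^sub>a \<langle>H\<rangle>)) \<bullet>\<^sub>a \<langle>?V\<rangle>) \<cdot> \<zeta> (P \<odot> H) X H Q \<cdot> \<delta> P X H (H \<bullet> Q) \<cdot>
      (\<langle>P\<rangle> \<bullet>\<^sub>a (\<langle>X\<rangle> \<odot>\<^sub>a ((\<langle>H\<^sup>-\<rangle> \<bullet>\<^sub>a \<rho>) \<cdot> ?n)))"
    by (simp add: bull.merge bull.merge_ext circ.merge)
  \<comment> \<open>Coassociativity of \<rho> rewrites the double coaction so that S acts on a leg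
    of d, the form that \<open>action_delta\<close> takes.\<close>
  also have "(\<langle>H\<^sup>-\<rangle> \<bullet>\<^sub>a \<rho>) \<cdot> ?n = \<alpha>\<^sup>\<bullet> (H\<^sup>-) H Q \<cdot> (?s \<bullet>\<^sub>a \<langle>Q\<rangle>) \<cdot> \<rho>"
  proof -
    have "(\<langle>H\<^sup>-\<rangle> \<bullet>\<^sub>a \<rho>) \<cdot> ?n = (S \<bullet>\<^sub>a \<langle>H \<bullet> Q\<rangle>) \<cdot> ((\<langle>H\<rangle> \<bullet>\<^sub>a \<rho>) \<cdot> \<rho>)"
      by (simp add: bull.merge_ext)
    also have "\<dots> = ((S \<bullet>\<^sub>a \<langle>H \<bullet> Q\<rangle>) \<cdot> \<alpha>\<^sup>\<bullet> H H Q) \<cdot> (d \<bullet>\<^sub>a \<langle>Q\<rangle>) \<cdot> \<rho>"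
      by (simp flip: Q.left_coact_comult)
    also have "(S \<bullet>\<^sub>a \<langle>H \<bullet> Q\<rangle>) \<cdot> \<alpha>\<^sup>\<bullet> H H Q = \<alpha>\<^sup>\<bullet> (H\<^sup>-) H Q \<cdot> ((S \<bullet>\<^sub>a \<langle>H\<rangle>) \<bullet>\<^sub>a \<langle>Q\<rangle>)"
      using bull.assoc_natural [of S "\<langle>H\<rangle>" "\<langle>Q\<rangle>"] by simp
    finally show ?thesis by (simp add: bull.merge_ext)
  qed
  also have "((\<mu> \<cdot> (\<mu> \<odot>\<^sub>a \<langle>H\<rangle>)) \<bullet>\<^sub>a \<langle>?V\<rangle>) \<cdot> \<zeta> (P \<odot> H) X H Q \<cdot> \<delta> P X H (H \<bullet> Q) \<cdot> (\<langle>P\<rangle> \<bullet>\<^sub>a (\<langle>X\<rangle> \<odot>\<^sub>a \<dots>)) =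
      ((\<mu> \<cdot> (\<mu> \<odot>\<^sub>a \<langle>H\<rangle>)) \<bullet>\<^sub>a \<langle>?V\<rangle>) \<cdot> (\<zeta> (P \<odot> H) X H Q \<cdot> \<delta> P X H (H \<bullet> Q) \<cdot>
      (\<langle>P\<rangle> \<bullet>\<^sub>a (\<langle>X\<rangle> \<odot>\<^sub>a \<alpha>\<^sup>\<bullet> (H\<^sup>-) H Q))) \<cdot> (\<langle>P\<rangle> \<bullet>\<^sub>a (\<langle>X\<rangle> \<odot>\<^sub>a ((?s \<bullet>\<^sub>a \<langle>Q\<rangle>) \<cdot> \<rho>)))"
    by (simp add: bull.merge circ.merge)
  also have "\<dots> = ((\<mu> \<cdot> (\<mu> \<odot>\<^sub>a \<langle>H\<rangle>) \<cdot> (\<r>\<^sup>\<bullet> (P \<odot> H) \<odot>\<^sub>a \<langle>H\<rangle>) \<cdot> \<delta> P \<J> H H) \<bullet>\<^sub>a \<langle>?V\<rangle>) \<cdot>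
      (\<alpha>\<^sup>\<bullet> P (\<J> \<odot> ?N) ?V)\<inverse> \<cdot> (\<langle>P\<rangle> \<bullet>\<^sub>a ((\<zeta> \<J> X ?N Q \<cdot> (\<langle>\<J> \<bullet> X\<rangle> \<odot>\<^sub>a (?s \<bullet>\<^sub>a \<langle>Q\<rangle>))) \<cdot> ((\<l>\<^sup>\<bullet> X)\<inverse> \<odot>\<^sub>a \<rho>)))"
    unfolding zeta_delta by (simp add: bull.merge bull.merge_ext circ.merge circ.merge_ext)
  also have "\<zeta> \<J> X ?N Q \<cdot> (\<langle>\<J> \<bullet> X\<rangle> \<odot>\<^sub>a (?s \<bullet>\<^sub>a \<langle>Q\<rangle>)) = ((\<langle>\<J>\<rangle> \<odot>\<^sub>a ?s) \<bullet>\<^sub>a \<langle>?V\<rangle>) \<cdot> \<zeta> \<J> X H Q"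
    using zeta_natural [of "\<langle>\<J>\<rangle>" "\<langle>X\<rangle>" ?s "\<langle>Q\<rangle>"] by simp
  also have "((\<mu> \<cdot> (\<mu> \<odot>\<^sub>a \<langle>H\<rangle>) \<cdot> (\<r>\<^sup>\<bullet> (P \<odot> H) \<odot>\<^sub>a \<langle>H\<rangle>) \<cdot> \<delta> P \<J> H H) \<bullet>\<^sub>a \<langle>?V\<rangle>) \<cdot>
      (\<alpha>\<^sup>\<bullet> P (\<J> \<odot> ?N) ?V)\<inverse> \<cdot> (\<langle>P\<rangle> \<bullet>\<^sub>a (\<dots> \<cdot> ((\<l>\<^sup>\<bullet> X)\<inverse> \<odot>\<^sub>a \<rho>))) =
      ((\<mu> \<cdot> (\<mu> \<odot>\<^sub>a \<langle>H\<rangle>) \<cdot> (\<r>\<^sup>\<bullet> (P \<odot> H) \<odot>\<^sub>a \<langle>H\<rangle>) \<cdot> \<delta> P \<J> H H) \<bullet>\<^sub>a \<langle>?V\<rangle>) \<cdot>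
      ((\<alpha>\<^sup>\<bullet> P (\<J> \<odot> ?N) ?V)\<inverse> \<cdot> (\<langle>P\<rangle> \<bullet>\<^sub>a ((\<langle>\<J>\<rangle> \<odot>\<^sub>a ?s) \<bullet>\<^sub>a \<langle>?V\<rangle>))) \<cdot> (\<langle>P\<rangle> \<bullet>\<^sub>a ?z)"
    by (simp add: bull.merge)
  also have "(\<alpha>\<^sup>\<bullet> P (\<J> \<odot> ?N) ?V)\<inverse> \<cdot> (\<langle>P\<rangle> \<bullet>\<^sub>a ((\<langle>\<J>\<rangle> \<odot>\<^sub>a ?s) \<bullet>\<^sub>a \<langle>?V\<rangle>)) =
      ((\<langle>P\<rangle> \<bullet>\<^sub>a (\<langle>\<J>\<rangle> \<odot>\<^sub>a ?s)) \<bullet>\<^sub>a \<langle>?V\<rangle>) \<cdot> (\<alpha>\<^sup>\<bullet> P (\<J> \<odot> H) ?V)\<inverse>"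
    using bull.assoc_inv_natural [of "\<langle>P\<rangle>" "\<langle>\<J>\<rangle> \<odot>\<^sub>a ?s" "\<langle>?V\<rangle>"] by simp
  also have "((\<mu> \<cdot> (\<mu> \<odot>\<^sub>a \<langle>H\<rangle>) \<cdot> (\<r>\<^sup>\<bullet> (P \<odot> H) \<odot>\<^sub>a \<langle>H\<rangle>) \<cdot> \<delta> P \<J> H H) \<bullet>\<^sub>a \<langle>?V\<rangle>) \<cdot> \<dots> \<cdot> (\<langle>P\<rangle> \<bullet>\<^sub>a ?z) =
      ((\<mu> \<cdot> (\<mu> \<odot>\<^sub>a \<langle>H\<rangle>) \<cdot> (\<r>\<^sup>\<bullet> (P \<odot> H) \<odot>\<^sub>a \<langle>H\<rangle>) \<cdot> \<delta> P \<J> H H \<cdot> (\<langle>P\<rangle> \<bullet>\<^sub>a (\<langle>\<J>\<rangle> \<odot>\<^sub>a ?s))) \<bullet>\<^sub>a \<langle>?V\<rangle>) \<cdot>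
      (\<alpha>\<^sup>\<bullet> P (\<J> \<odot> H) ?V)\<inverse> \<cdot> (\<langle>P\<rangle> \<bullet>\<^sub>a ?z)"
    by (simp add: bull.merge_ext)
  \<comment> \<open>S and \<mu> are eliminated here. What remains are unit data of \<bullet>
    together with e, removed by \<open>zeta_bull_left\<close> and the counit law of Q.\<close>
  also have "\<dots> = (\<r>\<^sup>\<bullet> P \<bullet>\<^sub>a \<langle>?V\<rangle>) \<cdot> (((\<langle>P\<rangle> \<bullet>\<^sub>a (m\<^sub>J \<cdot> (\<langle>\<J>\<rangle> \<odot>\<^sub>a e))) \<bullet>\<^sub>a \<langle>?V\<rangle>) \<cdot>
      (\<alpha>\<^sup>\<bullet> P (\<J> \<odot> H) ?V)\<inverse>) \<cdot> (\<langle>P\<rangle> \<bullet>\<^sub>a ?z)"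
    unfolding action_delta [OF P.right_module_in_axioms assms] by (simp add: bull.merge_ext)
  also have "\<dots> = ((\<r>\<^sup>\<bullet> P \<bullet>\<^sub>a \<langle>?V\<rangle>) \<cdot> (\<alpha>\<^sup>\<bullet> P \<J> ?V)\<inverse>) \<cdot> (\<langle>P\<rangle> \<bullet>\<^sub>a ((m\<^sub>J \<cdot> (\<langle>\<J>\<rangle> \<odot>\<^sub>a e)) \<bullet>\<^sub>a \<langle>?V\<rangle>)) \<cdot> (\<langle>P\<rangle> \<bullet>\<^sub>a ?z)"
    using circ.comp_extend [OF bull.assoc_inv_natural [of "\<langle>P\<rangle>" "m\<^sub>J \<cdot> (\<langle>\<J>\<rangle> \<odot>\<^sub>a e)" "\<langle>?V\<rangle>"]] by simp
  also have "\<dots> = \<langle>P\<rangle> \<bullet>\<^sub>a (\<l>\<^sup>\<bullet> ?V \<cdot> (m\<^sub>J \<bullet>\<^sub>a \<langle>?V\<rangle>) \<cdot>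
      (((\<langle>\<J>\<rangle> \<odot>\<^sub>a e) \<bullet>\<^sub>a \<langle>?V\<rangle>) \<cdot> \<zeta> \<J> X H Q) \<cdot> ((\<l>\<^sup>\<bullet> X)\<inverse> \<odot>\<^sub>a \<rho>))"
    unfolding bull.triangle_inv by (simp add: bull.merge bull.merge_ext)
  also have "((\<langle>\<J>\<rangle> \<odot>\<^sub>a e) \<bullet>\<^sub>a \<langle>?V\<rangle>) \<cdot> \<zeta> \<J> X H Q = \<zeta> \<J> X \<J> Q \<cdot> (\<langle>\<J> \<bullet> X\<rangle> \<odot>\<^sub>a (e \<bullet>\<^sub>a \<langle>Q\<rangle>))"
    using zeta_natural [of "\<langle>\<J>\<rangle>" "\<langle>X\<rangle>" e "\<langle>Q\<rangle>"] by simp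
  also have "\<l>\<^sup>\<bullet> ?V \<cdot> (m\<^sub>J \<bullet>\<^sub>a \<langle>?V\<rangle>) \<cdot> \<dots> \<cdot> ((\<l>\<^sup>\<bullet> X)\<inverse> \<odot>\<^sub>a \<rho>) =
      (\<l>\<^sup>\<bullet> ?V \<cdot> (m\<^sub>J \<bullet>\<^sub>a \<langle>?V\<rangle>) \<cdot> \<zeta> \<J> X \<J> Q) \<cdot> ((\<l>\<^sup>\<bullet> X)\<inverse> \<odot>\<^sub>a ((e \<bullet>\<^sub>a \<langle>Q\<rangle>) \<cdot> \<rho>))"
    by (simp add: circ.merge)
  also have "\<dots> = \<langle>?V\<rangle>"
    unfolding zeta_bull_left using Q.left_coact_counit by (simp add: circ.merge)
  finally show ?thesis by simp
qed

end

section \<open>Co-Galois maps\<close>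

context galois_bimonoid
begin

text \<open>The compatibility axioms of a bimonoid are symmetric under reversing both products, and
  S keeps its type because objects and \<open>rev_ob\<close> are unchanged.\<close>

lemma galois_bimonoid_reversal: "galois_bimonoid (reversal C) H m u d e S"
proof -
  have "monoid_in (reversal C) (circ (reversal C)) H m u"
    using circ.monoid_rev [OF monoid_in_axioms] by simp
  moreover have "comonoid_in (reversal C) (bull (reversal C)) H d e"
    using bull.comonoid_rev [OF comonoid_in_axioms] by simp
  moreover have "bimonoid_in_axioms (reversal C) H m u d e"
    using comult_mult counit_mult comult_unit counit_unit by (simp add: bimonoid_in_axioms_def)
  ultimately show ?thesis
    using galois_reversion_reversal S_hom
    by (simp add: galois_bimonoid_def bimonoid_in_def galois_bimonoid_axioms_def)
qed

text \<open>Modules and comodules change sides under reversal, so P and Q trade places; the formulas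
  then agree by definition.\<close>

lemma galois_reversal: "galois (reversal C) H P \<mu> X Q \<rho> = cogalois C H Q \<rho> X P \<mu>"
  and galois_bar_reversal: "galois_bar (reversal C) H S P \<mu> X Q \<rho> = cogalois_bar C H S Q \<rho> X P \<mu>"
  by (simp_all add: galois_def cogalois_def galois_bar_def cogalois_bar_def)

text \<open>Exchanging \<gamma> and \<delta> exchanges \<open>psi\<close> and \<open>varphi\<close>.
  This is why each statement on co-Galois maps carries the convolution equation opposite to that of
  its Galois counterpart.\<close>

lemma conv_reversal:
  "conv_id_left (reversal C) H m d S = conv_id_right C H m d S"
  "conv_id_right (reversal C) H m d S = conv_id_left C H m d S"
  "conv_unit_left (reversal C) u e = conv_unit_right C u e"
  "conv_unit_right (reversal C) u e = conv_unit_left C u e"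
  by (simp_all add: conv_id_left_def conv_id_right_def conv_unit_left_def conv_unit_right_def
      psi_def varphi_def)

lemma right_module_reversal:
  "left_module_in C (circ C) H m u Q \<mu> \<Longrightarrow>
    right_module_in (reversal C) (circ (reversal C)) H m u Q \<mu>"
  by (simp add: circ.left_module_rev)

lemma left_comodule_reversal:
  "right_comodule_in C (bull C) H d e P \<rho> \<Longrightarrow>
    left_comodule_in (reversal C) (bull (reversal C)) H d e P \<rho>"
  by (simp add: bull.right_comodule_rev)

lemma self_left_module: "left_module_in C (circ C) H m u H m"
  by unfold_locales (auto simp: mult_hom mult_assoc mult_unit_left)

lemma self_right_comodule: "right_comodule_in C (bull C) H d e H d"
  by unfold_locales (auto simp: comult_hom comult_coassoc comult_counit_right)

lemma galois_galois_bar_ident: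
  assumes "right_module_in C (circ C) H m u P \<mu>" "left_comodule_in C (bull C) H d e Q \<rho>"
    and "conv_id_right C H m d S = conv_unit_right C u e"
  shows "galois C H P \<mu> X Q \<rho> \<cdot> galois_bar C H S P \<mu> X Q \<rho> = \<langle>P \<bullet> (X \<odot> Q)\<rangle>"
  using galois_pair.galois_galois_bar [OF galois_pairI [OF assms(1,2)] assms(3)] .

lemma cogalois_self_iff:
  "cogalois_bar C H S H d \<I> H m \<cdot> cogalois C H H d \<I> H m = \<langle>H \<odot> (\<I> \<bullet> H)\<rangle> \<longleftrightarrow>
    conv_id_right C H m d S = conv_unit_right C u e"
  using galois_bimonoid.galois_self_iff [OF galois_bimonoid_reversal]
  by (simp add: galois_reversal galois_bar_reversal conv_reversal)

lemma cogalois_bar_cogalois_ident: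
  assumes "right_comodule_in C (bull C) H d e P \<rho>" "left_module_in C (circ C) H m u Q \<mu>"
    and "conv_id_right C H m d S = conv_unit_right C u e"
  shows "cogalois_bar C H S P \<rho> X Q \<mu> \<cdot> cogalois C H P \<rho> X Q \<mu> = \<langle>P \<odot> (X \<bullet> Q)\<rangle>"
  using galois_bimonoid.galois_bar_galois_ident [OF galois_bimonoid_reversal
      right_module_reversal [OF assms(2)] left_comodule_reversal [OF assms(1)], of X] assms(3)
  by (simp add: galois_reversal galois_bar_reversal conv_reversal)

lemma cogalois_cogalois_bar_ident:
  assumes "right_comodule_in C (bull C) H d e P \<rho>" "left_module_in C (circ C) H m u Q \<mu>"
    and "conv_id_left C H m d S = conv_unit_left C u e"
  shows "cogalois C H P \<rho> X Q \<mu> \<cdot> cogalois_bar C H S P \<rho> X Q \<mu> = \<langle>(P \<odot> X) \<bullet> Q\<rangle>"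
  using galois_bimonoid.galois_galois_bar_ident [OF galois_bimonoid_reversal
      right_module_reversal [OF assms(2)] left_comodule_reversal [OF assms(1)], of X] assms(3)
  by (simp add: galois_reversal galois_bar_reversal conv_reversal)

lemma galois_hom:
  assumes "right_module_in C (circ C) H m u P \<mu>" "left_comodule_in C (bull C) H d e Q \<rho>"
  shows "galois C H P \<mu> X Q \<rho> \<in> (P \<bullet> X) \<odot> Q \<rightarrow> P \<bullet> (X \<odot> Q)"
    and "galois_bar C H S P \<mu> X Q \<rho> \<in> P \<bullet> (X \<odot> Q) \<rightarrow> (P \<bullet> X) \<odot> Q"
proof -
  interpret galois_pair C H m u d e S P \<mu> Q \<rho> by (rule galois_pairI [OF assms])
  show "galois C H P \<mu> X Q \<rho> \<in> (P \<bullet> X) \<odot> Q \<rightarrow> P \<bullet> (X \<odot> Q)"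
    and "galois_bar C H S P \<mu> X Q \<rho> \<in> P \<bullet> (X \<odot> Q) \<rightarrow> (P \<bullet> X) \<odot> Q"
    by (simp_all add: galois_def galois_bar_def circ.hom_iff)
qed

lemma cogalois_hom:
  assumes "right_comodule_in C (bull C) H d e P \<rho>" "left_module_in C (circ C) H m u Q \<mu>"
  shows "cogalois C H P \<rho> X Q \<mu> \<in> P \<odot> (X \<bullet> Q) \<rightarrow> (P \<odot> X) \<bullet> Q"
    and "cogalois_bar C H S P \<rho> X Q \<mu> \<in> (P \<odot> X) \<bullet> Q \<rightarrow> P \<odot> (X \<bullet> Q)"
  using galois_bimonoid.galois_hom [OF galois_bimonoid_reversal
      right_module_reversal [OF assms(2)] left_comodule_reversal [OF assms(1)], of X]
  by (simp_all add: galois_reversal galois_bar_reversal)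

end

text \<open>The lax structure starts from the reversed product, whose left unit constraint is the
  right one of \<odot>; hence its unit laws appear with the constraints crossed.\<close>

lemma (in duoidal_reversion) galois_reversion: "galois_reversion C"
proof -
  interpret phi: lax_monoidal_endofunctor C "rev_tensor C (circ C)" "circ C" "rev_ob C" "rev_arr C" "\<phi>\<^sup>\<odot>" "\<phi>\<^sup>\<odot>\<^sub>0"
    by (rule phi_circ_lax)
  show ?thesis
  proof
    show "\<phi>\<^sup>\<odot> X Y \<in> X\<^sup>- \<odot> Y\<^sup>- \<rightarrow> (Y \<odot> X)\<^sup>-" for X Y
      using phi.lax_hom [of X Y] by simp
    show "\<phi>\<^sup>\<odot>\<^sub>0 \<in> \<I> \<rightarrow> \<I>\<^sup>-"
      using phi.lax_unit_hom by simp
    show "(\<r>\<^sup>\<odot> X)\<^sup>-\<^sub>a \<cdot> \<phi>\<^sup>\<odot> \<I> X \<cdot> (\<phi>\<^sup>\<odot>\<^sub>0 \<odot>\<^sub>a \<langle>X\<^sup>-\<rangle>) = \<l>\<^sup>\<odot> (X\<^sup>-)" for X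
      using phi.lax_left [of X] by simp
    show "(\<l>\<^sup>\<odot> X)\<^sup>-\<^sub>a \<cdot> \<phi>\<^sup>\<odot> X \<I> \<cdot> (\<langle>X\<^sup>-\<rangle> \<odot>\<^sub>a \<phi>\<^sup>\<odot>\<^sub>0) = \<r>\<^sup>\<odot> (X\<^sup>-)" for X
      using phi.lax_right [of X] by simp
  qed (rule phi.functor_hom phi.functor_ident phi.functor_comp gamma_hom gamma_nat delta_hom delta_nat
      R1 R2 R3 R4 R5 R6 R7 R8 R9; assumption?)+
qed

theorem theorem2p25:
  fixes C :: "('o, 'm) reversion" (structure)
    and H :: 'o and m u d e S :: 'm
  assumes "duoidal_reversion C"
    and "bimonoid_in C H m u d e"
    and "S \<in> H \<rightarrow> H\<^sup>-"
  shows
    "(((\<forall>P \<mu> X Q \<rho>. right_module_in C (circ C) H m u P \<mu> \<and> left_comodule_in C (bull C) H d e Q \<rho> \<longrightarrow>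
         galois_bar C H S P \<mu> X Q \<rho> \<cdot> galois C H P \<mu> X Q \<rho> = \<langle>(P \<bullet> X) \<odot> Q\<rangle>) \<longleftrightarrow>
      galois_bar C H S H m \<I> H d \<cdot> galois C H H m \<I> H d = \<langle>(H \<bullet> \<I>) \<odot> H\<rangle>) \<and>
     (galois_bar C H S H m \<I> H d \<cdot> galois C H H m \<I> H d = \<langle>(H \<bullet> \<I>) \<odot> H\<rangle> \<longleftrightarrow>
      conv_id_left C H m d S = conv_unit_left C u e)) \<and>
     (conv_id_right C H m d S = conv_unit_right C u e \<longrightarrow>
      (\<forall>P \<mu> X Q \<rho>. right_module_in C (circ C) H m u P \<mu> \<and> left_comodule_in C (bull C) H d e Q \<rho> \<longrightarrow>
         galois C H P \<mu> X Q \<rho> \<cdot> galois_bar C H S P \<mu> X Q \<rho> = \<langle>P \<bullet> (X \<odot> Q)\<rangle>)) \<and>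
     (((\<forall>P \<rho> X Q \<mu>. right_comodule_in C (bull C) H d e P \<rho> \<and> left_module_in C (circ C) H m u Q \<mu> \<longrightarrow>
         cogalois_bar C H S P \<rho> X Q \<mu> \<cdot> cogalois C H P \<rho> X Q \<mu> = \<langle>P \<odot> (X \<bullet> Q)\<rangle>) \<longleftrightarrow>
      cogalois_bar C H S H d \<I> H m \<cdot> cogalois C H H d \<I> H m = \<langle>H \<odot> (\<I> \<bullet> H)\<rangle>) \<and>
     (cogalois_bar C H S H d \<I> H m \<cdot> cogalois C H H d \<I> H m = \<langle>H \<odot> (\<I> \<bullet> H)\<rangle> \<longleftrightarrow>
      conv_id_right C H m d S = conv_unit_right C u e)) \<and>
     (conv_id_left C H m d S = conv_unit_left C u e \<longrightarrow>
      (\<forall>P \<rho> X Q \<mu>. right_comodule_in C (bull C) H d e P \<rho> \<and> left_module_in C (circ C) H m u Q \<mu> \<longrightarrow>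
         cogalois C H P \<rho> X Q \<mu> \<cdot> cogalois_bar C H S P \<rho> X Q \<mu> = \<langle>(P \<odot> X) \<bullet> Q\<rangle>)) \<and>
     (((\<forall>P \<mu> X Q \<rho>. right_module_in C (circ C) H m u P \<mu> \<and> left_comodule_in C (bull C) H d e Q \<rho> \<longrightarrow>
         is_iso C (galois C H P \<mu> X Q \<rho>) \<and>
         galois_bar C H S P \<mu> X Q \<rho> = (galois C H P \<mu> X Q \<rho>)\<inverse>) \<and>
      (\<forall>P \<rho> X Q \<mu>. right_comodule_in C (bull C) H d e P \<rho> \<and> left_module_in C (circ C) H m u Q \<mu> \<longrightarrow>
         is_iso C (cogalois C H P \<rho> X Q \<mu>) \<and>
         cogalois_bar C H S P \<rho> X Q \<mu> = (cogalois C H P \<rho> X Q \<mu>)\<inverse>)) \<longleftrightarrow>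
     antipode C H m u d e S)"
proof -
  interpret galois_bimonoid C H m u d e S
    using assms by (intro galois_bimonoid.intro duoidal_reversion.galois_reversion galois_bimonoid_axioms.intro)
  let ?M = "\<lambda>P \<mu> Q \<rho>. right_module_in C (circ C) H m u P \<mu> \<and> left_comodule_in C (bull C) H d e Q \<rho>"
  let ?N = "\<lambda>P \<rho> Q \<mu>. right_comodule_in C (bull C) H d e P \<rho> \<and> left_module_in C (circ C) H m u Q \<mu>"
  let ?l = "conv_id_left C H m d S = conv_unit_left C u e"
  let ?r = "conv_id_right C H m d S = conv_unit_right C u e"
  have galois_inv: "is_iso C (galois C H P \<mu> X Q \<rho>) \<and> galois_bar C H S P \<mu> X Q \<rho> = (galois C H P \<mu> X Q \<rho>)\<inverse> \<longleftrightarrow>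
      galois_bar C H S P \<mu> X Q \<rho> \<cdot> galois C H P \<mu> X Q \<rho> = \<langle>(P \<bullet> X) \<odot> Q\<rangle> \<and>
      galois C H P \<mu> X Q \<rho> \<cdot> galois_bar C H S P \<mu> X Q \<rho> = \<langle>P \<bullet> (X \<odot> Q)\<rangle>"
    if "?M P \<mu> Q \<rho>" for P \<mu> X Q \<rho>
    using that by (intro circ.iso_inv_eq_iff galois_hom) auto
  have cogalois_inv: "is_iso C (cogalois C H P \<rho> X Q \<mu>) \<and> cogalois_bar C H S P \<rho> X Q \<mu> = (cogalois C H P \<rho> X Q \<mu>)\<inverse> \<longleftrightarrow>
      cogalois_bar C H S P \<rho> X Q \<mu> \<cdot> cogalois C H P \<rho> X Q \<mu> = \<langle>P \<odot> (X \<bullet> Q)\<rangle> \<and>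
      cogalois C H P \<rho> X Q \<mu> \<cdot> cogalois_bar C H S P \<rho> X Q \<mu> = \<langle>(P \<odot> X) \<bullet> Q\<rangle>"
    if "?N P \<rho> Q \<mu>" for P \<rho> X Q \<mu>
    using that by (intro circ.iso_inv_eq_iff cogalois_hom) auto
  \<comment> \<open>H with m and d is itself an admissible choice of module and comodule, so the
    general identities specialise to the instance at H, \<I>, H.\<close>
  have M: "?M H m H d" using self_right_module self_left_comodule by blast
  have N: "?N H d H m" using self_left_module self_right_comodule by blast
  have antipode: "antipode C H m u d e S \<longleftrightarrow> ?l \<and> ?r"
    using assms(3) by (simp add: antipode_def)
  have 1: "galois_bar C H S P \<mu> X Q \<rho> \<cdot> galois C H P \<mu> X Q \<rho> = \<langle>(P \<bullet> X) \<odot> Q\<rangle>"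
    if ?l "?M P \<mu> Q \<rho>" for P \<mu> X Q \<rho>
    using that galois_bar_galois_ident by blast
  have 2: "galois C H P \<mu> X Q \<rho> \<cdot> galois_bar C H S P \<mu> X Q \<rho> = \<langle>P \<bullet> (X \<odot> Q)\<rangle>"
    if ?r "?M P \<mu> Q \<rho>" for P \<mu> X Q \<rho>
    using that galois_galois_bar_ident by blast
  have 3: "cogalois_bar C H S P \<rho> X Q \<mu> \<cdot> cogalois C H P \<rho> X Q \<mu> = \<langle>P \<odot> (X \<bullet> Q)\<rangle>"
    if ?r "?N P \<rho> Q \<mu>" for P \<mu> X Q \<rho>
    using that cogalois_bar_cogalois_ident by blast
  have 4: "cogalois C H P \<rho> X Q \<mu> \<cdot> cogalois_bar C H S P \<rho> X Q \<mu> = \<langle>(P \<odot> X) \<bullet> Q\<rangle>"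
    if ?l "?N P \<rho> Q \<mu>" for P \<mu> X Q \<rho>
    using that cogalois_cogalois_bar_ident by blast
  show ?thesis
  proof (intro conjI)
    show "(\<forall>P \<mu> X Q \<rho>. ?M P \<mu> Q \<rho> \<longrightarrow>
         galois_bar C H S P \<mu> X Q \<rho> \<cdot> galois C H P \<mu> X Q \<rho> = \<langle>(P \<bullet> X) \<odot> Q\<rangle>) \<longleftrightarrow>
      galois_bar C H S H m \<I> H d \<cdot> galois C H H m \<I> H d = \<langle>(H \<bullet> \<I>) \<odot> H\<rangle>"
      using 1 M galois_self_iff by blast
    show "(\<forall>P \<rho> X Q \<mu>. ?N P \<rho> Q \<mu> \<longrightarrow>
         cogalois_bar C H S P \<rho> X Q \<mu> \<cdot> cogalois C H P \<rho> X Q \<mu> = \<langle>P \<odot> (X \<bullet> Q)\<rangle>) \<longleftrightarrow>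
      cogalois_bar C H S H d \<I> H m \<cdot> cogalois C H H d \<I> H m = \<langle>H \<odot> (\<I> \<bullet> H)\<rangle>"
      using 3 N cogalois_self_iff by blast
    show "((\<forall>P \<mu> X Q \<rho>. ?M P \<mu> Q \<rho> \<longrightarrow>
         is_iso C (galois C H P \<mu> X Q \<rho>) \<and>
         galois_bar C H S P \<mu> X Q \<rho> = (galois C H P \<mu> X Q \<rho>)\<inverse>) \<and>
      (\<forall>P \<rho> X Q \<mu>. ?N P \<rho> Q \<mu> \<longrightarrow>
         is_iso C (cogalois C H P \<rho> X Q \<mu>) \<and>
         cogalois_bar C H S P \<rho> X Q \<mu> = (cogalois C H P \<rho> X Q \<mu>)\<inverse>)) \<longleftrightarrow> antipode C H m u d e S" (is "?G \<and> ?K \<longleftrightarrow> _")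
    proof
      \<comment> \<open>At H, \<I>, H the left inverse property of \<kappa> gives the equation for
        Id \<star> S, and that of the co-Galois map gives the one for S \<star> Id.\<close>
      assume "?G \<and> ?K"
      then show "antipode C H m u d e S"
        using M N galois_inv cogalois_inv galois_self_iff cogalois_self_iff antipode by blast
    next
      assume "antipode C H m u d e S"
      then have "?l" "?r" using antipode by auto
      then show "?G \<and> ?K"
        by (simp add: galois_inv cogalois_inv 1 2 3 4)
    qed
  qed (use 2 4 galois_self_iff cogalois_self_iff in blast)+
qed

end
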